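(* Let $F$ be a graph which is $r$-semi-bounded (with respect to a triple $(S,T,v^* )$) and which contains a cycle. Then there exists a constant $C>0$ such that for every $p=p(n)$ with $n^{-a(F)}(\log n)^C\le p\le 1$ we have a.a.s. \[\mathrm{ex}(G_{n,p},F)=O\left(p^{1-1/r}n^{2-1/r}\right).\]
   Context: All graphs are finite and simple. Let $r\ge1$ be an integer. A bipartite graph $F$ is $r$-semi-bounded with respect to a triple $(S,T,v^* )$ if $S\cup T$ is a bipartition of $F$, $v^*\in T$ is adjacent to every vertex in $S$, and every $v\in T\setminus\{v^*\}$ has $\deg_F(v)\le r$. For $\nu\subseteq V(F)$ let $e(\nu):=e(F[\nu])$ be the number of edges of the induced subgraph $F[\nu]$, and if $e(\nu)\ge1$ let \[f(\nu):=|S\cap\nu|+\sum_{v\in T\cap\nu}\deg_F(v)-\max_{v\in T\cap\nu:\ \deg_{F[\nu]}(v)\ge1}\deg_F(v).\] Let $A_F$ be the set of (nonempty) $\nu\subseteq V(F)$ such that $F[\nu]$ has minimum degree $\delta(F[\nu])\ge1$ and $f(\nu)-1<r(e(\nu)-1)$. For $\nu\in A_F$ let \[a(\nu)=\frac{r(|\nu|-2)+1-f(\nu)}{r(e(\nu)-1)+1-f(\nu)},\qquad a(F)=\min_{\nu\in A_F}a(\nu).\] (The set $A_F$ is nonempty when $F$ contains a cycle.) The quantity $a(F)$ depends on $r$ and the triple, which are fixed. $G_{n,p}$ is the random graph on $n$ vertices in which each possible edge is included independently with probability $p$, and $\mathrm{ex}(G_{n,p},F)$ is the maximum number of edges in an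 $F$-free subgraph of $G_{n,p}$. A sequence of events $A_n$ holds asymptotically almost surely (a.a.s.) if $\Pr[A_n]\to1$ as $n\to\infty$; "a.a.s. $X_n=O(g(n))$" means there is a constant $K>0$ depending only on the fixed data ($F$, $r$, the triple) such that a.a.s. $X_n\le Kg(n)$. *)

theory Defs
  imports "HOL-Probability.Probability"
begin

type_synonym 'a ugraph = "'a set \<times> 'a set set"

abbreviation verts :: "'a ugraph \<Rightarrow> 'a set" where "verts G \<equiv> fst G"
abbreviation edges :: "'a ugraph \<Rightarrow> 'a set set" where "edges G \<equiv> snd G"

definition simple_graph :: "'a ugraph \<Rightarrow> bool" where
  "simple_graph G \<longleftrightarrow> finite (verts G) \<and> (\<forall>e\<in>edges G. e \<subseteq> verts G \<and> card e = 2)"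

definition degree :: "'a ugraph \<Rightarrow> 'a \<Rightarrow> nat" where
  "degree G v = card {e \<in> edges G. v \<in> e}"

definition min_degree :: "'a ugraph \<Rightarrow> nat" where
  "min_degree G = Min (degree G ` verts G)"

definition induced :: "'a ugraph \<Rightarrow> 'a set \<Rightarrow> 'a ugraph" where
  "induced G W = (W, {e \<in> edges G. e \<subseteq> W})"

definition subgraph :: "'a ugraph \<Rightarrow> 'a ugraph \<Rightarrow> bool" where
  "subgraph H G \<longleftrightarrow> simple_graph H \<and> verts H \<subseteq> verts G \<and> edges H \<subseteq> edges G"

definition contains_cycle :: "'a ugraph \<Rightarrow> bool" where
  "contains_cycle G \<longleftrightarrow>
     (\<exists>vs. length vs \<ge> 3 \<and> distinct vs \<and> set vs \<subseteq> verts G \<and>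
        (\<forall>i<length vs. {vs ! i, vs ! (Suc i mod length vs)} \<in> edges G))"

text \<open>A copy of \<open>F\<close> in \<open>G\<close> is a not necessarily induced subgraph of \<open>G\<close> isomorphic to \<open>F\<close>.\<close>

definition contains_copy :: "'a ugraph \<Rightarrow> 'b ugraph \<Rightarrow> bool" where
  "contains_copy F G \<longleftrightarrow>
     (\<exists>\<phi>. inj_on \<phi> (verts F) \<and> \<phi> ` verts F \<subseteq> verts G \<and>
        (\<forall>e\<in>edges F. \<phi> ` e \<in> edges G))"

definition extremal_number :: "'b ugraph \<Rightarrow> 'a ugraph \<Rightarrow> nat" where
  "extremal_number G F =
     Max {card (edges H) | H. subgraph H G \<and> \<not> contains_copy F H}"

definition random_graph :: "nat \<Rightarrow> real \<Rightarrow> nat ugraph pmf" where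
  "random_graph n p =
     (let P = {e. e \<subseteq> {..<n} \<and> card e = 2}
      in map_pmf (\<lambda>X. ({..<n}, {e \<in> P. X e})) (Pi_pmf P False (\<lambda>_. bernoulli_pmf p)))"

definition bipartition :: "'a ugraph \<Rightarrow> 'a set \<Rightarrow> 'a set \<Rightarrow> bool" where
  "bipartition F S T \<longleftrightarrow> S \<union> T = verts F \<and> S \<inter> T = {} \<and>
     (\<forall>e\<in>edges F. \<exists>s\<in>S. \<exists>t\<in>T. e = {s, t})"

definition semi_bounded :: "nat \<Rightarrow> 'a ugraph \<Rightarrow> 'a set \<Rightarrow> 'a set \<Rightarrow> 'a \<Rightarrow> bool" where
  "semi_bounded r F S T vstar \<longleftrightarrow> bipartition F S T \<and> vstar \<in> T \<and>
     (\<forall>s\<in>S. {s, vstar} \<in> edges F) \<and> (\<forall>v\<in>T - {vstar}. degree F v \<le> r)"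

definition e_num :: "'a ugraph \<Rightarrow> 'a set \<Rightarrow> nat" where
  "e_num F \<nu> = card (edges (induced F \<nu>))"

text \<open>Only meaningful if \<open>e_num F \<nu> \<ge> 1\<close>; otherwise the maximum is over the empty set.\<close>

definition f_val :: "'a ugraph \<Rightarrow> 'a set \<Rightarrow> 'a set \<Rightarrow> 'a set \<Rightarrow> real" where
  "f_val F S T \<nu> = real (card (S \<inter> \<nu>)) + (\<Sum>v\<in>T \<inter> \<nu>. real (degree F v))
     - real (Max (degree F ` {v \<in> T \<inter> \<nu>. degree (induced F \<nu>) v \<ge> 1}))"

definition A_set :: "nat \<Rightarrow> 'a ugraph \<Rightarrow> 'a set \<Rightarrow> 'a set \<Rightarrow> 'a set set" where
  "A_set r F S T = {\<nu>. \<nu> \<subseteq> verts F \<and> \<nu> \<noteq> {} \<and> min_degree (induced F \<nu>) \<ge> 1 \<and>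
     f_val F S T \<nu> - 1 < real r * (real (e_num F \<nu>) - 1)}"

definition a_val :: "nat \<Rightarrow> 'a ugraph \<Rightarrow> 'a set \<Rightarrow> 'a set \<Rightarrow> 'a set \<Rightarrow> real" where
  "a_val r F S T \<nu> =
     (real r * (real (card \<nu>) - 2) + 1 - f_val F S T \<nu>) /
     (real r * (real (e_num F \<nu>) - 1) + 1 - f_val F S T \<nu>)"

text \<open>For semi-bounded \<open>F\<close> the minimum is over a nonempty set as soon as \<open>F\<close> contains a cycle.\<close>

definition a_exponent :: "nat \<Rightarrow> 'a ugraph \<Rightarrow> 'a set \<Rightarrow> 'a set \<Rightarrow> real" where
  "a_exponent r F S T = Min (a_val r F S T ` A_set r F S T)"

end

theory Submission imports Defs begin

text \<open>An \<open>F\<close>-free subgraph of \<open>G_{n,p}\<close> is an independent set of the hypergraph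
  whose vertices are the edges of \<open>K_n\<close> and whose hyperedges are the edge sets of the
  copies of \<open>F\<close>, unless it has fewer vertices than \<open>F\<close> and hence
  \<open>O(1)\<close> edges. Put \<open>m = p^{1-1/r} n^{2-1/r}\<close> and let \<open>Z_C(x)\<close>
  be the sum of \<open>x^|I|\<close> over the \<open>F\<close>-free \<open>I \<subseteq> C\<close>. A
  union bound gives \<open>P(ex > K m) \<le> \<Sum>{p^|I| : |I| > K m} \<le> 2^{-K m} Z(2 p)\<close>,
  where \<open>Z\<close> is taken over all pairs, so the theorem follows from
  \<open>Z(2 p) \<le> exp (O(m))\<close>.

  This is the container method, used in the form of a recursion for \<open>Z\<close> (lemma
  \<open>container_bound\<close>): if some family of \<open>e\<close> copies of \<open>F\<close>
  inside \<open>C\<close> has at most \<open>K \<tau>^{j-1} e / |C|\<close> members through every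
  \<open>j\<close>-set, then \<open>Z_C\<close> is at most \<open>z^t (1 + x/z)^|C|\<close> times some
  \<open>Z_{C'}\<close>, where \<open>t\<close> is of order \<open>\<tau> |C|\<close>,
  \<open>z \<ge> 1\<close> is arbitrary and \<open>C'\<close> is smaller than \<open>C\<close> by a
  constant factor. The recursion stops once \<open>|C| = O(p^{-1/r} n^{2-1/r})\<close>, where the
  trivial bound \<open>(1 + 2 p)^|C|\<close> is already \<open>exp (O(m))\<close>.

  The required family is a random-like number \<open>n^v q^e\<close> of copies, with \<open>q\<close>
  of order \<open>|C| / n^2\<close>. Embed \<open>v*\<close> first, then \<open>S\<close> into its
  neighbourhood, then every other vertex of \<open>T\<close> into the common neighbourhood of at most
  \<open>r\<close> vertices. Neither degrees nor codegrees of \<open>C\<close> are regular; both are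
  made so by cutting every neighbourhood into blocks of one fixed size of order \<open>n q\<close>,
  and every common neighbourhood of \<open>d\<close> vertices into blocks of one fixed size of order
  \<open>n q^d\<close>, and by asking that the image of \<open>b\<close> lies in the same block as the
  image of \<open>v*\<close>. Lemma \<open>card_embs_ge\<close> says that this loses only a constant
  factor. Conversely at most \<open>n^{v-|\<nu>|} q^{e-f(\<nu>)}\<close> of these embeddings extend a
  given embedding of \<open>\<nu>\<close> (lemma \<open>extension_bound\<close>), and this is the
  origin of \<open>f\<close>: if \<open>v* \<notin> \<nu>\<close>, the vertex
  \<open>v \<in> \<nu>\<close> of maximum degree is used to reach \<open>v*\<close>, by embedding
  first the neighbours of \<open>v\<close> and then \<open>v*\<close> inside the block of
  \<open>v\<close>.

  Write \<open>q = k n^{-1/r}\<close>. The codegree condition for \<open>\<nu>\<close> becomes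
  \<open>\<tau>^{e(\<nu>)-1} n^{|\<nu>|-2} q^{f(\<nu>)-1} \<ge> 1\<close>, and
  \<open>\<tau> = max (k^{-r}) (w / k)\<close> with \<open>w = p^{1-1/r} / log^3 n\<close> satisfies
  it: the first term serves the \<open>\<nu>\<close> with
  \<open>f(\<nu>) - 1 \<ge> r (e(\<nu>) - 1)\<close>, the second one the
  \<open>\<nu> \<in> A_F\<close>, for which it is the inequality
  \<open>p \<ge> n^{-a(\<nu>)} log^C n\<close> (lemma \<open>log_tau_bound\<close>). When
  \<open>|C|\<close> is \<open>u\<close> times the final size, the first term contributes
  \<open>O(m u^{-1/2})\<close> to \<open>log Z\<close>, a geometric series over the steps, and the
  second one \<open>O(m / log^2 n)\<close> in each of \<open>O(log n)\<close> steps (lemmas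
  \<open>container_step_numeric\<close> and \<open>indep_sum_all_pairs_le\<close>).\<close>

section \<open>A container inequality for generating functions of independent sets\<close>

text \<open>The set \<open>S\<close> holds the vertices already decided to be in the independent set; they carry
  no weight, so that a branching on a vertex \<open>v\<close> multiplies one of the two branches by
  \<open>x\<close>.\<close>

definition indep_sum :: "('v set \<Rightarrow> bool) \<Rightarrow> real \<Rightarrow> 'v set \<Rightarrow> 'v set \<Rightarrow> real" where
  "indep_sum P x S C = (\<Sum>I | I \<subseteq> C \<and> P (I \<union> S). x ^ card I)"

lemma indep_sum_branch:
  assumes "finite C" "v \<in> C"
  shows "indep_sum P x S C = indep_sum P x S (C - {v}) + x * indep_sum P x (insert v S) (C - {v})"
proof -
  let ?A = "{I. I \<subseteq> C - {v} \<and> P (I \<union> S)}" and ?B = "{I. I \<subseteq> C - {v} \<and> P (I \<union> insert v S)}"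
  have fin: "finite ?A" "finite ?B"
    using assms by auto
  have eq: "{I. I \<subseteq> C \<and> P (I \<union> S)} = ?A \<union> insert v ` ?B" (is "?L = _")
  proof (intro equalityI subsetI)
    fix I assume I: "I \<in> ?L"
    show "I \<in> ?A \<union> insert v ` ?B"
    proof (cases "v \<in> I")
      case True
      have "I = insert v (I - {v})" using True by auto
      moreover have "I - {v} \<in> ?B"
      proof -
        have "(I - {v}) \<union> insert v S = I \<union> S" using True by auto
        then show ?thesis using I by auto
      qed
      ultimately show ?thesis by blast
    next
      case False then show ?thesis using I by auto
    qed
  next
    fix I assume "I \<in> ?A \<union> insert v ` ?B"
    then show "I \<in> ?L" using assms(2) by auto
  qed
  have "indep_sum P x S C = (\<Sum>I\<in>?A. x ^ card I) + (\<Sum>I\<in>insert v ` ?B. x ^ card I)"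
    unfolding indep_sum_def eq using fin by (intro sum.union_disjoint) auto
  also have "(\<Sum>I\<in>insert v ` ?B. x ^ card I) = (\<Sum>I\<in>?B. x ^ card (insert v I))"
    by (rule sum.reindex_cong[where l = "insert v"]) (auto simp: inj_on_def)
  also have "\<dots> = (\<Sum>I\<in>?B. x * x ^ card I)"
  proof (intro sum.cong refl)
    fix I assume "I \<in> ?B"
    then have "finite I" "v \<notin> I" using assms(1) finite_subset by auto
    then show "x ^ card (insert v I) = x * x ^ card I" by simp
  qed
  finally show ?thesis unfolding indep_sum_def by (simp add: sum_distrib_left)
qed

lemma indep_sum_drop_condition:
  assumes "finite C" "x \<ge> 0" "\<And>A B. P B \<Longrightarrow> A \<subseteq> B \<Longrightarrow> P A"
  shows "indep_sum P x S C \<le> indep_sum P x {} C"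
  unfolding indep_sum_def using assms by (intro sum_mono2) auto

lemma indep_sum_eq_0:
  assumes "\<not> P S" "\<And>A B. P B \<Longrightarrow> A \<subseteq> B \<Longrightarrow> P A"
  shows "indep_sum P x S C = 0"
proof -
  have "{I. I \<subseteq> C \<and> P (I \<union> S)} = {}" using assms by blast
  then show ?thesis unfolding indep_sum_def by (simp only: sum.empty)
qed

lemma indep_sum_le_all:
  assumes "finite C" "x \<ge> 0"
  shows "indep_sum P x S C \<le> (1 + x) ^ card C"
proof -
  have "indep_sum P x S C \<le> (\<Sum>I\<in>Pow C. x ^ card I)"
    unfolding indep_sum_def using assms by (intro sum_mono2) auto
  also have "\<dots> = (\<Prod>c\<in>C. x + 1)"
    using prod_add[OF assms(1), of "\<lambda>_. x" "\<lambda>_. 1"] by simp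
  also have "\<dots> = (1 + x) ^ card C" by (simp add: add.commute)
  finally show ?thesis .
qed

text \<open>The vertices below the threshold carry at most half of the total degree, and no vertex carries more
  than \<open>K e / |V|\<close>, so many vertices must lie above it. These are the vertices that a
  container avoids.\<close>

lemma many_high_degree_vertices:
  fixes h :: "'i \<Rightarrow> 'v set" and K e :: real
  assumes V: "finite V" "V \<noteq> {}" and A: "finite A" and e: "e > 0" and K: "K > 0"
    and h: "\<And>i. i \<in> A \<Longrightarrow> h i \<subseteq> V \<and> h i \<noteq> {}"
    and deg: "\<And>v. v \<in> V \<Longrightarrow> real (card {i \<in> A. v \<in> h i}) \<le> K * e / card V"
    and large: "real (card A) \<ge> e / 2"
  shows "real (card {v \<in> V. real (card {i \<in> A. v \<in> h i}) \<ge> e / (4 * card V)}) \<ge> card V / (4 * K)"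
proof -
  define W where "W = {v \<in> V. real (card {i \<in> A. v \<in> h i}) \<ge> e / (4 * card V)}"
  have N: "real (card V) > 0" using V by (simp add: card_gt_0_iff)
  have WV: "W \<subseteq> V" unfolding W_def by auto
  have "e / 2 \<le> real (card A)" by (rule large)
  also have "\<dots> = (\<Sum>i\<in>A. 1)" by simp
  also have "\<dots> \<le> (\<Sum>i\<in>A. real (card (h i)))"
  proof (intro sum_mono)
    fix i assume "i \<in> A"
    then have "finite (h i)" "h i \<noteq> {}" using h V(1) finite_subset[of "h i" V] by auto
    then have "card (h i) > 0" by (simp add: card_gt_0_iff)
    then show "1 \<le> real (card (h i))" by simp
  qed
  also have "\<dots> = real (\<Sum>i\<in>A. card {v \<in> V. v \<in> h i})"
  proof -
    have "{v \<in> V. v \<in> h i} = h i" if "i \<in> A" for i using h[OF that] by auto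
    then show ?thesis by simp
  qed
  also have "\<dots> = real (\<Sum>v\<in>V. card {i \<in> A. v \<in> h i})"
    using sum_multicount_gen[OF A V(1), of "\<lambda>i v. v \<in> h i" "\<lambda>v. card {i \<in> A. v \<in> h i}"] by simp
  also have "\<dots> = (\<Sum>v\<in>W. real (card {i \<in> A. v \<in> h i})) + (\<Sum>v\<in>V - W. real (card {i \<in> A. v \<in> h i}))"
    using sum.subset_diff[OF WV V(1), of "\<lambda>v. real (card {i \<in> A. v \<in> h i})"] by simp
  also have "\<dots> \<le> (\<Sum>v\<in>W. K * e / card V) + (\<Sum>v\<in>V - W. e / (4 * card V))"
    using deg WV by (intro add_mono sum_mono) (auto simp: W_def)
  also have "\<dots> \<le> card W * (K * e / card V) + card V * (e / (4 * card V))"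
  proof -
    have "card (V - W) \<le> card V" using V(1) by (intro card_mono) auto
    then have "card (V - W) * (e / (4 * card V)) \<le> card V * (e / (4 * card V))"
      using e by (intro mult_right_mono) auto
    then show ?thesis by simp
  qed
  also have "card V * (e / (4 * card V)) = e / 4" using N by simp
  finally have "e / 4 \<le> card W * (K * e / card V)" by linarith
  then have "card V / (4 * K) \<le> card W"
    using e K N by (simp add: field_simps)
  then show ?thesis unfolding W_def .
qed

lemma sum_codegrees:
  fixes g :: "'i \<Rightarrow> 'v set"
  assumes "finite V" "finite G" "\<And>i. i \<in> G \<Longrightarrow> g i \<subseteq> V \<and> card (g i) \<le> l"
  shows "(\<Sum>X\<in>Pow V. card {i \<in> G. X \<subseteq> g i}) \<le> 2 ^ l * card G"
proof -
  have "(\<Sum>X\<in>Pow V. card {i \<in> G. X \<subseteq> g i}) = (\<Sum>i\<in>G. card {X \<in> Pow V. X \<subseteq> g i})"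
    using sum_multicount_gen[OF assms(2), of "Pow V" "\<lambda>i X. X \<subseteq> g i" "\<lambda>X. card {i \<in> G. X \<subseteq> g i}"] assms(1)
    by simp
  also have "\<dots> \<le> (\<Sum>i\<in>G. 2 ^ l)"
  proof (intro sum_mono)
    fix i assume i: "i \<in> G"
    have "{X \<in> Pow V. X \<subseteq> g i} = Pow (g i)" using assms(3)[OF i] by auto
    then have "card {X \<in> Pow V. X \<subseteq> g i} = 2 ^ card (g i)"
      using card_Pow finite_subset assms(1,3) i by metis
    also have "(2::nat) ^ card (g i) \<le> 2 ^ l" using assms(3)[OF i] by (simp add: power_increasing)
    finally show "card {X \<in> Pow V. X \<subseteq> g i} \<le> 2 ^ l" .
  qed
  finally show ?thesis by (simp add: mult.commute)
qed

text \<open>Induction on the uniformity \<open>l\<close>. Inside one level the vertices of \<open>C\<close> are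
  examined one at a time, and only those of large degree in the current hypergraph \<open>A\<close>.
  If such a vertex \<open>v\<close> is outside the independent set, it is deleted from
  \<open>C\<close>. If it is inside, its link is added to the hypergraph \<open>G\<close> of smaller
  uniformity, whose members no independent set containing \<open>S\<close> can contain. Hyperedges
  through a set \<open>X\<close> that already has at least half of the permitted degree in
  \<open>G\<close> are dropped from \<open>A\<close>; this keeps the degree condition for
  \<open>G\<close> at the cost of a small fraction of \<open>A\<close>. After \<open>b\<close>
  vertices inside the independent set, \<open>G\<close> has a proportion \<open>\<tau>/4\<close> of
  the hyperedges and the induction hypothesis applies to it; if the process stops earlier, no vertex
  of \<open>C\<close> has large degree in \<open>A\<close>, so \<open>C\<close> is a container. The
  binary tree of decisions with at most \<open>t\<close> inner choices has weight at most
  \<open>\<Sum>{j \<le> t} (|C| choose j) x^j\<close>; the larger function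
  \<open>z^t (1 + x/z)^|C|\<close> satisfies Pascal's recursion exactly, which makes the induction on
  \<open>C\<close> close.

  A hyperedge is represented by its index \<open>i\<close>, and the map from indices to sets changes
  when a link is taken. Every index moves to \<open>G\<close> at most once, so multiplicities of links
  need no separate treatment.\<close>

lemma container_bound:
  fixes P :: "'v set \<Rightarrow> bool" and h :: "'i \<Rightarrow> 'v set" and \<tau> x z e K Kmax \<kappa> M :: real
  assumes V: "finite V" "V \<noteq> {}"
    and P: "\<And>A B. P B \<Longrightarrow> A \<subseteq> B \<Longrightarrow> P A"
    and x: "x \<ge> 0" and z: "z \<ge> 1" and \<tau>: "0 < \<tau>" "\<tau> \<le> 1" and b: "\<tau> * card V \<le> real b"
    and \<kappa>: "\<kappa> \<ge> 2 ^ (l + 3)"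
    and M: "M \<ge> 0"
      "\<And>C'. C' \<subseteq> V \<Longrightarrow> real (card C') \<le> card V - card V / (4 * Kmax) \<Longrightarrow> indep_sum P x {} C' \<le> M"
    and J: "finite J" "real (card J) \<ge> e" "e > 0" and K: "K > 0" "K * \<kappa> ^ l \<le> Kmax"
    and h: "\<And>i. i \<in> J \<Longrightarrow> h i \<subseteq> V \<and> card (h i) \<le> l \<and> \<not> P (h i \<union> S)"
    and deg: "\<And>X. X \<noteq> {} \<Longrightarrow> X \<subseteq> V \<Longrightarrow>
       real (card {i \<in> J. X \<subseteq> h i}) \<le> K * \<tau> ^ (card X - 1) * e / card V"
    and C: "C \<subseteq> V"
  shows "indep_sum P x S C \<le> z ^ (l * b) * (1 + x / z) ^ card C * M"
  using \<kappa> J K h deg C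
proof (induction l arbitrary: J h S C e K)
  case 0
  from 0(3,4) have "J \<noteq> {}" by auto
  then obtain i where i: "i \<in> J" by auto
  have "h i = {}" using 0(7)[OF i] V finite_subset by fastforce
  then have "\<not> P S" using 0(7)[OF i] by simp
  then have "indep_sum P x S C = 0" using indep_sum_eq_0 P by metis
  then show ?case using z x M by simp
next
  case (Suc l)
  note J = \<open>finite J\<close> \<open>e \<le> real (card J)\<close> \<open>e > 0\<close>
  note K = \<open>K > 0\<close> \<open>K * \<kappa> ^ Suc l \<le> Kmax\<close>
  note h = Suc.prems(7) and deg = Suc.prems(8)
  define N where "N = real (card V)"
  have N: "N > 0" using V unfolding N_def by (simp add: card_gt_0_iff)
  define e' where "e' = \<tau> * e / 4"
  define K' where "K' = \<kappa> * K"
  define \<delta> where "\<delta> = e / (4 * N)"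
  have \<kappa>: "\<kappa> \<ge> 2 ^ (l + 4)" using Suc.prems(1) by (simp add: add.commute)
  have \<kappa>8: "\<kappa> \<ge> 16" using \<kappa> power_increasing[of 4 "l+4" "2::real"] by simp
  have \<kappa>': "\<kappa> \<ge> 2 ^ (l + 3)" using \<kappa> power_increasing[of "l+3" "l+4" "2::real"] by linarith
  have e': "e' > 0" unfolding e'_def using \<tau> J by simp
  have K': "K' > 0" "K' * \<kappa> ^ l \<le> Kmax" unfolding K'_def using K \<kappa>8 by (auto simp: mult_ac)
  have Kmax: "K \<le> Kmax"
  proof -
    have "K * 1 \<le> K * \<kappa> ^ Suc l" using K \<kappa>8 by (intro mult_left_mono one_le_power) auto
    then show ?thesis using K by linarith
  qed
  have \<delta>: "\<delta> > 0" unfolding \<delta>_def using N J by simp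
  (* t bounds the number of vertices still to be chosen:
     each of them adds at least \<delta> to the size of G, whose target is e'. *)
  have main: "indep_sum P x S C \<le> z ^ (t + l * b) * (1 + x / z) ^ card C * M"
    if "G \<subseteq> J" "C \<subseteq> V"
      and hS: "\<And>i. i \<in> J \<Longrightarrow> \<not> P (h i \<union> S)"
      and gS: "\<And>i. i \<in> G \<Longrightarrow> g i \<subseteq> V \<and> card (g i) \<le> l \<and> \<not> P (g i \<union> S)"
      and degG: "\<And>X. X \<noteq> {} \<Longrightarrow> X \<subseteq> V \<Longrightarrow>
       real (card {i \<in> G. X \<subseteq> g i}) \<le> K' * \<tau> ^ (card X - 1) * e' / card V"
      and t: "e' - card G \<le> t * \<delta>"
    for G g S C and t :: nat
  proof -
    have "finite C" using V that(2) finite_subset by auto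
    then show ?thesis using that
    proof (induction C arbitrary: S G g t rule: finite_psubset_induct)
      case (psubset C)
      note GJ = \<open>G \<subseteq> J\<close> and CV = \<open>C \<subseteq> V\<close> and hS = psubset.prems(3) and gS = psubset.prems(4)
        and degG = psubset.prems(5) and t = psubset.prems(6)
      have finG: "finite G" using GJ J(1) finite_subset by auto
      have pos: "(1 + x / z) ^ card C \<ge> 1" "z ^ (t + l * b) \<ge> 1" using x z by (auto intro!: one_le_power)
      show ?case
      proof (cases "real (card G) \<ge> e'")
        case True
        have "indep_sum P x S C \<le> z ^ (l * b) * (1 + x / z) ^ card C * M"
          by (rule Suc.IH[where J = G and h = g and e = e' and K = K'])
             (use \<kappa>' finG True e' K' gS degG CV in auto)
        also have "\<dots> \<le> z ^ (t + l * b) * (1 + x / z) ^ card C * M"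
          using M(1) pos z x by (intro mult_right_mono power_increasing) auto
        finally show ?thesis .
      next
        case False
        then obtain t' where t': "t = Suc t'" using t \<delta> by (cases t) auto
        define thr where "thr X = K' * \<tau> ^ (card X - 1) * e' / (2 * N)" for X :: "'v set"
        (* thr is half of the permitted degree: one further link adds at most the other half. *)
        define A where "A = {i \<in> J - G. \<forall>X. X \<noteq> {} \<and> X \<subseteq> h i \<longrightarrow> real (card {i \<in> G. X \<subseteq> g i}) < thr X}"
        have finA: "finite A" unfolding A_def using J(1) by auto
        show ?thesis
        proof (cases "\<exists>v\<in>C. real (card {i \<in> A. v \<in> h i}) \<ge> \<delta>")
          case True
          then obtain v where v: "v \<in> C" "real (card {i \<in> A. v \<in> h i}) \<ge> \<delta>" by auto
          define Av where "Av = {i \<in> A. v \<in> h i}"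
          define g' where "g' = (\<lambda>i. if i \<in> Av then h i - {v} else g i)"
          have AvG: "Av \<inter> G = {}" unfolding Av_def A_def by auto
          have finAv: "finite Av" unfolding Av_def using finA by auto
          have sub: "C - {v} \<subset> C" using v by auto
          have no: "indep_sum P x S (C - {v}) \<le> z ^ (t + l * b) * (1 + x / z) ^ card (C - {v}) * M"
            by (rule psubset.IH[OF sub GJ, where g = g]) (use CV hS gS degG t in auto)
          have "indep_sum P x (insert v S) (C - {v}) \<le> z ^ (t' + l * b) * (1 + x / z) ^ card (C - {v}) * M"
          proof (rule psubset.IH[OF sub, where G = "G \<union> Av" and g = g'])
            show "G \<union> Av \<subseteq> J" using GJ unfolding Av_def A_def by auto
            show "C - {v} \<subseteq> V" using CV by auto
            show "\<not> P (h i \<union> insert v S)" if "i \<in> J" for i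
              using hS[OF that] P[of "h i \<union> insert v S" "h i \<union> S"] by auto
            show "g' i \<subseteq> V \<and> card (g' i) \<le> l \<and> \<not> P (g' i \<union> insert v S)" if "i \<in> G \<union> Av" for i
            proof (cases "i \<in> Av")
              case True
              then have i: "i \<in> J" "v \<in> h i" unfolding Av_def A_def by auto
              have "finite (h i)" using h[OF i(1)] V(1) finite_subset by auto
              then have "card (h i - {v}) \<le> l" using h[OF i(1)] i(2) by (simp add: card_Diff_singleton le_diff_conv)
              moreover have "\<not> P ((h i - {v}) \<union> insert v S)"
                using hS[OF i(1)] P[of "(h i - {v}) \<union> insert v S" "h i \<union> S"] i(2) by auto
              ultimately show ?thesis using True h[OF i(1)] unfolding g'_def by auto
            next
              case False
              then have "i \<in> G" using that by auto
              then show ?thesis using gS P[of "g i \<union> insert v S" "g i \<union> S"] False unfolding g'_def by auto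
            qed
            show "real (card {i \<in> G \<union> Av. X \<subseteq> g' i}) \<le> K' * \<tau> ^ (card X - 1) * e' / card V"
              if X: "X \<noteq> {}" "X \<subseteq> V" for X
            proof -
              have split: "{i \<in> G \<union> Av. X \<subseteq> g' i} = {i \<in> G. X \<subseteq> g i} \<union> {i \<in> Av. X \<subseteq> h i - {v}}"
                unfolding g'_def using AvG by auto
              show ?thesis
              proof (cases "{i \<in> Av. X \<subseteq> h i - {v}} = {}")
                case True
                show ?thesis using degG[OF X] unfolding split True by simp
              next
                case False
                then obtain i where i: "i \<in> Av" "X \<subseteq> h i - {v}" by auto
                then have vX: "v \<notin> X" and "i \<in> A" "X \<subseteq> h i" unfolding Av_def by auto
                then have sat: "real (card {i \<in> G. X \<subseteq> g i}) < thr X" using X unfolding A_def by auto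
                have finX: "finite X" using X V(1) finite_subset by auto
                have cX: "card X > 0" using X(1) finX by (simp add: card_gt_0_iff)
                have "card {i \<in> Av. X \<subseteq> h i - {v}} \<le> card {i \<in> J. insert v X \<subseteq> h i}"
                  using J(1) by (intro card_mono) (auto simp: Av_def A_def)
                also have "real \<dots> \<le> K * \<tau> ^ (card (insert v X) - 1) * e / card V"
                  using deg[of "insert v X"] v CV X by auto
                also have "\<dots> = K * \<tau> ^ card X * e / N" using vX finX N_def by simp
                also have "\<dots> = 4 * K * \<tau> ^ (card X - 1) * e' / N"
                  using cX by (cases "card X") (auto simp: e'_def)
                also have "\<dots> \<le> thr X"
                proof -
                  have "4 * K * (\<tau> ^ (card X - 1) * e' / N) \<le> K' / 2 * (\<tau> ^ (card X - 1) * e' / N)"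
                    using \<tau> e' N K \<kappa>8 by (intro mult_right_mono) (auto simp: K'_def)
                  then show ?thesis unfolding thr_def by (simp add: field_simps)
                qed
                finally have new: "real (card {i \<in> Av. X \<subseteq> h i - {v}}) \<le> thr X" by simp
                have "card {i \<in> G \<union> Av. X \<subseteq> g' i} \<le> card {i \<in> G. X \<subseteq> g i} + card {i \<in> Av. X \<subseteq> h i - {v}}"
                  unfolding split by (rule card_Un_le)
                then have "real (card {i \<in> G \<union> Av. X \<subseteq> g' i}) \<le> 2 * thr X" using sat new by linarith
                also have "2 * thr X = K' * \<tau> ^ (card X - 1) * e' / card V" unfolding thr_def N_def by simp
                finally show ?thesis .
              qed
            qed
            show "e' - real (card (G \<union> Av)) \<le> real t' * \<delta>"
            proof -
              have "card (G \<union> Av) = card G + card Av"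
                using finG finAv AvG by (intro card_Un_disjoint) auto
              then show ?thesis using t v(2) unfolding t' Av_def by (simp add: algebra_simps)
            qed
          qed
          then have yes: "x * indep_sum P x (insert v S) (C - {v}) \<le> x * (z ^ (t' + l * b) * (1 + x / z) ^ card (C - {v}) * M)"
            using x by (intro mult_left_mono) auto
          have "indep_sum P x S C \<le> z ^ (t + l * b) * (1 + x / z) ^ card (C - {v}) * M
              + x * (z ^ (t' + l * b) * (1 + x / z) ^ card (C - {v}) * M)"
            unfolding indep_sum_branch[OF psubset.hyps(1) v(1)] using no yes by linarith
          also have "x * (z ^ (t' + l * b) * (1 + x / z) ^ card (C - {v}) * M) =
              (x / z) * (z ^ (t + l * b) * (1 + x / z) ^ card (C - {v}) * M)"
            unfolding t' using z by simp
          also have "z ^ (t + l * b) * (1 + x / z) ^ card (C - {v}) * M + \<dots> =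
             z ^ (t + l * b) * (1 + x / z) ^ Suc (card (C - {v})) * M" by (simp add: algebra_simps)
          also have "Suc (card (C - {v})) = card C" using card_Suc_Diff1[OF psubset.hyps(1) v(1)] .
          finally show ?thesis .
        next
          case low: False
          have "indep_sum P x S C \<le> M"
          proof (cases "\<exists>i\<in>J. h i = {}")
            case True
            then obtain i where "i \<in> J" "h i = {}" by auto
            then have "\<not> P S" using hS[of i] by auto
            then have "indep_sum P x S C = 0" using indep_sum_eq_0 P by metis
            then show ?thesis using M(1) by simp
          next
            case False
            define Sat where "Sat = {X \<in> Pow V. X \<noteq> {} \<and> real (card {i \<in> G. X \<subseteq> g i}) \<ge> thr X}"
            have finSat: "finite Sat" unfolding Sat_def using V(1) by auto
            have cov: "J \<subseteq> G \<union> A \<union> (\<Union>X\<in>Sat. {i \<in> J. X \<subseteq> h i})"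
            proof
              fix i assume i: "i \<in> J"
              show "i \<in> G \<union> A \<union> (\<Union>X\<in>Sat. {i \<in> J. X \<subseteq> h i})"
              proof (cases "i \<in> G \<union> A")
                case False
                then obtain X where X: "X \<noteq> {}" "X \<subseteq> h i" "\<not> real (card {i \<in> G. X \<subseteq> g i}) < thr X"
                  using i unfolding A_def by auto
                then have "X \<in> Sat" unfolding Sat_def using h[OF i] by auto
                then show ?thesis using X i by auto
              qed auto
            qed
            have rem: "real (card (\<Union>X\<in>Sat. {i \<in> J. X \<subseteq> h i})) \<le> e / 4"
            proof -
              have "real (card (\<Union>X\<in>Sat. {i \<in> J. X \<subseteq> h i})) \<le> (\<Sum>X\<in>Sat. real (card {i \<in> J. X \<subseteq> h i}))"
                using of_nat_mono[OF card_UN_le[OF finSat, of "\<lambda>X. {i \<in> J. X \<subseteq> h i}"], where 'a = real]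
                by (simp only: of_nat_sum)
              also have "\<dots> \<le> (\<Sum>X\<in>Sat. 8 / (\<kappa> * \<tau>) * real (card {i \<in> G. X \<subseteq> g i}))"
              proof (intro sum_mono)
                fix X assume X: "X \<in> Sat"
                have "real (card {i \<in> J. X \<subseteq> h i}) \<le> K * \<tau> ^ (card X - 1) * e / N"
                  using deg X unfolding Sat_def N_def by auto
                also have "\<dots> = 8 / (\<kappa> * \<tau>) * thr X"
                  unfolding thr_def K'_def e'_def using \<kappa>8 \<tau> by (simp add: field_simps)
                also have "\<dots> \<le> 8 / (\<kappa> * \<tau>) * real (card {i \<in> G. X \<subseteq> g i})"
                  using X \<kappa>8 \<tau> unfolding Sat_def by (intro mult_left_mono) auto
                finally show "real (card {i \<in> J. X \<subseteq> h i}) \<le> \<dots>" .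
              qed
              also have "\<dots> = 8 / (\<kappa> * \<tau>) * (\<Sum>X\<in>Sat. real (card {i \<in> G. X \<subseteq> g i}))"
                by (simp add: sum_distrib_left)
              also have "\<dots> \<le> 8 / (\<kappa> * \<tau>) * (\<Sum>X\<in>Pow V. real (card {i \<in> G. X \<subseteq> g i}))"
                using \<kappa>8 \<tau> V(1) by (intro mult_left_mono sum_mono2) (auto simp: Sat_def)
              also have "\<dots> \<le> 8 / (\<kappa> * \<tau>) * (2 ^ l * real (card G))"
              proof -
                have "(\<Sum>X\<in>Pow V. card {i \<in> G. X \<subseteq> g i}) \<le> 2 ^ l * card G"
                  by (rule sum_codegrees[OF V(1) finG]) (use gS in auto)
                then have "real (\<Sum>X\<in>Pow V. card {i \<in> G. X \<subseteq> g i}) \<le> real (2 ^ l * card G)"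
                  by (rule of_nat_mono)
                then show ?thesis using \<kappa>8 \<tau> by (intro mult_left_mono) auto
              qed
              also have "\<dots> \<le> 8 / (\<kappa> * \<tau>) * (2 ^ l * e')"
                using \<open>\<not> e' \<le> real (card G)\<close> \<kappa>8 \<tau> by (intro mult_left_mono) auto
              also have "\<dots> = 2 ^ (l + 1) / \<kappa> * e" unfolding e'_def using \<kappa>8 \<tau> by (simp add: field_simps)
              also have "\<dots> \<le> 1 / 8 * e"
              proof -
                have "2 ^ (l + 1) / \<kappa> \<le> 1 / 8"
                  using \<kappa> \<kappa>8 by (simp add: field_simps power_add)
                then show ?thesis using J(3) by (intro mult_right_mono) auto
              qed
              also have "\<dots> \<le> e / 4" using J(3) by simp
              finally show ?thesis .
            qed
            have "card J \<le> card (G \<union> A \<union> (\<Union>X\<in>Sat. {i \<in> J. X \<subseteq> h i}))"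
              using finG finA finSat J(1) cov by (intro card_mono) auto
            also have "\<dots> \<le> card G + card A + card (\<Union>X\<in>Sat. {i \<in> J. X \<subseteq> h i})"
              by (meson add_le_mono card_Un_le le_refl order_trans)
            finally have "real (card J) \<le> card G + card A + card (\<Union>X\<in>Sat. {i \<in> J. X \<subseteq> h i})"
              by linarith
            moreover have "real (card G) \<le> e / 4"
            proof -
              have "\<tau> * e \<le> 1 * e" using \<tau> J(3) by (intro mult_right_mono) auto
              then show ?thesis using \<open>\<not> e' \<le> real (card G)\<close> unfolding e'_def by linarith
            qed
            ultimately have Abig: "real (card A) \<ge> e / 2" using rem J(2) by linarith
            have "card V / (4 * K) \<le> real (card {v \<in> V. real (card {i \<in> A. v \<in> h i}) \<ge> e / (4 * card V)})"
            proof (rule many_high_degree_vertices[OF V finA J(3) K(1) _ _ Abig])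
              show "h i \<subseteq> V \<and> h i \<noteq> {}" if "i \<in> A" for i
                using that h False unfolding A_def by auto
              show "real (card {i \<in> A. v \<in> h i}) \<le> K * e / card V" if "v \<in> V" for v
              proof -
                have "card {i \<in> A. v \<in> h i} \<le> card {i \<in> J. {v} \<subseteq> h i}"
                  using J(1) by (intro card_mono) (auto simp: A_def)
                also have "real \<dots> \<le> K * \<tau> ^ (card {v} - 1) * e / card V" using deg[of "{v}"] that by auto
                finally show ?thesis by simp
              qed
            qed
            moreover have "card V / (4 * Kmax) \<le> card V / (4 * K)"
              using Kmax K(1) by (intro divide_left_mono) auto
            moreover have "card C + card {v \<in> V. real (card {i \<in> A. v \<in> h i}) \<ge> e / (4 * card V)} \<le> card V"
            proof -
              let ?W = "{v \<in> V. real (card {i \<in> A. v \<in> h i}) \<ge> e / (4 * card V)}"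
              have "C \<inter> ?W = {}" using low unfolding \<delta>_def N_def by auto
              then have "card C + card ?W = card (C \<union> ?W)"
                using psubset.hyps(1) V(1) by (intro card_Un_disjoint[symmetric]) auto
              also have "\<dots> \<le> card V" using CV V(1) by (intro card_mono) auto
              finally show ?thesis .
            qed
            ultimately have "real (card C) \<le> card V - card V / (4 * Kmax)" by linarith
            then have "indep_sum P x {} C \<le> M" using M(2) CV by auto
            then show ?thesis using indep_sum_drop_condition[OF psubset.hyps(1) x, of P S] P by force
          qed
          also have "M = 1 * 1 * M" by simp
          also have "\<dots> \<le> z ^ (t + l * b) * (1 + x / z) ^ card C * M"
            using pos M(1) by (intro mult_right_mono mult_mono) auto
          finally show ?thesis .
        qed
      qed
    qed
  qed
  have "indep_sum P x S C \<le> z ^ (b + l * b) * (1 + x / z) ^ card C * M"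
  proof (rule main[where G = "{}" and g = h])
    show "e' - real (card {}) \<le> real b * \<delta>"
      using b J(3) N unfolding e'_def \<delta>_def N_def[symmetric] by (simp add: field_simps)
  qed (use Suc.prems h K' \<tau> e' in auto)
  then show ?case by simp
qed

section \<open>Balanced supersaturation for semi-bounded graphs\<close>

lemma exists_blocks:
  assumes "finite X" "L > 0"
  shows "\<exists>P. disjoint P \<and> (\<forall>B\<in>P. B \<subseteq> X \<and> card B = L) \<and> card (X - \<Union>P) < L"
  using assms(1)
proof (induction "card X" arbitrary: X rule: less_induct)
  case less
  show ?case
  proof (cases "card X < L")
    case True
    then show ?thesis by (intro exI[of _ "{}"]) auto
  next
    case False
    then obtain B where B: "B \<subseteq> X" "card B = L" by (meson not_less obtain_subset_with_card_n)
    have fB: "finite B" "B \<noteq> {}" using B less.prems assms(2) finite_subset by auto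
    have "X - B \<subset> X" using B fB by auto
    then have "card (X - B) < card X" using less.prems psubset_card_mono by metis
    then obtain P where P: "disjoint P" "\<forall>B'\<in>P. B' \<subseteq> X - B \<and> card B' = L" "card (X - B - \<Union>P) < L"
      using less.hyps[of "X - B"] less.prems by auto
    have "X - \<Union>(insert B P) = X - B - \<Union>P" by auto
    moreover have "disjoint (insert B P)"
      using P(1,2) unfolding disjoint_def by blast
    ultimately show ?thesis using P B by (intro exI[of _ "insert B P"]) auto
  qed
qed

text \<open>All blocks have the same size, so membership in a common block is a relation in which every element
  has the same number of partners; the price is the loss of fewer than \<open>L\<close> elements.\<close>

definition blocks :: "nat \<Rightarrow> 'v set \<Rightarrow> 'v set set" where
  "blocks L X = (SOME P. disjoint P \<and> (\<forall>B\<in>P. B \<subseteq> X \<and> card B = L) \<and> card (X - \<Union>P) < L)"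

lemma
  assumes "finite X" "L > 0"
  shows blocks_disjoint: "disjoint (blocks L X)"
    and blocks_subset: "B \<in> blocks L X \<Longrightarrow> B \<subseteq> X"
    and blocks_card: "B \<in> blocks L X \<Longrightarrow> card B = L"
    and blocks_rest: "card (X - \<Union>(blocks L X)) < L"
  using someI_ex[OF exists_blocks[OF assms]] unfolding blocks_def[symmetric] by auto

lemma blocks_eqI:
  assumes "finite X" "L > 0" "B \<in> blocks L X" "B' \<in> blocks L X" "y \<in> B" "y \<in> B'"
  shows "B = B'"
  using blocks_disjoint[OF assms(1,2)] assms(3-6) unfolding disjoint_def by blast

lemma card_blocks:
  assumes "finite X" "L > 0"
  shows "card X < L * card (blocks L X) + L"
proof -
  have fin: "finite (blocks L X)"
    by (rule finite_subset[of _ "Pow X"]) (use blocks_subset[OF assms] assms in auto)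
  have sub: "\<Union>(blocks L X) \<subseteq> X" using blocks_subset[OF assms] by auto
  have "card (\<Union>(blocks L X)) = (\<Sum>B\<in>blocks L X. card B)"
  proof (rule card_Union_disjoint)
    show "pairwise disjnt (blocks L X)"
      using blocks_disjoint[OF assms] by (auto simp: disjoint_def pairwise_def disjnt_def)
    show "finite B" if "B \<in> blocks L X" for B
      using blocks_subset[OF assms that] assms(1) by (rule finite_subset)
  qed
  also have "\<dots> = L * card (blocks L X)" using blocks_card[OF assms] by simp
  finally have "card (\<Union>(blocks L X)) = L * card (blocks L X)" .
  moreover have "card X = card (\<Union>(blocks L X)) + card (X - \<Union>(blocks L X))"
    using sub assms(1) by (metis card_Diff_subset card_mono finite_subset le_add_diff_inverse)
  ultimately show ?thesis using blocks_rest[OF assms] by simp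
qed

text \<open>Greedy choice: when the value at the last argument is chosen, at most \<open>|X| + |A|\<close>
  elements are forbidden.\<close>

lemma card_injective_choices_ge:
  assumes "finite A" "finite X"
    and "\<And>a. a \<in> A \<Longrightarrow> finite (M a) \<and> inj_on \<pi> (M a) \<and> m a + card X + card A \<le> card (M a)"
  shows "(\<Prod>a\<in>A. m a) \<le> card {f \<in> PiE A M. inj_on (\<pi> \<circ> f) A \<and> (\<pi> \<circ> f) ` A \<inter> X = {}}"
  using assms(1,3)
proof (induction A rule: finite_induct)
  case empty
  show ?case by simp
next
  case (insert a A)
  let ?Z = "\<lambda>A. {f \<in> PiE A M. inj_on (\<pi> \<circ> f) A \<and> (\<pi> \<circ> f) ` A \<inter> X = {}}"
  let ?F = "\<lambda>f. {x \<in> M a. \<pi> x \<notin> X \<union> (\<pi> \<circ> f) ` A}"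
  have "finite (PiE A M)" "finite (PiE (insert a A) M)"
    using insert.hyps insert.prems by (auto intro!: finite_PiE)
  then have finZ: "finite (?Z A)" "finite (?Z (insert a A))" by simp_all
  have IH: "(\<Prod>a\<in>A. m a) \<le> card (?Z A)"
  proof (rule insert.IH)
    fix b assume "b \<in> A"
    then show "finite (M b) \<and> inj_on \<pi> (M b) \<and> m b + card X + card A \<le> card (M b)"
      using insert.prems[of b] insert.hyps by auto
  qed
  have Ma: "finite (M a)" "inj_on \<pi> (M a)" "m a + card X + Suc (card A) \<le> card (M a)"
    using insert.prems[of a] insert.hyps by auto
  have F: "m a \<le> card (?F f)" if "f \<in> ?Z A" for f
  proof -
    let ?Y = "X \<union> (\<pi> \<circ> f) ` A"
    have finY: "finite ?Y" using assms(2) insert.hyps by auto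
    have "card {x \<in> M a. \<pi> x \<in> ?Y} = card (\<pi> ` {x \<in> M a. \<pi> x \<in> ?Y})"
      using Ma(2) by (intro card_image[symmetric]) (auto simp: inj_on_def)
    also have "\<dots> \<le> card ?Y" using finY by (intro card_mono) auto
    also have "\<dots> \<le> card X + card A"
      using card_Un_le[of X "(\<pi> \<circ> f) ` A"] card_image_le[OF insert.hyps(1), of "\<pi> \<circ> f"] by linarith
    finally have "card {x \<in> M a. \<pi> x \<in> ?Y} \<le> card X + card A" .
    moreover have "card (M a) = card {x \<in> M a. \<pi> x \<in> ?Y} + card (?F f)"
    proof -
      have "M a = {x \<in> M a. \<pi> x \<in> ?Y} \<union> ?F f" by auto
      then have "card (M a) = card ({x \<in> M a. \<pi> x \<in> ?Y} \<union> ?F f)" by simp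
      also have "\<dots> = card {x \<in> M a. \<pi> x \<in> ?Y} + card (?F f)"
        using Ma(1) by (intro card_Un_disjoint) auto
      finally show ?thesis .
    qed
    ultimately show ?thesis using Ma(3) by linarith
  qed
  have "(\<Prod>a\<in>insert a A. m a) = m a * (\<Prod>a\<in>A. m a)" using insert.hyps by simp
  also have "\<dots> \<le> m a * card (?Z A)" using IH by simp
  also have "\<dots> = (\<Sum>f\<in>?Z A. m a)" by simp
  also have "\<dots> \<le> (\<Sum>f\<in>?Z A. card (?F f))" using F by (intro sum_mono) auto
  also have "\<dots> = card (SIGMA f:?Z A. ?F f)" using finZ Ma(1) by simp
  also have "\<dots> = card ((\<lambda>(f, x). f(a := x)) ` (SIGMA f:?Z A. ?F f))"
  proof (rule card_image[symmetric], rule inj_onI)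
    fix p p' assume p: "p \<in> (SIGMA f:?Z A. ?F f)" "p' \<in> (SIGMA f:?Z A. ?F f)"
      and eq: "(\<lambda>(f, x). f(a := x)) p = (\<lambda>(f, x). f(a := x)) p'"
    obtain f x f' x' where [simp]: "p = (f, x)" "p' = (f', x')" by (metis surj_pair)
    have "f(a := x) = f'(a := x')" using eq by simp
    then have "x = x'" "f(a := undefined) = f'(a := undefined)" by (metis fun_upd_same, metis fun_upd_upd)
    moreover have "f a = undefined" "f' a = undefined" using p insert.hyps by (auto simp: PiE_def extensional_def)
    ultimately show "p = p'" by (metis \<open>p = (f, x)\<close> \<open>p' = (f', x')\<close> fun_upd_triv)
  qed
  also have "\<dots> \<le> card (?Z (insert a A))"
  proof (intro card_mono[OF finZ(2)] subsetI)
    fix g assume "g \<in> (\<lambda>(f, x). f(a := x)) ` (SIGMA f:?Z A. ?F f)"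
    then obtain f x where g: "g = f(a := x)" "f \<in> ?Z A" "x \<in> ?F f" by auto
    have gA: "g b = f b" if "b \<in> A" for b using that g(1) insert.hyps by auto
    have "g \<in> PiE (insert a A) M" using g by (auto simp: PiE_def extensional_def)
    moreover have "inj_on (\<pi> \<circ> g) (insert a A)"
    proof -
      have "inj_on (\<pi> \<circ> g) A" using g(2) gA by (auto simp: inj_on_def)
      moreover have "(\<pi> \<circ> g) a \<notin> (\<pi> \<circ> g) ` (A - {a})" using g gA by auto
      ultimately show ?thesis by simp
    qed
    moreover have "(\<pi> \<circ> g) ` insert a A \<inter> X = {}" using g gA by auto
    ultimately show "g \<in> ?Z (insert a A)" by simp
  qed
  finally show ?case .
qed

text \<open>A semi-bounded graph without isolated vertices, given by the neighbourhoods \<open>Nb b\<close> of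
  the vertices on the \<open>T\<close> side.\<close>

locale semi_bounded_pattern =
  fixes S T :: "'a set" and vs :: 'a and Nb :: "'a \<Rightarrow> 'a set" and r :: nat
  assumes finS: "finite S" and finT: "finite T" and disj: "S \<inter> T = {}"
    and vsT: "vs \<in> T" and Nbvs: "Nb vs = S" and r1: "r \<ge> 1"
    and Nb: "\<And>b. b \<in> T \<Longrightarrow> Nb b \<subseteq> S \<and> Nb b \<noteq> {}"
    and Nbr: "\<And>b. b \<in> T - {vs} \<Longrightarrow> card (Nb b) \<le> r"
begin

definition pattern_edges :: "'a set set" where
  "pattern_edges = (\<Union>b\<in>T. (\<lambda>a. {a, b}) ` Nb b)"

text \<open>The exponent of \<open>q\<close> in the number of extensions of an embedding of
  \<open>\<nu>\<close>, when \<open>vs\<close> is reached through \<open>v \<in> \<nu>\<close> unless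
  it belongs to \<open>\<nu>\<close> itself.\<close>

definition ext_exp :: "'a set \<Rightarrow> 'a \<Rightarrow> nat" where
  "ext_exp \<nu> v = card (S - \<nu>) + (\<Sum>b\<in>T - \<nu> - {vs}. card (Nb b)) + (if vs \<in> \<nu> then 0 else card (Nb v))"

text \<open>So small that the choices in which \<open>vs\<close> misses a block, summed over the vertices of
  \<open>T\<close>, are at most half of the \<open>2^{-|S|}\<close> proportion of injective choices.\<close>

definition \<epsilon> :: real where "\<epsilon> = 1 / (2 ^ (card S + 1) * card T)"

lemma finNb: "b \<in> T \<Longrightarrow> finite (Nb b)"
  using Nb finS finite_subset by metis

lemma finite_pattern_edges: "finite pattern_edges"
  unfolding pattern_edges_def using finT finNb by auto

lemma pattern_edge_subset: "e \<in> pattern_edges \<Longrightarrow> e \<subseteq> S \<union> T"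
  unfolding pattern_edges_def using Nb by blast

lemma cardT: "card T > 0" using finT vsT by (auto simp: card_gt_0_iff)

lemma \<epsilon>_pos: "\<epsilon> > 0" unfolding \<epsilon>_def using cardT by simp

lemma \<epsilon>_le: "\<epsilon> \<le> 1"
proof -
  have "(1::real) * 1 \<le> 2 ^ (card S + 1) * real (card T)"
    using cardT by (intro mult_mono one_le_power) auto
  then show ?thesis unfolding \<epsilon>_def using cardT by (subst pos_divide_le_eq) auto
qed

end

text \<open>\<open>C\<close> is the edge set of a graph on \<open>V\<close> in which the copies are to be found,
  and \<open>q\<close> plays the role of its density.\<close>

locale dense_host = semi_bounded_pattern S T vs Nb r
  for S T :: "'a set" and vs :: 'a and Nb :: "'a \<Rightarrow> 'a set" and r :: nat +
  fixes V :: "'v set" and C :: "'v set set" and D :: nat and q :: real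
  assumes finV: "finite V" and V0: "V \<noteq> {}"
    and C: "\<And>e. e \<in> C \<Longrightarrow> e \<subseteq> V \<and> card e = 2"
    and D: "D * card V \<le> card C" and D1: "D > 0" and q: "q = D / card V" and q1: "q \<le> 1"
    and dense: "\<epsilon> * card V * q ^ r \<ge> 2 * (card S + card T + 1)"
begin

abbreviation n :: real where "n \<equiv> real (card V)"

definition nbhd :: "'v \<Rightarrow> 'v set" where "nbhd t = {s. {s, t} \<in> C}"

text \<open>A vertex \<open>t\<close> of large degree is replaced by several clones, whose neighbourhoods are
  disjoint blocks of the neighbourhood of \<open>t\<close>, and a vertex of small degree is dropped.
  All clones have degree \<open>D\<close>, there are at least \<open>|V|\<close> of them, and an edge
  at \<open>t\<close> belongs to at most one clone of \<open>t\<close>.\<close>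

definition clones :: "('v \<times> 'v set) set" where
  "clones = (SIGMA t:V. blocks D (nbhd t))"

definition common :: "'v set \<Rightarrow> ('v \<times> 'v set) set" where
  "common Q = {y \<in> clones. Q \<subseteq> snd y}"

text \<open>A fixed small proportion of the typical number of common neighbours of \<open>card (Nb b)\<close>
  vertices.\<close>

definition mate_size :: "'a \<Rightarrow> nat" where
  "mate_size b = nat \<lfloor>\<epsilon> * n * q ^ card (Nb b)\<rfloor>"

text \<open>The block of \<open>y\<close> in the common neighbourhood of \<open>Q\<close>, or the empty set if
  \<open>y\<close> lies in none. The relation is symmetric in the two clones, so it bounds both the
  number of images of \<open>b\<close> for a given image of \<open>vs\<close> and the number of images
  of \<open>vs\<close> for a given image of \<open>b\<close>.\<close>

definition mates :: "'a \<Rightarrow> 'v set \<Rightarrow> ('v \<times> 'v set) \<Rightarrow> ('v \<times> 'v set) set" where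
  "mates b Q y = \<Union>{B \<in> blocks (mate_size b) (common Q). y \<in> B}"

text \<open>Injectivity on \<open>T\<close> is required for the underlying vertices of \<open>V\<close>, as two
  clones of the same vertex must not both be used.\<close>

definition embs :: "(('a \<Rightarrow> 'v) \<times> ('a \<Rightarrow> 'v \<times> 'v set)) set" where
  "embs = {(s, y). s \<in> S \<rightarrow>\<^sub>E V \<and> y \<in> T \<rightarrow>\<^sub>E clones \<and> inj_on s S \<and> inj_on (fst \<circ> y) T \<and>
        s ` S \<inter> (fst \<circ> y) ` T = {} \<and> s ` S \<subseteq> snd (y vs) \<and>
        (\<forall>b\<in>T - {vs}. y b \<in> mates b (s ` Nb b) (y vs))}"

definition emb :: "('a \<Rightarrow> 'v) \<times> ('a \<Rightarrow> 'v \<times> 'v set) \<Rightarrow> 'a \<Rightarrow> 'v" where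
  "emb i v = (if v \<in> S then fst i v else fst (snd i v))"

definition emb_edges :: "('a \<Rightarrow> 'v) \<times> ('a \<Rightarrow> 'v \<times> 'v set) \<Rightarrow> 'v set set" where
  "emb_edges i = (\<lambda>e. emb i ` e) ` pattern_edges"

lemma n_pos: "n > 0" using finV V0 by (simp add: card_gt_0_iff)

lemma q_pos: "q > 0" using q D1 n_pos by simp

lemma nq: "n * q = D" using q n_pos by simp

lemma nbhd_subset: "nbhd t \<subseteq> V - {t}"
proof
  fix s assume "s \<in> nbhd t"
  then have "{s, t} \<in> C" unfolding nbhd_def by simp
  then have "{s, t} \<subseteq> V" "card {s, t} = 2" using C by auto
  then show "s \<in> V - {t}" by (cases "s = t") auto
qed

lemma finite_nbhd: "finite (nbhd t)"
  using nbhd_subset[of t] finV finite_subset by blast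

lemma clone_props:
  assumes "y \<in> clones"
  shows "fst y \<in> V" "snd y \<subseteq> nbhd (fst y)" "card (snd y) = D" "finite (snd y)" "snd y \<subseteq> V" "fst y \<notin> snd y"
proof -
  have y: "fst y \<in> V" "snd y \<in> blocks D (nbhd (fst y))" using assms unfolding clones_def by auto
  show "fst y \<in> V" by (rule y(1))
  show sub: "snd y \<subseteq> nbhd (fst y)" by (rule blocks_subset[OF finite_nbhd D1 y(2)])
  show "card (snd y) = D" by (rule blocks_card[OF finite_nbhd D1 y(2)])
  show "finite (snd y)" by (rule finite_subset[OF sub finite_nbhd])
  show "snd y \<subseteq> V" "fst y \<notin> snd y" using sub nbhd_subset[of "fst y"] by auto
qed

lemma finite_clones: "finite clones"
proof (rule finite_subset)
  show "clones \<subseteq> V \<times> Pow V"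
  proof
    fix y assume "y \<in> clones"
    then show "y \<in> V \<times> Pow V" using clone_props(1,5)[of y] by (cases y) auto
  qed
qed (use finV in auto)

lemma clones_eqI:
  assumes "y \<in> clones" "y' \<in> clones" "fst y = fst y'" "s \<in> snd y" "s \<in> snd y'"
  shows "y = y'"
proof -
  have "snd y \<in> blocks D (nbhd (fst y))" "snd y' \<in> blocks D (nbhd (fst y))"
    using assms unfolding clones_def by auto
  then have "snd y = snd y'" using blocks_eqI[OF finite_nbhd D1] assms(4,5) by metis
  then show ?thesis using assms(3) by (simp add: prod_eq_iff)
qed

lemma common_subset: "common Q \<subseteq> clones" unfolding common_def by auto

lemma finite_common: "finite (common Q)" using common_subset finite_clones finite_subset by metis

lemma inj_on_fst_common: "Q \<noteq> {} \<Longrightarrow> inj_on fst (common Q)"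
proof (rule inj_onI)
  fix y y' assume Q: "Q \<noteq> {}" and y: "y \<in> common Q" "y' \<in> common Q" "fst y = fst y'"
  obtain s where "s \<in> Q" using Q by auto
  then show "y = y'" using y clones_eqI[of y y' s] unfolding common_def by auto
qed

lemma nq_power_ge: "d \<le> r \<Longrightarrow> \<epsilon> * n * q ^ d \<ge> 2 * (card S + card T + 1)"
proof -
  assume "d \<le> r"
  then have "q ^ r \<le> q ^ d" using q_pos q1 by (intro power_decreasing) auto
  then have "\<epsilon> * n * q ^ r \<le> \<epsilon> * n * q ^ d" using \<epsilon>_pos n_pos by (intro mult_left_mono) auto
  then show ?thesis using dense by linarith
qed

lemma
  assumes "b \<in> T"
  shows mate_size_le: "real (mate_size b) \<le> \<epsilon> * n * q ^ card (Nb b)"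
    and mate_size_ge: "b \<noteq> vs \<Longrightarrow> real (mate_size b) \<ge> \<epsilon> / 2 * n * q ^ card (Nb b) + card S + card T"
    and mate_size_pos: "b \<noteq> vs \<Longrightarrow> mate_size b > 0"
proof -
  let ?x = "\<epsilon> * n * q ^ card (Nb b)"
  have "?x \<ge> 0" using \<epsilon>_pos n_pos q_pos by simp
  then show "real (mate_size b) \<le> ?x" unfolding mate_size_def by simp
  assume "b \<noteq> vs"
  then have "?x \<ge> 2 * (card S + card T + 1)" using nq_power_ge Nbr assms by auto
  moreover have "real (mate_size b) \<ge> ?x - 1" unfolding mate_size_def by linarith
  ultimately show ge: "real (mate_size b) \<ge> \<epsilon> / 2 * n * q ^ card (Nb b) + card S + card T" by simp
  moreover have "\<epsilon> / 2 * n * q ^ card (Nb b) > 0" using \<epsilon>_pos n_pos q_pos by simp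
  ultimately have "real (mate_size b) > 0" by linarith
  then show "mate_size b > 0" by simp
qed

lemma D_ge: "D \<ge> 2 * card S"
proof -
  have "2 * real (card S + card T + 1) \<le> \<epsilon> * n * q ^ 1" using nq_power_ge[of 1] r1 by simp
  also have "\<dots> \<le> n * q" using \<epsilon>_le n_pos q_pos by simp
  also have "\<dots> = D" by (rule nq)
  finally have "2 * real (card S + card T + 1) \<le> real D" .
  then show ?thesis by simp
qed

lemma
  assumes "b \<in> T" "b \<noteq> vs"
  shows mates_common: "mates b Q y \<subseteq> common Q"
    and mates_card_le: "card (mates b Q y) \<le> mate_size b"
    and mates_finite: "finite (mates b Q y)"
    and mates_sym: "y' \<in> mates b Q y \<longleftrightarrow> y \<in> mates b Q y'"
    and mates_card: "y \<in> \<Union>(blocks (mate_size b) (common Q)) \<Longrightarrow> card (mates b Q y) = mate_size b"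
proof -
  note mate_size = mate_size_pos[OF assms]
  show sub: "mates b Q y \<subseteq> common Q"
    unfolding mates_def using blocks_subset[OF finite_common mate_size] by blast
  then show "finite (mates b Q y)" using finite_common finite_subset by metis
  have eq: "mates b Q y = B" if "B \<in> blocks (mate_size b) (common Q)" "y \<in> B" for B
    unfolding mates_def using that blocks_eqI[OF finite_common mate_size] by blast
  show c: "card (mates b Q y) = mate_size b" if "y \<in> \<Union>(blocks (mate_size b) (common Q))"
    using that eq blocks_card[OF finite_common mate_size] by auto
  have "mates b Q y = {}" if "y \<notin> \<Union>(blocks (mate_size b) (common Q))"
    unfolding mates_def using that by auto
  then show "card (mates b Q y) \<le> mate_size b" using c by (cases "y \<in> \<Union>(blocks (mate_size b) (common Q))") auto
  show "y' \<in> mates b Q y \<longleftrightarrow> y \<in> mates b Q y'" unfolding mates_def by auto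
qed

lemma finite_embs: "finite embs"
proof (rule finite_subset)
  show "embs \<subseteq> (S \<rightarrow>\<^sub>E V) \<times> (T \<rightarrow>\<^sub>E clones)" unfolding embs_def by auto
  show "finite ((S \<rightarrow>\<^sub>E V) \<times> (T \<rightarrow>\<^sub>E clones))"
    using finS finT finV finite_clones by (intro finite_cartesian_product finite_PiE) auto
qed

lemma embs_adjacent:
  assumes "(s, y) \<in> embs" "b \<in> T" "a \<in> Nb b"
  shows "s a \<in> snd (y b)"
proof (cases "b = vs")
  case True
  then show ?thesis using assms Nbvs unfolding embs_def by auto
next
  case False
  then have "y b \<in> mates b (s ` Nb b) (y vs)" using assms unfolding embs_def by auto
  then have "y b \<in> common (s ` Nb b)" using mates_common[OF assms(2) False] by blast
  then show ?thesis using assms(3) unfolding common_def by auto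
qed

lemma embs_clone: "(s, y) \<in> embs \<Longrightarrow> b \<in> T \<Longrightarrow> y b \<in> clones"
  unfolding embs_def by auto

lemma emb_inj:
  assumes "i \<in> embs"
  shows "inj_on (emb i) (S \<union> T)"
proof -
  obtain s y where i: "i = (s, y)" by (metis surj_pair)
  have embs: "inj_on s S" "inj_on (fst \<circ> y) T" "s ` S \<inter> (fst \<circ> y) ` T = {}"
    using assms i unfolding embs_def by auto
  have "inj_on (emb i) S" using embs(1) by (rule inj_on_cong[THEN iffD1, rotated]) (simp add: emb_def i)
  moreover have "inj_on (emb i) T"
    using embs(2) by (rule inj_on_cong[THEN iffD1, rotated]) (use disj in \<open>auto simp: emb_def i\<close>)
  moreover have "emb i ` S = s ` S" "emb i ` T = (fst \<circ> y) ` T"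
    using disj by (auto simp: emb_def i intro!: image_cong)
  ultimately show ?thesis using embs(3) by (auto simp: inj_on_Un)
qed

lemma emb_edges_subset:
  assumes "i \<in> embs"
  shows "emb_edges i \<subseteq> C"
proof
  obtain s y where i: "i = (s, y)" by (metis surj_pair)
  fix e assume "e \<in> emb_edges i"
  then obtain a b where ab: "b \<in> T" "a \<in> Nb b" "e = emb i ` {a, b}"
    unfolding emb_edges_def pattern_edges_def by auto
  have "a \<in> S" "b \<notin> S" using Nb ab disj by auto
  then have "e = {s a, fst (y b)}" using ab unfolding emb_def i by auto
  moreover have "s a \<in> snd (y b)" "y b \<in> clones" using embs_adjacent embs_clone ab assms i by auto
  then have "s a \<in> nbhd (fst (y b))" using clone_props by blast
  ultimately show "e \<in> C" unfolding nbhd_def by auto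
qed

lemma card_emb_edges: "i \<in> embs \<Longrightarrow> card (emb_edges i) \<le> card pattern_edges"
  unfolding emb_edges_def by (rule card_image_le[OF finite_pattern_edges])

text \<open>Once the image of \<open>vs\<close> is fixed, every vertex of \<open>S\<close> has \<open>D\<close>
  possible images, and after them every vertex of \<open>T\<close> has one block of possible images.\<close>

lemma card_fixed_part_le:
  assumes "S0 \<subseteq> S" "T0 \<subseteq> T" "vs \<in> T0"
  shows "card {(s, y) \<in> embs. (\<forall>a\<in>S0. s a = s0 a) \<and> (\<forall>b\<in>T0. y b = y0 b)}
    \<le> D ^ card (S - S0) * (\<Prod>b\<in>T - T0. mate_size b)" (is "card ?Z \<le> _")
proof (cases "y0 vs \<in> clones")
  case False
  have "i \<notin> ?Z" for i
  proof
    assume "i \<in> ?Z"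
    then obtain s y where "(s, y) \<in> embs" "y vs = y0 vs" using assms(3) by auto
    then show False using embs_clone[of s y vs] vsT False by simp
  qed
  then have "?Z = {}" by blast
  then show ?thesis by (simp only: card.empty)
next
  case True
  define A where "A = PiE S (\<lambda>a. if a \<in> S0 then {s0 a} else snd (y0 vs))"
  define B where "B = (\<lambda>s. PiE T (\<lambda>b. if b \<in> T0 then {y0 b} else mates b (s ` Nb b) (y0 vs)))"
  have finA: "finite A" unfolding A_def using finS clone_props(4)[OF True] by (intro finite_PiE) auto
  have notvs: "b \<noteq> vs" if "b \<in> T - T0" for b using that assms(3) by auto
  have finB: "finite (B s)" for s
    unfolding B_def using finT notvs by (intro finite_PiE) (auto intro: mates_finite)
  have "?Z \<subseteq> Sigma A B"
  proof
    fix i assume "i \<in> ?Z"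
    then obtain s y where i: "i = (s, y)" "(s, y) \<in> embs" "\<forall>a\<in>S0. s a = s0 a" "\<forall>b\<in>T0. y b = y0 b" by auto
    have yv: "y vs = y0 vs" using i assms(3) by auto
    have embs: "s \<in> S \<rightarrow>\<^sub>E V" "y \<in> T \<rightarrow>\<^sub>E clones" "s ` S \<subseteq> snd (y vs)"
      "\<forall>b\<in>T - {vs}. y b \<in> mates b (s ` Nb b) (y vs)"
      using i(2) unfolding embs_def by auto
    have "s \<in> A" unfolding A_def using embs(1,3) i(3) yv by (auto simp: PiE_iff)
    moreover have "y \<in> B s" unfolding B_def using embs(2,4) i(4) yv notvs by (auto simp: PiE_iff)
    ultimately show "i \<in> Sigma A B" using i(1) by auto
  qed
  then have "card ?Z \<le> card (Sigma A B)" using finA finB by (intro card_mono finite_SigmaI)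
  also have "\<dots> = (\<Sum>s\<in>A. card (B s))" using finA finB by (simp add: card_SigmaI)
  also have "\<dots> \<le> (\<Sum>s\<in>A. \<Prod>b\<in>T - T0. mate_size b)"
  proof (intro sum_mono)
    fix s
    have "card (B s) = (\<Prod>b\<in>T. card (if b \<in> T0 then {y0 b} else mates b (s ` Nb b) (y0 vs)))"
      unfolding B_def by (rule card_PiE[OF finT])
    also have "\<dots> \<le> (\<Prod>b\<in>T. if b \<in> T0 then 1 else mate_size b)"
      using notvs by (intro prod_mono) (auto intro: mates_card_le)
    also have "\<dots> = (\<Prod>b\<in>T - T0. mate_size b)"
      using finT by (intro prod.mono_neutral_cong_right) auto
    finally show "card (B s) \<le> (\<Prod>b\<in>T - T0. mate_size b)" .
  qed
  also have "\<dots> = card A * (\<Prod>b\<in>T - T0. mate_size b)" by simp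
  also have "card A = (\<Prod>a\<in>S. card (if a \<in> S0 then {s0 a} else snd (y0 vs)))"
    unfolding A_def by (rule card_PiE[OF finS])
  also have "\<dots> = (\<Prod>a\<in>S. if a \<in> S0 then 1 else D)"
    using clone_props(3)[OF True] by (intro prod.cong) auto
  also have "\<dots> = (\<Prod>a\<in>S - S0. D)"
    using finS by (intro prod.mono_neutral_cong_right) auto
  finally show ?thesis by simp
qed

lemma clone_determined:
  assumes "(s, y) \<in> embs" "(s', y') \<in> embs" "b \<in> T \<inter> \<nu>" "Nb b \<inter> \<nu> \<noteq> {}" "\<forall>v\<in>\<nu>. emb (s, y) v = emb (s', y') v"
  shows "y b = y' b"
proof -
  obtain a where a: "a \<in> Nb b" "a \<in> \<nu>" using assms(4) by auto
  have aS: "a \<in> S" "b \<notin> S" using a Nb assms(3) disj by auto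
  have "s a = s' a" "fst (y b) = fst (y' b)" using assms(3,5) a aS by (auto simp: emb_def)
  then show ?thesis
    using clones_eqI[of "y b" "y' b" "s a"] embs_clone[OF assms(1), of b] embs_clone[OF assms(2), of b]
      embs_adjacent[OF assms(1), of b a] embs_adjacent[OF assms(2), of b a] assms(3) a by auto
qed

lemma prod_mate_size_le:
  assumes "B \<subseteq> T"
  shows "real (\<Prod>b\<in>B. mate_size b) \<le> n ^ card B * q ^ (\<Sum>b\<in>B. card (Nb b))"
proof -
  have "real (\<Prod>b\<in>B. mate_size b) = (\<Prod>b\<in>B. real (mate_size b))" by simp
  also have "\<dots> \<le> (\<Prod>b\<in>B. n * q ^ card (Nb b))"
  proof (intro prod_mono conjI)
    fix b assume "b \<in> B"
    then have "real (mate_size b) \<le> \<epsilon> * n * q ^ card (Nb b)" using mate_size_le assms by auto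
    also have "\<dots> \<le> 1 * n * q ^ card (Nb b)"
      using \<epsilon>_le n_pos q_pos by (intro mult_right_mono) auto
    finally show "real (mate_size b) \<le> n * q ^ card (Nb b)" by simp
  qed auto
  also have "\<dots> = n ^ card B * q ^ (\<Sum>b\<in>B. card (Nb b))" by (simp add: prod.distrib power_sum)
  finally show ?thesis .
qed

text \<open>If \<open>vs \<in> \<nu>\<close>, the previous count applies. Otherwise the remaining neighbours of
  \<open>v\<close> are embedded first, with \<open>D\<close> choices each; then the image of
  \<open>vs\<close> is a mate of the image of \<open>v\<close>, and from there on the previous count
  applies again. The clones of the vertices in \<open>T \<inter> \<nu>\<close> are determined because
  none of these vertices is isolated in \<open>\<nu>\<close>.\<close>

lemma extension_bound:
  assumes \<nu>: "\<nu> \<subseteq> S \<union> T" and nonisolated: "\<And>b. b \<in> T \<inter> \<nu> \<Longrightarrow> Nb b \<inter> \<nu> \<noteq> {}" and v: "v \<in> T \<inter> \<nu>"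
  shows "real (card {i \<in> embs. \<forall>u\<in>\<nu>. emb i u = \<rho> u}) \<le> n ^ card ((S \<union> T) - \<nu>) * q ^ ext_exp \<nu> v"
    (is "real (card ?Z) \<le> _")
proof (cases "?Z = {}")
  case True
  show ?thesis unfolding True using n_pos q_pos by simp
next
  case False
  then obtain s0 y0 where i0: "(s0, y0) \<in> embs" "\<forall>u\<in>\<nu>. emb (s0, y0) u = \<rho> u" by auto
  have fixT: "y b = y0 b" if "(s, y) \<in> ?Z" "b \<in> T \<inter> \<nu>" for s y b
  proof (rule clone_determined[of s y s0 y0 b \<nu>])
    show "(s, y) \<in> embs" "\<forall>u\<in>\<nu>. emb (s, y) u = emb (s0, y0) u" using that(1) i0(2) by simp_all
  qed (use i0(1) that(2) nonisolated in blast)+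
  have fixS: "s a = s0 a" if "(s, y) \<in> ?Z" "a \<in> S \<inter> \<nu>" for s y a
  proof -
    have "emb (s, y) a = emb (s0, y0) a" using that i0(2) by simp
    then show ?thesis using that(2) by (simp add: emb_def)
  qed
  have cST: "card ((S \<union> T) - \<nu>) = card (S - \<nu>) + card (T - \<nu>)"
    using finS finT disj by (subst Un_Diff, subst card_Un_disjoint) auto
  have SmT: "S - S \<inter> \<nu> = S - \<nu>" "T - T \<inter> \<nu> = T - \<nu>" by auto
  have DS: "real (D ^ k) = n ^ k * q ^ k" for k by (simp add: nq[symmetric] power_mult_distrib)
  show ?thesis
  proof (cases "vs \<in> \<nu>")
    case True
    have "?Z \<subseteq> {(s, y) \<in> embs. (\<forall>a\<in>S \<inter> \<nu>. s a = s0 a) \<and> (\<forall>b\<in>T \<inter> \<nu>. y b = y0 b)}"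
    proof
      fix i assume i: "i \<in> ?Z"
      obtain s y where sy: "i = (s, y)" by (metis surj_pair)
      show "i \<in> {(s, y) \<in> embs. (\<forall>a\<in>S \<inter> \<nu>. s a = s0 a) \<and> (\<forall>b\<in>T \<inter> \<nu>. y b = y0 b)}"
        using i fixS[OF i[unfolded sy]] fixT[OF i[unfolded sy]] unfolding sy by blast
    qed
    then have "card ?Z \<le> card {(s, y) \<in> embs. (\<forall>a\<in>S \<inter> \<nu>. s a = s0 a) \<and> (\<forall>b\<in>T \<inter> \<nu>. y b = y0 b)}"
      by (intro card_mono finite_subset[OF _ finite_embs]) auto
    also have "\<dots> \<le> D ^ card (S - \<nu>) * (\<Prod>b\<in>T - \<nu>. mate_size b)"
    proof -
      have "S \<inter> \<nu> \<subseteq> S" "T \<inter> \<nu> \<subseteq> T" "vs \<in> T \<inter> \<nu>" using True vsT by auto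
      from card_fixed_part_le[OF this, of s0 y0] show ?thesis unfolding SmT .
    qed
    finally have "real (card ?Z) \<le> real (D ^ card (S - \<nu>) * (\<Prod>b\<in>T - \<nu>. mate_size b))"
      by (rule of_nat_mono)
    also have "\<dots> = real (D ^ card (S - \<nu>)) * real (\<Prod>b\<in>T - \<nu>. mate_size b)" by (rule of_nat_mult)
    also have "\<dots> \<le> real (D ^ card (S - \<nu>)) * (n ^ card (T - \<nu>) * q ^ (\<Sum>b\<in>T - \<nu>. card (Nb b)))"
      by (intro mult_left_mono prod_mate_size_le) auto
    also have "\<dots> = n ^ card ((S \<union> T) - \<nu>) * q ^ ext_exp \<nu> v"
      unfolding DS cST ext_exp_def using True by (simp add: power_add)
    finally show ?thesis .
  next
    case False
    note vsnu = False
    let ?\<Pi> = "\<Prod>b\<in>T - (T \<inter> insert vs \<nu>). mate_size b" and ?\<Pi>' = "\<Prod>b\<in>T - \<nu> - {vs}. mate_size b"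
    define S1 where "S1 = S \<inter> (\<nu> \<union> Nb v)"
    have vT: "v \<in> T" "v \<noteq> vs" "v \<in> \<nu>" using v False by auto
    have NbS: "Nb v \<subseteq> S" using Nb vT by auto
    have y0v: "y0 v \<in> clones" using embs_clone i0 vT by auto
    define A where "A = PiE (Nb v) (\<lambda>a. if a \<in> \<nu> then {s0 a} else snd (y0 v))"
    define M where "M = (\<lambda>s1. mates v (s1 ` Nb v) (y0 v))"
    define Z where "Z = (\<lambda>s1 ys. {(s, y) \<in> embs. (\<forall>a\<in>S1. s a = (if a \<in> Nb v then s1 a else s0 a)) \<and>
        (\<forall>b\<in>T \<inter> insert vs \<nu>. y b = (if b = vs then ys else y0 b))})"
    have finA: "finite A" unfolding A_def using finNb vT clone_props(4)[OF y0v] by (intro finite_PiE) auto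
    have "?Z \<subseteq> (\<Union>s1\<in>A. \<Union>ys\<in>M s1. Z s1 ys)"
    proof
      fix i assume i: "i \<in> ?Z"
      obtain s y where sy: "i = (s, y)" by (metis surj_pair)
      have embs: "(s, y) \<in> embs" and Z: "(s, y) \<in> ?Z" using i sy by auto
      define s1 where "s1 = restrict s (Nb v)"
      have yv: "y v = y0 v" using fixT[OF Z] vT by auto
      have "s1 \<in> A" unfolding A_def s1_def
        using fixS[OF Z] NbS embs_adjacent[OF embs vT(1)] yv by auto
      moreover have "y vs \<in> M s1"
      proof -
        have "y v \<in> mates v (s ` Nb v) (y vs)" using embs vT unfolding embs_def by auto
        moreover have "s1 ` Nb v = s ` Nb v" unfolding s1_def by auto
        ultimately show ?thesis unfolding M_def using mates_sym[OF vT(1,2)] yv by metis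
      qed
      moreover have "i \<in> Z s1 (y vs)"
        unfolding Z_def sy s1_def S1_def using embs fixS[OF Z] fixT[OF Z] by auto
      ultimately show "i \<in> (\<Union>s1\<in>A. \<Union>ys\<in>M s1. Z s1 ys)" by auto
    qed
    moreover have finM: "finite (M s1)" for s1 unfolding M_def using mates_finite vT by auto
    moreover have finZ: "finite (Z s1 ys)" for s1 ys
      by (rule finite_subset[OF _ finite_embs]) (auto simp: Z_def)
    ultimately have "card ?Z \<le> card (\<Union>s1\<in>A. \<Union>ys\<in>M s1. Z s1 ys)"
      using finA by (intro card_mono) auto
    also have "\<dots> \<le> (\<Sum>s1\<in>A. card (\<Union>ys\<in>M s1. Z s1 ys))" by (rule card_UN_le[OF finA])
    also have "\<dots> \<le> (\<Sum>s1\<in>A. \<Sum>ys\<in>M s1. card (Z s1 ys))"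
      using finM by (intro sum_mono card_UN_le) auto
    also have "\<dots> \<le> (\<Sum>s1\<in>A. \<Sum>ys\<in>M s1. D ^ card (S - S1) * ?\<Pi>)"
      unfolding Z_def by (intro sum_mono card_fixed_part_le) (use vsT in \<open>auto simp: S1_def\<close>)
    also have "\<dots> \<le> (\<Sum>s1\<in>A. mate_size v * (D ^ card (S - S1) * ?\<Pi>))"
    proof (intro sum_mono)
      fix s1
      have "card (M s1) \<le> mate_size v" unfolding M_def by (rule mates_card_le[OF vT(1,2)])
      then show "(\<Sum>ys\<in>M s1. D ^ card (S - S1) * ?\<Pi>)
        \<le> mate_size v * (D ^ card (S - S1) * ?\<Pi>)" by simp
    qed
    also have "\<dots> = card A * (mate_size v * (D ^ card (S - S1) * ?\<Pi>))" by simp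
    also have "card A = (\<Prod>a\<in>Nb v. card (if a \<in> \<nu> then {s0 a} else snd (y0 v)))"
      unfolding A_def by (rule card_PiE[OF finNb[OF vT(1)]])
    also have "\<dots> = (\<Prod>a\<in>Nb v. if a \<in> \<nu> then 1 else D)"
      using clone_props(3)[OF y0v] by (intro prod.cong) auto
    also have "\<dots> = (\<Prod>a\<in>Nb v - \<nu>. D)"
      using finNb[OF vT(1)] by (intro prod.mono_neutral_cong_right) auto
    also have "\<dots> = D ^ card (Nb v - \<nu>)" by simp
    also have "T - (T \<inter> insert vs \<nu>) = T - \<nu> - {vs}" by auto
    also have "D ^ card (Nb v - \<nu>) * (mate_size v * (D ^ card (S - S1) * ?\<Pi>')) =
        D ^ card (S - \<nu>) * mate_size v * ?\<Pi>'"
    proof -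
      have "S - \<nu> = (Nb v - \<nu>) \<union> (S - S1)" "(Nb v - \<nu>) \<inter> (S - S1) = {}"
        using NbS unfolding S1_def by auto
      then have "card (S - \<nu>) = card (Nb v - \<nu>) + card (S - S1)"
        using finS finNb[OF vT(1)] by (simp add: card_Un_disjoint)
      then show ?thesis by (simp add: power_add mult_ac)
    qed
    finally have "real (card ?Z) \<le> real (D ^ card (S - \<nu>) * mate_size v * ?\<Pi>')"
      by (rule of_nat_mono)
    also have "\<dots> = real (D ^ card (S - \<nu>)) * real (mate_size v) * real ?\<Pi>'" by simp
    also have "\<dots> \<le> real (D ^ card (S - \<nu>)) * (n ^ 1 * q ^ card (Nb v)) *
       (n ^ card (T - \<nu> - {vs}) * q ^ (\<Sum>b\<in>T - \<nu> - {vs}. card (Nb b)))"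
    proof (rule mult_mono)
      show "real (D ^ card (S - \<nu>)) * real (mate_size v) \<le> real (D ^ card (S - \<nu>)) * (n ^ 1 * q ^ card (Nb v))"
        using prod_mate_size_le[of "{v}"] vT by (intro mult_left_mono) auto
      show "real ?\<Pi>' \<le> n ^ card (T - \<nu> - {vs}) * q ^ (\<Sum>b\<in>T - \<nu> - {vs}. card (Nb b))"
        by (rule prod_mate_size_le) auto
      show "0 \<le> real (D ^ card (S - \<nu>)) * (n ^ 1 * q ^ card (Nb v))" using n_pos q_pos by simp
    qed (rule of_nat_0_le_iff)
    also have "\<dots> = n ^ card ((S \<union> T) - \<nu>) * q ^ ext_exp \<nu> v"
    proof -
      have "card (T - \<nu>) = Suc (card (T - \<nu> - {vs}))"
        using finT vsT vsnu by (intro card_Suc_Diff1[symmetric]) auto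
      then show ?thesis unfolding DS cST ext_exp_def using vsnu by (simp add: power_add mult_ac)
    qed
    finally show ?thesis .
  qed
qed

text \<open>An embedding whose copy contains the edges in \<open>X\<close> maps some set \<open>\<sigma>\<close>
  of \<open>|X|\<close> pattern edges onto \<open>X\<close>, hence \<open>\<Union>\<sigma>\<close>
  into \<open>\<Union>X\<close>. There are boundedly many such \<open>\<sigma>\<close> and maps, and
  each map has few extensions.\<close>

lemma codegree_bound:
  assumes X: "X \<noteq> {}" and R: "R \<ge> 0"
    and ext: "\<And>\<sigma>. \<sigma> \<subseteq> pattern_edges \<Longrightarrow> card \<sigma> = card X \<Longrightarrow>
      \<exists>v\<in>T \<inter> \<Union>\<sigma>. n ^ card ((S \<union> T) - \<Union>\<sigma>) * q ^ ext_exp (\<Union>\<sigma>) v \<le> R"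
  shows "real (card {i \<in> embs. X \<subseteq> emb_edges i})
    \<le> 2 ^ card pattern_edges * real (2 * card pattern_edges + 1) ^ card (S \<union> T) * R"
proof (cases "{i \<in> embs. X \<subseteq> emb_edges i} = {}")
  case True
  show ?thesis unfolding True using R by simp
next
  case False
  let ?M = "\<lambda>\<sigma>. \<Union>\<sigma> \<rightarrow>\<^sub>E \<Union>X"
  define E where "E = pattern_edges"
  have finE: "finite E" unfolding E_def by (rule finite_pattern_edges)
  have finU: "finite (S \<union> T)" using finS finT by auto
  obtain i0 where i0: "i0 \<in> embs" "X \<subseteq> emb_edges i0" using False by auto
  have XC: "X \<subseteq> C" using i0(2) emb_edges_subset[OF i0(1)] by (rule order_trans)
  have finX: "finite X" using i0(2) finE unfolding emb_edges_def E_def by (auto intro: finite_subset)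
  have XE: "card X \<le> card E"
    using card_mono[OF _ i0(2)] card_emb_edges[OF i0(1)] finE unfolding emb_edges_def E_def by auto
  have cUX: "card (\<Union>X) \<le> 2 * card E"
  proof -
    have "card (\<Union>X) \<le> (\<Sum>e\<in>X. card e)" using card_UN_le[OF finX, of "\<lambda>e. e"] by simp
    also have "\<dots> = (\<Sum>e\<in>X. 2)" using C XC by (intro sum.cong) auto
    finally show ?thesis using XE by simp
  qed
  have finUX: "finite (\<Union>X)" using C XC finV finX by (meson finite_Union finite_subset subsetD)
  define \<Sigma> where "\<Sigma> = {\<sigma>. \<sigma> \<subseteq> E \<and> card \<sigma> = card X}"
  have fin\<Sigma>: "finite \<Sigma>" unfolding \<Sigma>_def using finE by auto
  have \<Sigma>U: "\<Union>\<sigma> \<subseteq> S \<union> T" if "\<sigma> \<in> \<Sigma>" for \<sigma>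
    using that pattern_edge_subset unfolding \<Sigma>_def E_def by auto
  define Z where "Z = (\<lambda>\<sigma> \<rho>. {i \<in> embs. \<forall>u\<in>\<Union>\<sigma>. emb i u = \<rho> u})"
  have Zle: "real (card (Z \<sigma> \<rho>)) \<le> R" if sig: "\<sigma> \<in> \<Sigma>" for \<sigma> and \<rho> :: "'a \<Rightarrow> 'v"
  proof -
    obtain v where v: "v \<in> T \<inter> \<Union>\<sigma>" "n ^ card ((S \<union> T) - \<Union>\<sigma>) * q ^ ext_exp (\<Union>\<sigma>) v \<le> R"
      using ext[of \<sigma>] sig unfolding \<Sigma>_def E_def by auto
    have "Nb b \<inter> \<Union>\<sigma> \<noteq> {}" if b: "b \<in> T \<inter> \<Union>\<sigma>" for b
    proof -
      obtain e where e: "e \<in> \<sigma>" "b \<in> e" using b by auto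
      then obtain b' a' where "b' \<in> T" "a' \<in> Nb b'" "e = {a', b'}"
        using sig unfolding \<Sigma>_def E_def pattern_edges_def by blast
      moreover from this have "a' \<in> S" using Nb by auto
      ultimately have "b = b'" "a' \<in> \<Union>\<sigma>" using e b disj by auto
      then show ?thesis using \<open>a' \<in> Nb b'\<close> by auto
    qed
    then have "real (card (Z \<sigma> \<rho>)) \<le> n ^ card ((S \<union> T) - \<Union>\<sigma>) * q ^ ext_exp (\<Union>\<sigma>) v"
      unfolding Z_def using v(1) \<Sigma>U[OF sig] by (intro extension_bound) auto
    then show ?thesis using v(2) by linarith
  qed
  have "{i \<in> embs. X \<subseteq> emb_edges i} \<subseteq> (\<Union>\<sigma>\<in>\<Sigma>. \<Union>\<rho>\<in>?M \<sigma>. Z \<sigma> \<rho>)"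
  proof
    fix i assume i: "i \<in> {i \<in> embs. X \<subseteq> emb_edges i}"
    define \<sigma> where "\<sigma> = {e \<in> E. emb i ` e \<in> X}"
    have inj: "inj_on (emb i) (S \<union> T)" using emb_inj i by auto
    have "inj_on (\<lambda>e. emb i ` e) \<sigma>"
      using inj_on_image_eq_iff[OF inj] pattern_edge_subset unfolding \<sigma>_def E_def by (intro inj_onI) auto
    moreover have img: "(\<lambda>e. emb i ` e) ` \<sigma> = X" using i unfolding \<sigma>_def emb_edges_def E_def by auto
    ultimately have "card \<sigma> = card X" using card_image by metis
    then have "\<sigma> \<in> \<Sigma>" unfolding \<Sigma>_def by (auto simp: \<sigma>_def)
    moreover have "restrict (emb i) (\<Union>\<sigma>) \<in> \<Union>\<sigma> \<rightarrow>\<^sub>E \<Union>X" using img by auto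
    moreover have "i \<in> Z \<sigma> (restrict (emb i) (\<Union>\<sigma>))" unfolding Z_def using i by auto
    ultimately show "i \<in> (\<Union>\<sigma>\<in>\<Sigma>. \<Union>\<rho>\<in>?M \<sigma>. Z \<sigma> \<rho>)" by blast
  qed
  moreover have finF: "finite (?M \<sigma>)" if "\<sigma> \<in> \<Sigma>" for \<sigma>
    using \<Sigma>U[OF that] finU finUX finite_subset by (intro finite_PiE) auto
  moreover have finZ: "finite (Z \<sigma> \<rho>)" for \<sigma> \<rho> unfolding Z_def using finite_embs by auto
  ultimately have "card {i \<in> embs. X \<subseteq> emb_edges i} \<le> card (\<Union>\<sigma>\<in>\<Sigma>. \<Union>\<rho>\<in>?M \<sigma>. Z \<sigma> \<rho>)"
    using fin\<Sigma> by (intro card_mono) auto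
  also have "\<dots> \<le> (\<Sum>\<sigma>\<in>\<Sigma>. card (\<Union>\<rho>\<in>?M \<sigma>. Z \<sigma> \<rho>))" by (rule card_UN_le[OF fin\<Sigma>])
  also have "\<dots> \<le> (\<Sum>\<sigma>\<in>\<Sigma>. \<Sum>\<rho>\<in>?M \<sigma>. card (Z \<sigma> \<rho>))"
    using finF by (intro sum_mono card_UN_le) auto
  finally have "real (card {i \<in> embs. X \<subseteq> emb_edges i}) \<le> real (\<Sum>\<sigma>\<in>\<Sigma>. \<Sum>\<rho>\<in>?M \<sigma>. card (Z \<sigma> \<rho>))"
    by (rule of_nat_mono)
  also have "\<dots> = (\<Sum>\<sigma>\<in>\<Sigma>. \<Sum>\<rho>\<in>?M \<sigma>. real (card (Z \<sigma> \<rho>)))" by simp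
  also have "\<dots> \<le> (\<Sum>\<sigma>\<in>\<Sigma>. \<Sum>\<rho>\<in>?M \<sigma>. R)" using Zle by (intro sum_mono) auto
  also have "\<dots> = (\<Sum>\<sigma>\<in>\<Sigma>. real (card (?M \<sigma>)) * R)" by simp
  also have "\<dots> \<le> (\<Sum>\<sigma>\<in>\<Sigma>. real (2 * card E + 1) ^ card (S \<union> T) * R)"
  proof (intro sum_mono mult_right_mono[OF _ R])
    fix \<sigma> assume \<sigma>: "\<sigma> \<in> \<Sigma>"
    have "finite (\<Union>\<sigma>)" using \<Sigma>U[OF \<sigma>] finU finite_subset by metis
    then have "card (?M \<sigma>) = card (\<Union>X) ^ card (\<Union>\<sigma>)" by (simp add: card_PiE)
    also have "\<dots> \<le> (2 * card E + 1) ^ card (\<Union>\<sigma>)" using cUX by (intro power_mono) auto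
    also have "\<dots> \<le> (2 * card E + 1) ^ card (S \<union> T)"
      using card_mono[OF finU \<Sigma>U[OF \<sigma>]] by (intro power_increasing) auto
    finally have "real (card (?M \<sigma>)) \<le> real ((2 * card E + 1) ^ card (S \<union> T))"
      by (rule of_nat_mono)
    then show "real (card (?M \<sigma>)) \<le> real (2 * card E + 1) ^ card (S \<union> T)" by simp
  qed
  also have "\<dots> = card \<Sigma> * (real (2 * card E + 1) ^ card (S \<union> T) * R)" by simp
  also have "\<dots> \<le> 2 ^ card E * (real (2 * card E + 1) ^ card (S \<union> T) * R)"
  proof -
    have "card \<Sigma> \<le> card (Pow E)" unfolding \<Sigma>_def using finE by (intro card_mono) auto
    also have "\<dots> = 2 ^ card E" by (rule card_Pow[OF finE])
    finally have "real (card \<Sigma>) \<le> real (2 ^ card E)" by (rule of_nat_mono)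
    then show ?thesis using R by (intro mult_right_mono) auto
  qed
  finally show ?thesis unfolding E_def by (simp add: mult_ac)
qed

lemma card_clones_ge: "n \<le> card clones"
proof -
  have "(\<Sum>t\<in>V. card (nbhd t)) = (\<Sum>t\<in>V. card {e \<in> C. t \<in> e})"
  proof (intro sum.cong refl)
    fix t assume "t \<in> V"
    have "bij_betw (\<lambda>s. {s, t}) (nbhd t) {e \<in> C. t \<in> e}"
    proof (intro bij_betwI')
      fix s s' assume "s \<in> nbhd t" "s' \<in> nbhd t"
      then show "({s, t} = {s', t}) = (s = s')" using nbhd_subset[of t] by (auto simp: doubleton_eq_iff)
    next
      fix s assume "s \<in> nbhd t" then show "{s, t} \<in> {e \<in> C. t \<in> e}" unfolding nbhd_def by auto
    next
      fix e assume e: "e \<in> {e \<in> C. t \<in> e}"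
      then have "card e = 2" using C by auto
      then obtain u w where "e = {u, w}" by (auto simp: card_2_iff)
      then show "\<exists>s\<in>nbhd t. e = {s, t}" using e unfolding nbhd_def by (auto simp: insert_commute)
    qed
    then show "card (nbhd t) = card {e \<in> C. t \<in> e}" by (rule bij_betw_same_card)
  qed
  also have "\<dots> = (\<Sum>e\<in>C. card {t \<in> V. t \<in> e})"
  proof -
    have "finite C" by (rule finite_subset[of _ "Pow V"]) (use C finV in auto)
    then show ?thesis using sum_multicount_gen[OF finV, of C "\<lambda>t e. t \<in> e" "\<lambda>e. card {t \<in> V. t \<in> e}"] by simp
  qed
  also have "\<dots> = (\<Sum>e\<in>C. 2)"
  proof (intro sum.cong refl)
    fix e assume "e \<in> C"
    then have "{t \<in> V. t \<in> e} = e" "card e = 2" using C by auto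
    then show "card {t \<in> V. t \<in> e} = 2" by simp
  qed
  also have "\<dots> = 2 * card C" by simp
  finally have deg: "(\<Sum>t\<in>V. card (nbhd t)) = 2 * card C" .
  have "(\<Sum>t\<in>V. card (nbhd t)) \<le> (\<Sum>t\<in>V. D * card (blocks D (nbhd t)) + D)"
    using card_blocks[OF finite_nbhd D1] by (intro sum_mono less_imp_le)
  also have "\<dots> = D * (\<Sum>t\<in>V. card (blocks D (nbhd t))) + D * card V"
    by (simp add: sum.distrib sum_distrib_left mult.commute)
  also have "(\<Sum>t\<in>V. card (blocks D (nbhd t))) = card clones"
  proof -
    have "finite (blocks D (nbhd t))" for t
      by (rule finite_subset[of _ "Pow (nbhd t)"]) (use blocks_subset[OF finite_nbhd D1] finite_nbhd in auto)
    then show ?thesis unfolding clones_def using finV by simp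
  qed
  finally have "D * card V \<le> D * card clones" using deg D by linarith
  then show ?thesis using D1 by simp
qed

lemma card_injections_ge:
  assumes "finite B" "card B = D"
  shows "(D / 2) ^ card S \<le> real (card {s \<in> S \<rightarrow>\<^sub>E B. inj_on s S})"
proof -
  have "(D - card S) ^ card S \<le> card {s \<in> S \<rightarrow>\<^sub>E B. inj_on s S}"
    using card_injective_choices_ge[OF finS, of "{}" "\<lambda>_. B" id "\<lambda>_. D - card S"] assms D_ge by simp
  then have "real ((D - card S) ^ card S) \<le> real (card {s \<in> S \<rightarrow>\<^sub>E B. inj_on s S})" by (rule of_nat_mono)
  moreover have "(D / 2) ^ card S \<le> real (D - card S) ^ card S"
    using D_ge by (intro power_mono) auto
  moreover have "real ((D - card S) ^ card S) = real (D - card S) ^ card S" by simp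
  ultimately show ?thesis by linarith
qed

text \<open>After one of these choices for \<open>S\<close>, every vertex of \<open>T\<close> other than
  \<open>vs\<close> still has a full block of possible images.\<close>

definition good :: "('v \<times> 'v set) \<Rightarrow> ('a \<Rightarrow> 'v) set" where
  "good y = {s \<in> S \<rightarrow>\<^sub>E snd y. inj_on s S \<and>
     (\<forall>b\<in>T - {vs}. y \<in> \<Union>(blocks (mate_size b) (common (s ` Nb b))))}"

text \<open>For a given image of \<open>Nb b\<close>, fewer than \<open>mate_size b\<close> common neighbours
  are left out of the blocks. The number of pairs is thus counted from the image of
  \<open>Nb b\<close>, with no assumption on how codegrees are distributed.\<close>

lemma card_bad_le:
  assumes b: "b \<in> T - {vs}"
  shows "real (card (SIGMA y:clones. {s \<in> S \<rightarrow>\<^sub>E snd y. y \<notin> \<Union>(blocks (mate_size b) (common (s ` Nb b)))}))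
    \<le> \<epsilon> * n * D ^ card S" (is "real (card ?Z) \<le> _")
proof -
  define A where "A = (Nb b \<rightarrow>\<^sub>E V)"
  define R where "R = (\<lambda>s1. common (s1 ` Nb b) - \<Union>(blocks (mate_size b) (common (s1 ` Nb b))))"
  define W where "W = (\<lambda>(s1 :: 'a \<Rightarrow> 'v) (y :: 'v \<times> 'v set). {y} \<times> PiE S (\<lambda>a. if a \<in> Nb b then {s1 a} else snd y))"
  have Lb: "mate_size b > 0" using mate_size_pos b by auto
  have bT: "b \<in> T" using b by auto
  have NbS: "Nb b \<subseteq> S" using Nb bT by auto
  have finA: "finite A" unfolding A_def using finNb[OF bT] finV by (intro finite_PiE) auto
  have cardA: "card A = card V ^ card (Nb b)" unfolding A_def by (simp add: card_PiE finNb[OF bT])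
  have finR: "finite (R s1)" for s1 unfolding R_def using finite_common by auto
  have cardR: "card (R s1) \<le> mate_size b" for s1
    unfolding R_def using blocks_rest[OF finite_common Lb] by (simp add: less_imp_le)
  have Rc: "y \<in> clones" if "y \<in> R s1" for y s1 using that common_subset unfolding R_def by auto
  have finW: "finite (W s1 y)" if "y \<in> clones" for s1 y
    unfolding W_def using finS clone_props(4)[OF that] by (intro finite_cartesian_product finite_PiE) auto
  have cardW: "card (W s1 y) = D ^ (card S - card (Nb b))" if "y \<in> clones" for s1 y
  proof -
    have "card (W s1 y) = (\<Prod>a\<in>S. card (if a \<in> Nb b then {s1 a} else snd y))"
      unfolding W_def by (simp add: card_cartesian_product card_PiE[OF finS])
    also have "\<dots> = (\<Prod>a\<in>S. if a \<in> Nb b then 1 else D)"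
      using clone_props(3)[OF that] by (intro prod.cong) auto
    also have "\<dots> = (\<Prod>a\<in>S - Nb b. D)"
      using finS by (intro prod.mono_neutral_cong_right) auto
    finally show ?thesis using card_Diff_subset[OF finNb[OF bT] NbS] by simp
  qed
  have "?Z \<subseteq> (\<Union>s1\<in>A. \<Union>y\<in>R s1. W s1 y)"
  proof
    fix p assume "p \<in> ?Z"
    then obtain y s where p: "p = (y, s)" "y \<in> clones" "s \<in> S \<rightarrow>\<^sub>E snd y"
      "y \<notin> \<Union>(blocks (mate_size b) (common (s ` Nb b)))" by auto
    define s1 where "s1 = restrict s (Nb b)"
    have img: "s1 ` Nb b = s ` Nb b" unfolding s1_def by auto
    have sy: "s ` Nb b \<subseteq> snd y" using p(3) NbS by auto
    have "s1 \<in> A" unfolding A_def s1_def using sy clone_props(5)[OF p(2)] by auto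
    moreover have "y \<in> R s1" unfolding R_def img using p(2,4) sy by (auto simp: common_def)
    moreover have "p \<in> W s1 y" unfolding W_def p(1) s1_def using p(3) by (auto simp: PiE_iff)
    ultimately show "p \<in> (\<Union>s1\<in>A. \<Union>y\<in>R s1. W s1 y)" by blast
  qed
  then have "card ?Z \<le> card (\<Union>s1\<in>A. \<Union>y\<in>R s1. W s1 y)"
    using finA finR finW Rc by (intro card_mono) auto
  also have "\<dots> \<le> (\<Sum>s1\<in>A. card (\<Union>y\<in>R s1. W s1 y))" by (rule card_UN_le[OF finA])
  also have "\<dots> \<le> (\<Sum>s1\<in>A. \<Sum>y\<in>R s1. card (W s1 y))" using finR by (intro sum_mono card_UN_le) auto
  also have "\<dots> = (\<Sum>s1\<in>A. card (R s1) * D ^ (card S - card (Nb b)))"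
    using cardW Rc by simp
  also have "\<dots> \<le> (\<Sum>s1\<in>A. mate_size b * D ^ (card S - card (Nb b)))"
    using cardR by (intro sum_mono mult_right_mono) auto
  also have "\<dots> = card V ^ card (Nb b) * (mate_size b * D ^ (card S - card (Nb b)))" by (simp add: cardA)
  finally have "real (card ?Z) \<le> real (card V ^ card (Nb b) * (mate_size b * D ^ (card S - card (Nb b))))"
    by (rule of_nat_mono)
  also have "\<dots> = n ^ card (Nb b) * (real (mate_size b) * D ^ (card S - card (Nb b)))" by simp
  also have "\<dots> \<le> n ^ card (Nb b) * ((\<epsilon> * n * q ^ card (Nb b)) * D ^ (card S - card (Nb b)))"
    using mate_size_le[OF bT] n_pos by (intro mult_left_mono mult_right_mono) auto
  also have "\<dots> = \<epsilon> * n * ((n * q) ^ card (Nb b) * D ^ (card S - card (Nb b)))"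
    by (simp add: power_mult_distrib)
  also have "(n * q) ^ card (Nb b) * D ^ (card S - card (Nb b)) = D ^ card S"
    unfolding nq using card_mono[OF finS NbS] by (simp add: power_add[symmetric])
  finally show ?thesis by simp
qed

lemma sum_card_good_ge:
  "n * D ^ card S / 2 ^ (card S + 1) \<le> real (\<Sum>y\<in>clones. card (good y))"
proof -
  define Inj where "Inj = (SIGMA y:clones. {s \<in> S \<rightarrow>\<^sub>E snd y. inj_on s S})"
  define Bad where "Bad = (\<lambda>b. SIGMA y:clones. {s \<in> S \<rightarrow>\<^sub>E snd y. y \<notin> \<Union>(blocks (mate_size b) (common (s ` Nb b)))})"
  have finE: "finite (S \<rightarrow>\<^sub>E snd y)" if "y \<in> clones" for y
    using finS clone_props(4)[OF that] by (intro finite_PiE) auto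
  have fgood: "finite (good y)" if "y \<in> clones" for y using finE[OF that] unfolding good_def by auto
  have finI: "finite Inj" unfolding Inj_def using finite_clones finE by auto
  have finB: "finite (Bad b)" for b unfolding Bad_def using finite_clones finE by auto
  have "Inj \<subseteq> (SIGMA y:clones. good y) \<union> (\<Union>b\<in>T - {vs}. Bad b)"
    unfolding Inj_def Bad_def good_def by auto
  then have "card Inj \<le> card ((SIGMA y:clones. good y) \<union> (\<Union>b\<in>T - {vs}. Bad b))"
    using finite_clones fgood finT finB by (intro card_mono) auto
  also have "\<dots> \<le> card (SIGMA y:clones. good y) + card (\<Union>b\<in>T - {vs}. Bad b)" by (rule card_Un_le)
  also have "card (SIGMA y:clones. good y) = (\<Sum>y\<in>clones. card (good y))"
    using finite_clones fgood by simp
  also have "card (\<Union>b\<in>T - {vs}. Bad b) \<le> (\<Sum>b\<in>T - {vs}. card (Bad b))"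
    using finT by (intro card_UN_le) auto
  finally have "card Inj \<le> (\<Sum>y\<in>clones. card (good y)) + (\<Sum>b\<in>T - {vs}. card (Bad b))" by simp
  from of_nat_mono[OF this, where 'a = real]
  have 1: "real (card Inj) \<le> real (\<Sum>y\<in>clones. card (good y)) + (\<Sum>b\<in>T - {vs}. real (card (Bad b)))"
    by (simp only: of_nat_add of_nat_sum)
  have "(\<Sum>b\<in>T - {vs}. real (card (Bad b))) \<le> (\<Sum>b\<in>T - {vs}. \<epsilon> * n * D ^ card S)"
    unfolding Bad_def by (intro sum_mono card_bad_le)
  also have "\<dots> \<le> card T * (\<epsilon> * n * D ^ card S)"
    using \<epsilon>_pos n_pos card_mono[OF finT, of "T - {vs}"] by (auto intro!: mult_right_mono)
  also have "\<dots> = n * D ^ card S / 2 ^ (card S + 1)"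
    unfolding \<epsilon>_def using cardT by (simp add: field_simps)
  finally have 2: "(\<Sum>b\<in>T - {vs}. real (card (Bad b))) \<le> n * D ^ card S / 2 ^ (card S + 1)" .
  have "n * (D / 2) ^ card S \<le> card clones * (D / 2) ^ card S"
    using card_clones_ge by (intro mult_right_mono) auto
  also have "\<dots> = (\<Sum>y\<in>clones. (D / 2) ^ card S)" by simp
  also have "\<dots> \<le> (\<Sum>y\<in>clones. real (card {s \<in> S \<rightarrow>\<^sub>E snd y. inj_on s S}))"
    using clone_props by (intro sum_mono card_injections_ge) auto
  also have "\<dots> = real (card Inj)" unfolding Inj_def using finite_clones finE by simp
  finally have "n * (D / 2) ^ card S \<le> real (card Inj)" .
  moreover have "n * (D / 2) ^ card S = 2 * (n * D ^ card S / 2 ^ (card S + 1))"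
    by (simp add: power_divide)
  ultimately show ?thesis using 1 2 by linarith
qed

text \<open>Most clones \<open>y\<close> and maps of \<open>S\<close> into the neighbourhood of \<open>y\<close>
  are good; the remaining vertices of \<open>T\<close> are then chosen greedily in their blocks. The
  blocks are long enough to avoid all vertices used before, because clones with a common neighbour
  belong to different vertices.\<close>

lemma card_embs_ge:
  "(\<epsilon> / 2) ^ card T / 2 ^ (card S + 1) * n ^ card (S \<union> T) * q ^ (\<Sum>b\<in>T. card (Nb b)) \<le> real (card embs)"
proof -
  define T' where "T' = T - {vs}"
  have finT': "finite T'" unfolding T'_def using finT by auto
  define m where "m = (\<lambda>b. mate_size b - (card S + card T))"
  define F where "F = (\<lambda>(y, s). {f \<in> PiE T' (\<lambda>b. mates b (s ` Nb b) y).
     inj_on (fst \<circ> f) T' \<and> (fst \<circ> f) ` T' \<inter> (s ` S \<union> {fst y}) = {}})"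
  define G where "G = (SIGMA y:clones. good y)"
  define \<Phi> where "\<Phi> = (\<lambda>(p, f). (snd p, f(vs := fst p)) :: ('a \<Rightarrow> 'v) \<times> ('a \<Rightarrow> 'v \<times> 'v set))"
  have cT: "card T = Suc (card T')" unfolding T'_def using card_Suc_Diff1[OF finT vsT] by simp
  have fgood: "finite (good y)" if "y \<in> clones" for y
    by (rule finite_subset[of _ "S \<rightarrow>\<^sub>E snd y"]) (use finS clone_props(4)[OF that] in \<open>auto simp: good_def intro!: finite_PiE\<close>)
  have finG: "finite G" unfolding G_def using finite_clones fgood by auto
  have finF: "finite (F p)" for p
  proof -
    obtain y s where p: "p = (y, s)" by (metis surj_pair)
    have "finite (PiE T' (\<lambda>b. mates b (s ` Nb b) y))"
      using finT' mates_finite unfolding T'_def by (intro finite_PiE) auto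
    then show ?thesis unfolding F_def p by simp
  qed
  have F: "(\<Prod>b\<in>T'. m b) \<le> card (F p)" if "p \<in> G" for p
  proof -
    obtain y s where p: "p = (y, s)" by (metis surj_pair)
    have y: "y \<in> clones" "s \<in> good y" using that p unfolding G_def by auto
    show ?thesis unfolding F_def p prod.case
    proof (rule card_injective_choices_ge[OF finT'])
      show "finite (s ` S \<union> {fst y})" using finS by auto
      fix b assume b: "b \<in> T'"
      then have b': "b \<in> T" "b \<noteq> vs" unfolding T'_def by auto
      have "y \<in> \<Union>(blocks (mate_size b) (common (s ` Nb b)))" using y b unfolding good_def T'_def by auto
      then have "card (mates b (s ` Nb b) y) = mate_size b" by (rule mates_card[OF b'])
      moreover have "card (s ` S \<union> {fst y}) \<le> card S + 1"
        using card_Un_le[of "s ` S" "{fst y}"] card_image_le[OF finS, of s] by simp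
      moreover have "mate_size b \<ge> card S + card T"
      proof -
        have "real (mate_size b) \<ge> \<epsilon> / 2 * n * q ^ card (Nb b) + card S + card T" by (rule mate_size_ge[OF b'])
        moreover have "\<epsilon> / 2 * n * q ^ card (Nb b) \<ge> 0" using \<epsilon>_pos n_pos q_pos by simp
        ultimately have "real (mate_size b) \<ge> real (card S + card T)" by simp
        then show ?thesis by (simp only: of_nat_le_iff)
      qed
      moreover have "inj_on fst (mates b (s ` Nb b) y)"
      proof (rule inj_on_subset[OF inj_on_fst_common mates_common[OF b']])
        show "s ` Nb b \<noteq> {}" using Nb[OF b'(1)] by simp
      qed
      moreover have "m b = mate_size b - (card S + Suc (card T'))" unfolding m_def cT ..
      ultimately show "finite (mates b (s ` Nb b) y) \<and> inj_on fst (mates b (s ` Nb b) y) \<and>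
         m b + card (s ` S \<union> {fst y}) + card T' \<le> card (mates b (s ` Nb b) y)"
        using mates_finite[OF b'] cT by (intro conjI) (blast, blast, arith)
    qed
  qed
  have "(\<Sum>y\<in>clones. card (good y)) * (\<Prod>b\<in>T'. m b) = card G * (\<Prod>b\<in>T'. m b)"
    unfolding G_def using finite_clones fgood by simp
  also have "\<dots> = (\<Sum>p\<in>G. \<Prod>b\<in>T'. m b)" by simp
  also have "\<dots> \<le> (\<Sum>p\<in>G. card (F p))" by (intro sum_mono F)
  also have "\<dots> = card (Sigma G F)" using finG finF by simp
  also have "\<dots> = card (\<Phi> ` Sigma G F)"
  proof (rule card_image[symmetric], rule inj_onI)
    fix u u' assume u: "u \<in> Sigma G F" "u' \<in> Sigma G F" and eq: "\<Phi> u = \<Phi> u'"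
    obtain y s f where 1: "u = ((y, s), f)" by (metis surj_pair)
    obtain y' s' f' where 2: "u' = ((y', s'), f')" by (metis surj_pair)
    have e: "s = s'" "f(vs := y) = f'(vs := y')" using eq unfolding \<Phi>_def 1 2 by auto
    have "f vs = undefined" "f' vs = undefined"
      using u unfolding 1 2 F_def T'_def by (auto simp: PiE_def extensional_def)
    then have "f = f'" "y = y'" using e(2) by (metis fun_upd_triv fun_upd_upd, metis fun_upd_same)
    then show "u = u'" using e 1 2 by simp
  qed
  also have "\<dots> \<le> card embs"
  proof (intro card_mono[OF finite_embs] subsetI)
    fix i assume "i \<in> \<Phi> ` Sigma G F"
    then obtain y s f where i: "i = (s, f(vs := y))" "y \<in> clones" "s \<in> good y" "f \<in> F (y, s)"
      unfolding \<Phi>_def G_def by auto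
    define g where "g = f(vs := y)"
    have s: "s \<in> S \<rightarrow>\<^sub>E snd y" "inj_on s S" using i(3) unfolding good_def by auto
    have f: "f \<in> PiE T' (\<lambda>b. mates b (s ` Nb b) y)" "inj_on (fst \<circ> f) T'"
      "(fst \<circ> f) ` T' \<inter> (s ` S \<union> {fst y}) = {}" using i(4) unfolding F_def by auto
    have g: "g vs = y" "g b = f b" if "b \<in> T'" for b using that unfolding g_def T'_def by auto
    have gv: "g vs = y" unfolding g_def by simp
    have T: "T = insert vs T'" using vsT unfolding T'_def by auto
    have mc: "f b \<in> clones" if "b \<in> T'" for b
      using f(1) that mates_common[of b "s ` Nb b" y] common_subset unfolding T'_def by (auto simp: PiE_iff)
    have "s \<in> S \<rightarrow>\<^sub>E V" using s(1) clone_props(5)[OF i(2)] by (auto simp: PiE_iff)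
    moreover have "g \<in> T \<rightarrow>\<^sub>E clones"
      using mc i(2) f(1) unfolding g_def T by (auto simp: PiE_iff extensional_def)
    moreover have "(fst \<circ> g) ` T' = (fst \<circ> f) ` T'" using g by (intro image_cong) auto
    moreover have "inj_on (fst \<circ> g) T'" using f(2) g by (auto simp: inj_on_def)
    moreover have "(fst \<circ> g) vs \<notin> (fst \<circ> f) ` T'" using f(3) gv by auto
    moreover have "vs \<notin> T'" unfolding T'_def by auto
    moreover have "fst y \<notin> s ` S" using s(1) clone_props(6)[OF i(2)] by auto
    moreover have "s ` S \<subseteq> snd (g vs)" using s(1) gv by auto
    moreover have "\<forall>b\<in>T - {vs}. g b \<in> mates b (s ` Nb b) (g vs)"
      using f(1) gv g unfolding T'_def[symmetric] by auto
    moreover have "inj_on (fst \<circ> g) T" unfolding T using calculation by (simp add: insert_Diff_if)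
    moreover have "s ` S \<inter> (fst \<circ> g) ` T = {}" unfolding T using calculation f(3) gv by auto
    ultimately show "i \<in> embs" unfolding embs_def i(1) g_def[symmetric] using s(2) by auto
  qed
  finally have "real ((\<Sum>y\<in>clones. card (good y)) * (\<Prod>b\<in>T'. m b)) \<le> real (card embs)" by (rule of_nat_mono)
  then have main: "real (\<Sum>y\<in>clones. card (good y)) * (\<Prod>b\<in>T'. real (m b)) \<le> real (card embs)" by simp
  have mb: "\<epsilon> / 2 * n * q ^ card (Nb b) \<le> real (m b)" if "b \<in> T'" for b
  proof -
    have b': "b \<in> T" "b \<noteq> vs" using that unfolding T'_def by auto
    show ?thesis using mate_size_ge[OF b'] unfolding m_def by linarith
  qed
  have pos: "\<epsilon> / 2 * n * q ^ k > 0" for k using \<epsilon>_pos n_pos q_pos by simp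
  have "(n * D ^ card S / 2 ^ (card S + 1)) * (\<Prod>b\<in>T'. \<epsilon> / 2 * n * q ^ card (Nb b))
      \<le> real (\<Sum>y\<in>clones. card (good y)) * (\<Prod>b\<in>T'. real (m b))"
  proof (rule mult_mono[OF sum_card_good_ge])
    show "(\<Prod>b\<in>T'. \<epsilon> / 2 * n * q ^ card (Nb b)) \<le> (\<Prod>b\<in>T'. real (m b))"
      by (intro prod_mono conjI mb less_imp_le[OF pos])
    show "0 \<le> (\<Prod>b\<in>T'. \<epsilon> / 2 * n * q ^ card (Nb b))" by (intro prod_nonneg less_imp_le[OF pos])
  qed (rule of_nat_0_le_iff)
  also note main
  finally have "(n * D ^ card S / 2 ^ (card S + 1)) * (\<Prod>b\<in>T'. \<epsilon> / 2 * n * q ^ card (Nb b)) \<le> real (card embs)" .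
  moreover have "(\<epsilon> / 2) ^ card T / 2 ^ (card S + 1) * n ^ card (S \<union> T) * q ^ (\<Sum>b\<in>T. card (Nb b))
     \<le> (n * D ^ card S / 2 ^ (card S + 1)) * (\<Prod>b\<in>T'. \<epsilon> / 2 * n * q ^ card (Nb b))"
  proof -
    have sumT: "(\<Sum>b\<in>T. card (Nb b)) = card S + (\<Sum>b\<in>T'. card (Nb b))"
      unfolding T'_def using sum.remove[OF finT vsT, of "\<lambda>b. card (Nb b)"] Nbvs by simp
    have cU: "card (S \<union> T) = card S + Suc (card T')"
      using card_Un_disjoint[OF finS finT disj] cT by simp
    have "(\<Prod>b\<in>T'. \<epsilon> / 2 * n * q ^ card (Nb b)) = (\<epsilon> / 2) ^ card T' * n ^ card T' * q ^ (\<Sum>b\<in>T'. card (Nb b))"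
      by (simp add: prod.distrib power_sum prod_dividef power_divide power_mult_distrib)
    moreover have "real D ^ card S = n ^ card S * q ^ card S" by (simp add: nq[symmetric] power_mult_distrib)
    ultimately have eq: "(n * D ^ card S / 2 ^ (card S + 1)) * (\<Prod>b\<in>T'. \<epsilon> / 2 * n * q ^ card (Nb b)) =
      (\<epsilon> / 2) ^ card T' * (n ^ card (S \<union> T) * q ^ (\<Sum>b\<in>T. card (Nb b)) / 2 ^ (card S + 1))"
      unfolding sumT cU by (simp add: power_add)
    have "(\<epsilon> / 2) ^ card T * (n ^ card (S \<union> T) * q ^ (\<Sum>b\<in>T. card (Nb b)) / 2 ^ (card S + 1)) \<le>
      (\<epsilon> / 2) ^ card T' * (n ^ card (S \<union> T) * q ^ (\<Sum>b\<in>T. card (Nb b)) / 2 ^ (card S + 1))"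
      using \<epsilon>_pos \<epsilon>_le n_pos q_pos unfolding cT by (intro mult_right_mono power_decreasing) auto
    then show ?thesis unfolding eq by simp
  qed
  ultimately show ?thesis by linarith
qed

end

section \<open>One container step for copies of a semi-bounded graph\<close>

context semi_bounded_pattern
begin

definition embedding_free :: "'v set set \<Rightarrow> bool" where
  "embedding_free I \<longleftrightarrow> \<not> (\<exists>\<phi>. inj_on \<phi> (S \<union> T) \<and> (\<forall>e\<in>pattern_edges. \<phi> ` e \<in> I))"

lemma embedding_free_subset: "embedding_free B \<Longrightarrow> A \<subseteq> B \<Longrightarrow> embedding_free A"
  unfolding embedding_free_def by blast

text \<open>The quantity \<open>f(\<nu>)\<close> of a set \<open>\<nu>\<close> without isolated vertices, as a
  natural number.\<close>

definition f_nat :: "'a set \<Rightarrow> nat" where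
  "f_nat \<nu> = card (S \<inter> \<nu>) + (\<Sum>b\<in>T \<inter> \<nu>. card (Nb b)) - Max ((\<lambda>b. card (Nb b)) ` (T \<inter> \<nu>))"

definition e_nat :: "'a set \<Rightarrow> nat" where
  "e_nat \<nu> = card {e \<in> pattern_edges. e \<subseteq> \<nu>}"

lemma card_edges_between:
  assumes "U \<subseteq> T"
  shows "card (\<Union>b\<in>U. (\<lambda>a. {a, b}) ` (Nb b \<inter> \<nu>)) = (\<Sum>b\<in>U. card (Nb b \<inter> \<nu>))"
proof -
  have "card (\<Union>b\<in>U. (\<lambda>a. {a, b}) ` (Nb b \<inter> \<nu>)) = (\<Sum>b\<in>U. card ((\<lambda>a. {a, b}) ` (Nb b \<inter> \<nu>)))"
  proof (rule card_UN_disjoint)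
    show "finite U" using assms finT finite_subset by auto
    show "\<forall>b\<in>U. finite ((\<lambda>a. {a, b}) ` (Nb b \<inter> \<nu>))" using finNb assms by auto
    show "\<forall>b\<in>U. \<forall>b'\<in>U. b \<noteq> b' \<longrightarrow>
       (\<lambda>a. {a, b}) ` (Nb b \<inter> \<nu>) \<inter> (\<lambda>a. {a, b'}) ` (Nb b' \<inter> \<nu>) = {}"
    proof (intro ballI impI)
      fix b b' assume b: "b \<in> U" "b' \<in> U" "b \<noteq> b'"
      have "{a, b} \<noteq> {a', b'}" if "a \<in> Nb b" "a' \<in> Nb b'" for a a'
      proof -
        have "a \<in> S" "a' \<in> S" "b \<in> T" "b' \<in> T" using that b assms Nb by blast+
        then show ?thesis using disj b(3) by (auto simp: doubleton_eq_iff)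
      qed
      then show "(\<lambda>a. {a, b}) ` (Nb b \<inter> \<nu>) \<inter> (\<lambda>a. {a, b'}) ` (Nb b' \<inter> \<nu>) = {}" by blast
    qed
  qed
  also have "\<dots> = (\<Sum>b\<in>U. card (Nb b \<inter> \<nu>))"
  proof (intro sum.cong refl card_image inj_onI)
    fix b a a' assume "b \<in> U" "a \<in> Nb b \<inter> \<nu>" "a' \<in> Nb b \<inter> \<nu>" "{a, b} = {a', b}"
    then show "a = a'" by (auto simp: doubleton_eq_iff)
  qed
  finally show ?thesis .
qed

lemma card_pattern_edges: "card pattern_edges = (\<Sum>b\<in>T. card (Nb b))"
  using card_edges_between[of T UNIV] unfolding pattern_edges_def by simp

lemma e_nat_eq: "e_nat \<nu> = (\<Sum>b\<in>T \<inter> \<nu>. card (Nb b \<inter> \<nu>))"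
proof -
  have "{e \<in> pattern_edges. e \<subseteq> \<nu>} = (\<Union>b\<in>T \<inter> \<nu>. (\<lambda>a. {a, b}) ` (Nb b \<inter> \<nu>))"
    unfolding pattern_edges_def by auto
  then show ?thesis unfolding e_nat_def using card_edges_between[of "T \<inter> \<nu>" \<nu>] by simp
qed

lemma S_nonempty: "S \<noteq> {}" using Nb[OF vsT] Nbvs by simp

lemma card_S_pos: "card S > 0" using S_nonempty finS by (simp add: card_gt_0_iff)

lemma card_pattern_edges_pos: "card pattern_edges > 0"
proof -
  have "card (Nb vs) \<le> card pattern_edges"
    unfolding card_pattern_edges using finT vsT by (intro member_le_sum) auto
  then show ?thesis using card_S_pos Nbvs by simp
qed

lemma card_Nb_le: "b \<in> T \<Longrightarrow> card (Nb b) \<le> card (Nb vs)"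
  using Nb finS Nbvs by (simp add: card_mono)

lemma edge_union:
  assumes "\<sigma> \<subseteq> pattern_edges" "\<sigma> \<noteq> {}"
  shows "\<Union>\<sigma> \<subseteq> S \<union> T" "T \<inter> \<Union>\<sigma> \<noteq> {}" "S \<inter> \<Union>\<sigma> \<noteq> {}"
    "\<And>b. b \<in> T \<inter> \<Union>\<sigma> \<Longrightarrow> Nb b \<inter> \<Union>\<sigma> \<noteq> {}"
    "card \<sigma> \<le> e_nat (\<Union>\<sigma>)"
proof -
  show "\<Union>\<sigma> \<subseteq> S \<union> T" using assms pattern_edge_subset by blast
  obtain e where e: "e \<in> \<sigma>" using assms(2) by auto
  then obtain b a where ab: "b \<in> T" "a \<in> Nb b" "e = {a, b}"
    using assms(1) unfolding pattern_edges_def by blast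
  then show "T \<inter> \<Union>\<sigma> \<noteq> {}" using e by auto
  have "a \<in> S" using ab Nb by auto
  then show "S \<inter> \<Union>\<sigma> \<noteq> {}" using e ab by auto
  show "Nb b \<inter> \<Union>\<sigma> \<noteq> {}" if b: "b \<in> T \<inter> \<Union>\<sigma>" for b
  proof -
    obtain e where e: "e \<in> \<sigma>" "b \<in> e" using b by auto
    then obtain b' a' where ab: "b' \<in> T" "a' \<in> Nb b'" "e = {a', b'}"
      using assms(1) unfolding pattern_edges_def by blast
    then have "a' \<in> S" using Nb by auto
    then have "b = b'" "a' \<in> \<Union>\<sigma>" using e b disj ab by auto
    then show ?thesis using ab by auto
  qed
  show "card \<sigma> \<le> e_nat (\<Union>\<sigma>)"
    unfolding e_nat_def using finite_pattern_edges assms(1) by (intro card_mono) auto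
qed

text \<open>The two requirements are compatible because \<open>vs\<close>, being adjacent to all of
  \<open>S\<close>, has maximum degree in \<open>T\<close>.\<close>

lemma exists_apex:
  assumes "T \<inter> \<nu> \<noteq> {}"
  shows "\<exists>v\<in>T \<inter> \<nu>. (\<forall>b\<in>T \<inter> \<nu>. card (Nb b) \<le> card (Nb v)) \<and> (vs \<in> \<nu> \<longrightarrow> v = vs)"
proof (cases "vs \<in> \<nu>")
  case True
  then show ?thesis using vsT card_Nb_le by (intro bexI[of _ vs]) auto
next
  case False
  let ?A = "(\<lambda>b. card (Nb b)) ` (T \<inter> \<nu>)"
  have fin: "finite ?A" "?A \<noteq> {}" using finT assms by auto
  have "Max ?A \<in> ?A" by (rule Max_in[OF fin])
  then obtain v where v: "v \<in> T \<inter> \<nu>" "Max ?A = card (Nb v)" by auto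
  have "\<forall>b\<in>T \<inter> \<nu>. card (Nb b) \<le> card (Nb v)"
    using Max_ge[OF fin(1)] v(2) by (metis imageI)
  then show ?thesis using False v by blast
qed

lemma f_nat_apex:
  assumes v: "v \<in> T \<inter> \<nu>" "\<forall>b\<in>T \<inter> \<nu>. card (Nb b) \<le> card (Nb v)"
  shows "f_nat \<nu> = card (S \<inter> \<nu>) + (\<Sum>b\<in>T \<inter> \<nu> - {v}. card (Nb b))"
proof -
  have "Max ((\<lambda>b. card (Nb b)) ` (T \<inter> \<nu>)) = card (Nb v)"
    using v finT by (intro Max_eqI) auto
  then show ?thesis
    unfolding f_nat_def using sum.remove[of "T \<inter> \<nu>" v "\<lambda>b. card (Nb b)"] v(1) finT by simp
qed

lemma ext_exp_f_nat:
  assumes \<nu>: "\<nu> \<subseteq> S \<union> T" and v: "v \<in> T \<inter> \<nu>" "\<forall>b\<in>T \<inter> \<nu>. card (Nb b) \<le> card (Nb v)" "vs \<in> \<nu> \<longrightarrow> v = vs"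
  shows "ext_exp \<nu> v + f_nat \<nu> = card pattern_edges"
proof -
  let ?g = "\<lambda>b. card (Nb b)"
  have S: "card S = card (S - \<nu>) + card (S \<inter> \<nu>)"
    using finS by (metis Diff_Int2 Int_commute add.commute card_Diff_subset_Int card_mono finite_Int inf_le1 le_add_diff_inverse2)
  have T: "sum ?g T = sum ?g (T - \<nu>) + sum ?g (T \<inter> \<nu>)"
    using finT sum.Int_Diff[of T ?g \<nu>] by (simp add: add.commute)
  have v': "sum ?g (T \<inter> \<nu>) = card (Nb v) + sum ?g (T \<inter> \<nu> - {v})"
    using sum.remove[of "T \<inter> \<nu>" v ?g] v(1) finT by simp
  show ?thesis
  proof (cases "vs \<in> \<nu>")
    case True
    then have "v = vs" "T - \<nu> - {vs} = T - \<nu>" using v by auto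
    then show ?thesis
      unfolding f_nat_apex[OF v(1,2)] ext_exp_def card_pattern_edges using True S T v' Nbvs by simp
  next
    case False
    then have "sum ?g (T - \<nu>) = card (Nb vs) + sum ?g (T - \<nu> - {vs})"
      using sum.remove[of "T - \<nu>" vs ?g] vsT finT by simp
    then show ?thesis
      unfolding f_nat_apex[OF v(1,2)] ext_exp_def card_pattern_edges using False S T v' Nbvs by simp
  qed
qed

text \<open>The first two bounds make \<open>f(\<nu>) - 1\<close> lie between \<open>e(\<nu>) - 1\<close> and
  \<open>r (|\<nu>| - 2)\<close>, which is what the choice of \<open>\<tau>\<close> rests on. Both
  compare term by term after the apex is removed from the sum in \<open>f\<close>: the other vertices
  have degree at most \<open>r\<close>, and the apex has at most \<open>|S \<inter> \<nu>|\<close>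
  neighbours in \<open>\<nu>\<close>.\<close>

lemma f_nat_bounds:
  assumes "\<sigma> \<subseteq> pattern_edges" "\<sigma> \<noteq> {}"
  defines "\<nu> \<equiv> \<Union>\<sigma>"
  shows "e_nat \<nu> \<le> f_nat \<nu>" "f_nat \<nu> + 2 * r \<le> r * card \<nu> + 1" "card \<nu> \<ge> 2" "f_nat \<nu> \<ge> 1" "e_nat \<nu> \<ge> 1"
proof -
  note U = edge_union[OF assms(1,2), folded \<nu>_def]
  obtain v where v: "v \<in> T \<inter> \<nu>" "\<forall>b\<in>T \<inter> \<nu>. card (Nb b) \<le> card (Nb v)" "vs \<in> \<nu> \<longrightarrow> v = vs"
    using exists_apex[OF U(2)] by auto
  have fin: "finite \<nu>" "finite (T \<inter> \<nu>)" using U(1) finS finT finite_subset by auto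
  have cS: "card (S \<inter> \<nu>) \<ge> 1" using U(3) fin by (simp add: Suc_le_eq card_gt_0_iff)
  have cT: "card (T \<inter> \<nu>) \<ge> 1" using U(2) fin by (simp add: Suc_le_eq card_gt_0_iff)
  have c\<nu>: "card \<nu> = card (S \<inter> \<nu>) + card (T \<inter> \<nu>)"
  proof -
    have "\<nu> = (S \<inter> \<nu>) \<union> (T \<inter> \<nu>)" using U(1) by auto
    then have "card \<nu> = card ((S \<inter> \<nu>) \<union> (T \<inter> \<nu>))" by simp
    also have "\<dots> = card (S \<inter> \<nu>) + card (T \<inter> \<nu>)" using finS fin disj by (intro card_Un_disjoint) auto
    finally show ?thesis .
  qed
  have "e_nat \<nu> = card (Nb v \<inter> \<nu>) + (\<Sum>b\<in>T \<inter> \<nu> - {v}. card (Nb b \<inter> \<nu>))"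
    unfolding e_nat_eq using sum.remove[of "T \<inter> \<nu>" v "\<lambda>b. card (Nb b \<inter> \<nu>)"] v(1) fin by simp
  also have "\<dots> \<le> card (S \<inter> \<nu>) + (\<Sum>b\<in>T \<inter> \<nu> - {v}. card (Nb b))"
    using finS Nb v(1) finNb by (intro add_mono sum_mono card_mono) auto
  finally show "e_nat \<nu> \<le> f_nat \<nu>" unfolding f_nat_apex[OF v(1,2)] .
  have "(\<Sum>b\<in>T \<inter> \<nu> - {v}. card (Nb b)) \<le> (\<Sum>b\<in>T \<inter> \<nu> - {v}. r)"
    using v(3) by (intro sum_mono Nbr) auto
  also have "\<dots> = (card (T \<inter> \<nu>) - 1) * r" using v(1) by simp
  finally have "f_nat \<nu> \<le> card (S \<inter> \<nu>) + (card (T \<inter> \<nu>) - 1) * r" unfolding f_nat_apex[OF v(1,2)] by simp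
  moreover have "card (S \<inter> \<nu>) + r \<le> r * card (S \<inter> \<nu>) + 1"
  proof -
    obtain s where s: "card (S \<inter> \<nu>) = Suc s" using cS by (cases "card (S \<inter> \<nu>)") auto
    have "s \<le> r * s" using r1 by simp
    then show ?thesis unfolding s by simp
  qed
  moreover have "(card (T \<inter> \<nu>) - 1) * r + r = r * card (T \<inter> \<nu>)"
    using cT by (metis le_add_diff_inverse2 mult.commute mult_Suc_right plus_1_eq_Suc add.commute)
  moreover have "r * card \<nu> = r * card (S \<inter> \<nu>) + r * card (T \<inter> \<nu>)" by (simp add: c\<nu> distrib_left)
  ultimately show "f_nat \<nu> + 2 * r \<le> r * card \<nu> + 1" by linarith
  show "card \<nu> \<ge> 2" using c\<nu> cS cT by simp
  have "card \<sigma> \<ge> 1" using assms finite_pattern_edges by (metis One_nat_def Suc_leI card_gt_0_iff finite_subset)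
  then show "e_nat \<nu> \<ge> 1" using U(5) by simp
  then show "f_nat \<nu> \<ge> 1" using \<open>e_nat \<nu> \<le> f_nat \<nu>\<close> by simp
qed

definition count_const :: real where "count_const = (\<epsilon> / 2) ^ card T / 2 ^ (card S + 1)"
definition codegree_const :: real where "codegree_const = 2 ^ card pattern_edges * real (2 * card pattern_edges + 1) ^ card (S \<union> T)"
definition shrink_const :: real where
  "shrink_const = 2 * codegree_const / count_const * (2 ^ (card pattern_edges + 3)) ^ card pattern_edges"

lemma count_const: "count_const > 0" "count_const \<le> 1"
proof -
  show "count_const > 0" unfolding count_const_def using \<epsilon>_pos by simp
  have "(\<epsilon> / 2) ^ card T \<le> 1" using \<epsilon>_pos \<epsilon>_le by (intro power_le_one) auto
  moreover have "(2::real) ^ (card S + 1) \<ge> 1" by (rule one_le_power) simp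
  ultimately show "count_const \<le> 1" unfolding count_const_def by (subst pos_divide_le_eq) auto
qed

lemma codegree_const: "codegree_const \<ge> 1"
proof -
  have "1 * 1 \<le> codegree_const" unfolding codegree_const_def by (intro mult_mono one_le_power) auto
  then show ?thesis by simp
qed

lemma shrink_const: "shrink_const \<ge> 1"
proof -
  have "1 \<le> codegree_const / count_const" using count_const codegree_const by (simp add: pos_le_divide_eq)
  then have "1 \<le> 2 * codegree_const / count_const" by simp
  moreover have "(1::real) \<le> (2 ^ (card pattern_edges + 3)) ^ card pattern_edges"
    by (intro one_le_power) simp
  ultimately have "1 * 1 \<le> shrink_const" unfolding shrink_const_def by (intro mult_mono) auto
  then show ?thesis by simp
qed

end

context dense_host
begin

lemma emb_edges_not_free: "i \<in> embs \<Longrightarrow> \<not> embedding_free (emb_edges i)"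
  unfolding embedding_free_def emb_edges_def using emb_inj by blast

text \<open>The condition on \<open>\<tau>\<close> is the codegree condition after division by the number of
  copies per edge: by \<open>ext_exp_f_nat\<close> the exponents of \<open>n\<close> and
  \<open>q\<close> complement those in \<open>extension_bound\<close>. It involves
  \<open>e_nat\<close> and not the size of \<open>\<sigma>\<close> since \<open>\<tau> \<le> 1\<close>
  and \<open>\<sigma>\<close> has at most \<open>e_nat (\<Union>\<sigma>)\<close> members.\<close>

lemma container_step:
  fixes \<tau> x z M :: real
  assumes C2: "card C \<le> 2 * (D * card V)"
    and \<tau>: "0 < \<tau>" "\<tau> \<le> 1" "\<tau> * card C \<le> real b"
    and exts: "\<And>\<sigma>. \<sigma> \<subseteq> pattern_edges \<Longrightarrow> \<sigma> \<noteq> {} \<Longrightarrow>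
       1 \<le> \<tau> ^ (e_nat (\<Union>\<sigma>) - 1) * n ^ (card (\<Union>\<sigma>) - 2) * q ^ (f_nat (\<Union>\<sigma>) - 1)"
    and x: "x \<ge> 0" and z: "z \<ge> 1" and M: "M \<ge> 0"
      "\<And>C'. C' \<subseteq> C \<Longrightarrow> real (card C') \<le> card C - card C / (4 * shrink_const) \<Longrightarrow>
        indep_sum embedding_free x {} C' \<le> M"
  shows "indep_sum embedding_free x {} C \<le> z ^ (card pattern_edges * b) * (1 + x / z) ^ card C * M"
proof (rule container_bound[where V = C and J = embs and h = emb_edges and \<tau> = \<tau> and \<kappa> = "2 ^ (card pattern_edges + 3)"
      and K = "2 * codegree_const / count_const" and e = "count_const * n ^ card (S \<union> T) * q ^ card pattern_edges" and Kmax = shrink_const])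
  let ?ee = "card pattern_edges" and ?v = "card (S \<union> T)"
  have finU: "finite (S \<union> T)" using finS finT by auto
  have v2: "?v \<ge> 2"
    using card_Un_disjoint[OF finS finT disj] card_S_pos cardT by simp
  show finC: "finite C" by (rule finite_subset[of _ "Pow V"]) (use C finV in auto)
  have "D * card V > 0" using D1 n_pos by simp
  then have cC: "card C > 0" using D by linarith
  then show "C \<noteq> {}" by auto
  show "real (card embs) \<ge> count_const * n ^ ?v * q ^ ?ee" using card_embs_ge unfolding count_const_def card_pattern_edges .
  show "count_const * n ^ ?v * q ^ ?ee > 0" using count_const n_pos q_pos by simp
  show "2 * codegree_const / count_const > 0" using count_const codegree_const by simp
  show "2 * codegree_const / count_const * (2 ^ (?ee + 3)) ^ ?ee \<le> shrink_const" unfolding shrink_const_def by simp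
  show "emb_edges i \<subseteq> C \<and> card (emb_edges i) \<le> ?ee \<and> \<not> embedding_free (emb_edges i \<union> {})" if "i \<in> embs" for i
    using emb_edges_subset[OF that] card_emb_edges[OF that] emb_edges_not_free[OF that] by simp
  show "real (card {i \<in> embs. X \<subseteq> emb_edges i}) \<le> 2 * codegree_const / count_const * \<tau> ^ (card X - 1) * (count_const * n ^ ?v * q ^ ?ee) / card C"
    if X: "X \<noteq> {}" "X \<subseteq> C" for X
  proof -
    define R where "R = \<tau> ^ (card X - 1) * n ^ (?v - 2) * q ^ (?ee - 1)"
    have finX: "finite X" using X finC finite_subset by auto
    have "real (card {i \<in> embs. X \<subseteq> emb_edges i}) \<le> codegree_const * R" unfolding codegree_const_def
    proof (rule codegree_bound[OF X(1)])
      show "R \<ge> 0" unfolding R_def using \<tau> n_pos q_pos by simp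
      fix \<sigma> assume \<sigma>: "\<sigma> \<subseteq> pattern_edges" "card \<sigma> = card X"
      have \<sigma>0: "\<sigma> \<noteq> {}" using \<sigma>(2) X finX by auto
      define \<nu> where "\<nu> = \<Union>\<sigma>"
      note U = edge_union[OF \<sigma>(1) \<sigma>0, folded \<nu>_def] and B = f_nat_bounds[OF \<sigma>(1) \<sigma>0, folded \<nu>_def]
      obtain v where v: "v \<in> T \<inter> \<nu>" "\<forall>b\<in>T \<inter> \<nu>. card (Nb b) \<le> card (Nb v)" "vs \<in> \<nu> \<longrightarrow> v = vs"
        using exists_apex[OF U(2)] by auto
      note ef = ext_exp_f_nat[OF U(1) v]
      have c\<nu>: "card ((S \<union> T) - \<nu>) + card \<nu> = ?v"
        using U(1) finU by (metis card_Diff_subset card_mono finite_subset le_add_diff_inverse2)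
      have "n ^ card ((S \<union> T) - \<nu>) * q ^ ext_exp \<nu> v * 1 \<le> n ^ card ((S \<union> T) - \<nu>) * q ^ ext_exp \<nu> v *
         (\<tau> ^ (e_nat \<nu> - 1) * n ^ (card \<nu> - 2) * q ^ (f_nat \<nu> - 1))"
        using exts[OF \<sigma>(1) \<sigma>0, folded \<nu>_def] n_pos q_pos by (intro mult_left_mono) auto
      also have "\<dots> \<le> n ^ card ((S \<union> T) - \<nu>) * q ^ ext_exp \<nu> v *
         (\<tau> ^ (card X - 1) * n ^ (card \<nu> - 2) * q ^ (f_nat \<nu> - 1))"
        using \<tau> n_pos q_pos U(5) \<sigma>(2) by (intro mult_left_mono mult_right_mono power_decreasing) auto
      also have "\<dots> = \<tau> ^ (card X - 1) * n ^ (card ((S \<union> T) - \<nu>) + (card \<nu> - 2)) * q ^ (ext_exp \<nu> v + (f_nat \<nu> - 1))"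
        by (simp add: power_add)
      also have "card ((S \<union> T) - \<nu>) + (card \<nu> - 2) = ?v - 2" using c\<nu> B(3) by simp
      also have "ext_exp \<nu> v + (f_nat \<nu> - 1) = ?ee - 1" using ef B(4) by simp
      finally have "n ^ card ((S \<union> T) - \<nu>) * q ^ ext_exp \<nu> v \<le> R" unfolding R_def by simp
      then show "\<exists>v\<in>T \<inter> \<Union>\<sigma>. n ^ card (S \<union> T - \<Union>\<sigma>) * q ^ ext_exp (\<Union>\<sigma>) v \<le> R"
        using v(1) unfolding \<nu>_def by blast
    qed
    also have "codegree_const * R = codegree_const * \<tau> ^ (card X - 1) * (n ^ ?v * q ^ ?ee) / (n ^ 2 * q)"
    proof -
      have "n ^ ?v = n ^ (?v - 2) * n ^ 2" using power_add[of n "?v - 2" 2] v2 by (simp only: le_add_diff_inverse2)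
      moreover have "q ^ ?ee = q ^ (?ee - 1) * q"
        using card_pattern_edges_pos by (simp add: power_Suc2[symmetric])
      ultimately show ?thesis unfolding R_def using n_pos q_pos by simp
    qed
    also have "\<dots> \<le> codegree_const * \<tau> ^ (card X - 1) * (n ^ ?v * q ^ ?ee) / (card C / 2)"
    proof (rule divide_left_mono)
      have "real (card C) \<le> real (2 * (D * card V))" using C2 by (rule of_nat_mono)
      also have "\<dots> = 2 * (n ^ 2 * q)" using nq by (simp add: power2_eq_square mult_ac)
      finally show "card C / 2 \<le> n ^ 2 * q" by simp
      show "0 \<le> codegree_const * \<tau> ^ (card X - 1) * (n ^ ?v * q ^ ?ee)" using codegree_const \<tau> n_pos q_pos by simp
      show "0 < n ^ 2 * q * (card C / 2)" using n_pos q_pos cC by simp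
    qed
    also have "\<dots> = 2 * codegree_const / count_const * \<tau> ^ (card X - 1) * (count_const * n ^ ?v * q ^ ?ee) / card C"
      using count_const by (simp add: field_simps)
    finally show ?thesis .
  qed
  show "embedding_free A" if "embedding_free B" "A \<subseteq> B" for A B :: "'v set set"
    using that by (rule embedding_free_subset)
qed (use assms finite_embs in auto)

end

section \<open>Iterating the container step\<close>

lemma ln_ge_1:
  fixes n :: real
  assumes "n \<ge> 3"
  shows "ln n \<ge> 1"
proof -
  have "exp 1 \<le> n" using assms exp_le by linarith
  then show ?thesis using ln_ge_iff[of n 1] assms by linarith
qed

lemma mult_powr_minus:
  fixes p a :: real
  assumes "p > 0"
  shows "p * p powr (- a) = p powr (1 - a)"
  using powr_add[of p 1 "- a"] assms by simp

text \<open>The inequality \<open>\<tau>^{e(\<nu>)-1} n^{|\<nu>|-2} q^{f(\<nu>)-1} \<ge> 1\<close> on the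
  logarithmic scale, with \<open>A = ln n\<close>, \<open>B = ln q\<close>, \<open>P = ln p\<close>,
  \<open>\<Lambda> = ln (ln n)\<close>, \<open>lt = ln \<tau>\<close>, and \<open>e\<close>,
  \<open>a1\<close>, \<open>b1\<close> for the three exponents. In terms of
  \<open>A + \<rho> B = \<rho> ln k\<close> everything is linear. Outside \<open>A_F\<close> the lower
  bound \<open>k^{-r}\<close> for \<open>\<tau>\<close> is used, inside \<open>A_F\<close> the lower
  bound \<open>w / k\<close>; there \<open>d\<close> is the denominator of \<open>a(\<nu>)\<close> and
  \<open>\<rho> a1 - b1\<close> its numerator.\<close>

lemma log_tau_bound:
  fixes A B P \<Lambda> lt a \<rho> e a1 b1 c :: real
  assumes \<rho>: "\<rho> \<ge> 1" and pos: "A \<ge> 0" "\<Lambda> \<ge> 0" "A + \<rho> * B \<ge> 0" "A + \<rho> * B \<ge> - P"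
    and lt: "lt \<ge> - (A + \<rho> * B)" "lt \<ge> (1 - 1 / \<rho>) * P - 3 * \<Lambda> - B - A / \<rho>"
    and e: "e \<ge> 0" "e \<le> b1" "b1 \<le> \<rho> * a1"
    and P: "P \<ge> - a * A + c * \<Lambda>"
    and adm: "b1 < \<rho> * e \<Longrightarrow> \<rho> * e - b1 \<ge> 1 \<and> a * (\<rho> * e - b1) \<le> \<rho> * a1 - b1 \<and> 3 * \<rho> * e \<le> c"
  shows "e * lt + a1 * A + b1 * B \<ge> 0"
proof (cases "b1 < \<rho> * e")
  case False
  have "e * lt \<ge> e * (- (A + \<rho> * B))" using lt(1) e(1) by (rule mult_left_mono)
  moreover have "(b1 - \<rho> * e) * (A + \<rho> * B) \<ge> 0" using False pos by simp
  moreover have "(\<rho> * a1 - b1) * A \<ge> 0" using e pos by simp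
  moreover have "\<rho> * (e * (- (A + \<rho> * B)) + a1 * A + b1 * B) = (b1 - \<rho> * e) * (A + \<rho> * B) + (\<rho> * a1 - b1) * A"
    by (simp add: algebra_simps)
  ultimately have "\<rho> * (e * (- (A + \<rho> * B)) + a1 * A + b1 * B) \<ge> 0" "e * lt \<ge> e * (- (A + \<rho> * B))" by linarith+
  moreover from this(1) have "e * (- (A + \<rho> * B)) + a1 * A + b1 * B \<ge> 0"
    using \<rho> by (simp add: zero_le_mult_iff)
  ultimately show ?thesis by linarith
next
  case True
  define d where "d = \<rho> * e - b1"
  have d: "d \<ge> 1" "a * d \<le> \<rho> * a1 - b1" "3 * \<rho> * e \<le> c" using adm[OF True] unfolding d_def by auto
  have 1: "e * lt \<ge> e * ((1 - 1 / \<rho>) * P - 3 * \<Lambda> - B - A / \<rho>)" using lt(2) e(1) by (rule mult_left_mono)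
  have eq: "\<rho> * (e * ((1 - 1 / \<rho>) * P - 3 * \<Lambda> - B - A / \<rho>) + a1 * A + b1 * B)
     = (b1 - e) * (A + \<rho> * B) + e * (\<rho> - 1) * P + (\<rho> * a1 - b1) * A - 3 * \<rho> * e * \<Lambda>"
    using \<rho> by (simp add: field_simps)
  have "(b1 - e) * (A + \<rho> * B) \<ge> (b1 - e) * (- P)" using pos e by (intro mult_left_mono) auto
  moreover have "(\<rho> * a1 - b1) * A \<ge> a * d * A" using d pos by (intro mult_right_mono) auto
  moreover have "d * P \<ge> d * (- a * A + c * \<Lambda>)" using P d by (intro mult_left_mono) auto
  moreover have "d * (c * \<Lambda>) \<ge> 1 * (3 * \<rho> * e * \<Lambda>)"
    using d pos \<rho> e by (intro mult_mono mult_right_mono) auto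
  moreover have "(b1 - e) * (- P) + e * (\<rho> - 1) * P = d * P" unfolding d_def by (simp add: algebra_simps)
  moreover have "d * (- a * A + c * \<Lambda>) = - (a * d * A) + d * (c * \<Lambda>)" by (simp add: algebra_simps)
  ultimately have "\<rho> * (e * ((1 - 1 / \<rho>) * P - 3 * \<Lambda> - B - A / \<rho>) + a1 * A + b1 * B) \<ge> 0"
    unfolding eq by linarith
  then have "e * ((1 - 1 / \<rho>) * P - 3 * \<Lambda> - B - A / \<rho>) + a1 * A + b1 * B \<ge> 0"
    using \<rho> by (simp add: zero_le_mult_iff)
  then show ?thesis using 1 by linarith
qed

lemma card_pairs_le:
  assumes "finite V" "\<And>e. e \<in> C \<Longrightarrow> e \<subseteq> V \<and> card e = 2"
  shows "real (card C) \<le> real (card V) ^ 2"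
proof -
  have "C \<subseteq> (\<lambda>(x, y). {x, y}) ` (V \<times> V)"
  proof
    fix e assume e: "e \<in> C"
    then obtain x y where "e = {x, y}" using assms(2) by (meson card_2_iff)
    then show "e \<in> (\<lambda>(x, y). {x, y}) ` (V \<times> V)" using assms(2)[OF e] by auto
  qed
  then have "card C \<le> card ((\<lambda>(x, y). {x, y}) ` (V \<times> V))" using assms(1) by (intro card_mono) auto
  also have "\<dots> \<le> card (V \<times> V)" using assms(1) by (intro card_image_le) auto
  finally have "card C \<le> card V ^ 2" by (simp add: card_cartesian_product power2_eq_square)
  from of_nat_mono[OF this, where 'a = real] show ?thesis by simp
qed

context semi_bounded_pattern
begin

text \<open>The recursion stops at \<open>start_const * p powr (-1/r) * n powr (2-1/r)\<close> edges; above that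
  size, the blocks of \<open>dense_host\<close> are large enough for the greedy choices.\<close>

definition start_const :: real where "start_const = 4 * (card S + card T + 1) / \<epsilon>"

text \<open>Each of the \<open>e(\<nu>) - 1\<close> factors \<open>w\<close> in the codegree condition costs
  \<open>ln^3 n\<close>, raised to the power \<open>r\<close> when the condition is solved for
  \<open>p\<close>.\<close>

definition log_exponent :: real where "log_exponent = 3 * r * card pattern_edges"

text \<open>Exponents \<open>a\<close> with \<open>a \<le> a(\<nu>)\<close> for all
  \<open>\<nu> \<in> A_F\<close>, with the positive denominator of \<open>a(\<nu>)\<close> multiplied
  out.\<close>

definition admissible :: "real \<Rightarrow> bool" where
  "admissible a \<longleftrightarrow> (\<forall>\<sigma>. \<sigma> \<subseteq> pattern_edges \<and> \<sigma> \<noteq> {} \<and>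
     real (f_nat (\<Union>\<sigma>)) - 1 < real r * (real (e_nat (\<Union>\<sigma>)) - 1) \<longrightarrow>
     a * (real r * (real (e_nat (\<Union>\<sigma>)) - 1) + 1 - real (f_nat (\<Union>\<sigma>)))
       \<le> real r * (real (card (\<Union>\<sigma>)) - 2) + 1 - real (f_nat (\<Union>\<sigma>)))"

definition \<beta> :: real where "\<beta> = 2 * card pattern_edges * r * start_const + 2 * start_const"
definition \<gamma> :: real where "\<gamma> = 6 * card pattern_edges * r"

lemma start_const: "start_const \<ge> 4"
proof -
  have "4 * 1 / 1 \<le> start_const" unfolding start_const_def using \<epsilon>_pos \<epsilon>_le by (intro frac_le mult_left_mono) auto
  then show ?thesis by simp
qed

text \<open>With \<open>|C| = u N1\<close> the choice \<open>z = u^r\<close> balances the two factors: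
  \<open>x |C| / z\<close> is of order \<open>m u^{1-r}\<close>, and \<open>z^t\<close> has exponent
  \<open>t r ln u\<close>, where the part of \<open>t\<close> that stems from \<open>k^{-r}\<close> is
  also of order \<open>m u^{1-r}\<close>. As \<open>r \<ge> 2\<close>, both are
  \<open>O(m u^{-1/2})\<close>. The part of \<open>t\<close> that stems from \<open>w / k\<close> is
  of order \<open>m / ln^3 n\<close> and loses one logarithm through \<open>ln u \<le> 2 ln n\<close>.\<close>

lemma container_step_numeric:
  fixes V :: "'v set" and C :: "'v set set" and p a M n m N1 :: real
  defines "n \<equiv> real (card V)"
  defines "m \<equiv> p powr (1 - 1 / r) * n powr (2 - 1 / r)"
  defines "N1 \<equiv> start_const * p powr (- 1 / r) * n powr (2 - 1 / r)"
  assumes r2: "r \<ge> 2" and V: "finite V" "n \<ge> 3" and C: "\<And>e. e \<in> C \<Longrightarrow> e \<subseteq> V \<and> card e = 2"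
    and p: "n powr (- a) * ln n powr log_exponent \<le> p" "p \<le> 1"
    and adm: "admissible a" and m: "m \<ge> ln n ^ 3" and N1: "N1 \<le> card C"
    and M: "M \<ge> 0" "\<And>C'. C' \<subseteq> C \<Longrightarrow> real (card C') \<le> card C - card C / (4 * shrink_const) \<Longrightarrow>
        indep_sum embedding_free (2 * p) {} C' \<le> M"
  shows "indep_sum embedding_free (2 * p) {} C \<le> exp (m * (\<beta> * sqrt (N1 / card C) + \<gamma> / ln n ^ 2)) * M"
proof -
  define N where "N = real (card C)"
  define R where "R = real r"
  have R: "R \<ge> 2" unfolding R_def using r2 by simp
  have n: "n > 0" "n \<ge> 1" using V by auto
  have ln1: "ln n \<ge> 1" by (rule ln_ge_1[OF V(2)])
  have "n \<noteq> 0" "ln n \<noteq> 0" using n ln1 by auto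
  then have lower: "n powr (- a) * ln n powr log_exponent > 0"
    by (intro mult_pos_pos) (simp_all only: powr_gt_zero simp_thms)
  then have p0: "p > 0" using p by linarith
  have nE: "n powr (2 - 1 / R) \<ge> n"
  proof -
    have "1 / R \<le> 1" using R by simp
    then have "n powr 1 \<le> n powr (2 - 1 / R)" using n by (intro powr_mono) auto
    then show ?thesis using n by simp
  qed
  have pR: "p powr (- 1 / R) \<ge> 1"
  proof -
    have "p powr 0 \<le> p powr (- 1 / R)" using p0 p(2) R by (intro powr_mono') auto
    then show ?thesis using p0 by simp
  qed
  have N1n: "N1 \<ge> n"
  proof -
    have "1 * 1 * n \<le> N1" unfolding N1_def R_def[symmetric] using start_const pR nE n by (intro mult_mono) auto
    then show ?thesis by simp
  qed
  have N1p: "N1 > 0" using N1n n by simp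
  have NN: "N \<ge> N1" unfolding N_def by (rule N1)
  have Np: "N > 0" using NN N1p by linarith
  define u where "u = N / N1"
  have u1: "u \<ge> 1" unfolding u_def using NN N1p by simp
  have uN: "N = u * N1" unfolding u_def using N1p by simp
  have pN1: "p * N1 = start_const * m"
    unfolding N1_def m_def using mult_powr_minus[OF p0, of "1 / r"] by (simp add: mult_ac)
  have finC: "finite C" by (rule finite_subset[of _ "Pow V"]) (use C V in auto)
  have N2: "N \<le> n ^ 2"
    unfolding N_def n_def by (rule card_pairs_le[OF V(1) C])
  define D where "D = card C div card V"
  define q where "q = D / card V"
  have V0: "V \<noteq> {}" using V n_def by auto
  have cV: "card V > 0" using n n_def by simp
  have Dn: "D * card V \<le> card C" unfolding D_def by simp
  have "n \<le> N" using NN N1n by linarith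
  then have cc: "card V \<le> card C" unfolding n_def N_def by simp
  then have D1: "D > 0" unfolding D_def using cV by (simp add: div_greater_zero_iff)
  have C2: "card C \<le> 2 * (D * card V)"
  proof -
    have "card C = D * card V + card C mod card V" unfolding D_def by simp
    moreover have "card C mod card V < card V" using cV by simp
    moreover have "card V \<le> D * card V" using D1 by simp
    ultimately show ?thesis by linarith
  qed
  have q0: "q > 0" unfolding q_def using D1 cV by simp
  have qn: "n * q = D" unfolding q_def n_def using cV by simp
  have q_le: "q \<le> 1"
  proof -
    have "real (D * card V) \<le> N" unfolding N_def using Dn by (rule of_nat_mono)
    then have "n * q * n \<le> n * n" using N2 qn unfolding n_def by (simp add: power2_eq_square)
    then show ?thesis using n by simp
  qed
  have q_ge: "q \<ge> N / (2 * n ^ 2)"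
  proof -
    have "N \<le> real (2 * (D * card V))" unfolding N_def using C2 by (rule of_nat_mono)
    also have "\<dots> = 2 * n ^ 2 * q" using qn n_def by (simp add: power2_eq_square)
    finally show ?thesis using n by (simp add: field_simps)
  qed
  (* n q^r is the typical number of common neighbours of r vertices. *)
  have nqr: "n * q ^ r \<ge> (start_const / 2) ^ r * (u ^ r / p)"
  proof -
    have N1r: "N1 ^ r = start_const ^ r * (1 / p) * (n ^ (2 * r) / n)"
    proof -
      have "(p powr (- 1 / R)) ^ r = 1 / p"
      proof -
        have "(p powr (- 1 / R)) ^ r = p powr (- 1 / R * real r)"
          using p0 by (simp add: powr_powr flip: powr_realpow)
        also have "- 1 / R * real r = - 1" using R unfolding R_def by simp
        finally show ?thesis using p0 by (simp add: powr_minus_divide)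
      qed
      moreover have "(n powr (2 - 1 / R)) ^ r = n ^ (2 * r) / n"
      proof -
        have "(n powr (2 - 1 / R)) ^ r = n powr ((2 - 1 / R) * real r)"
          using n by (simp add: powr_powr flip: powr_realpow)
        also have "(2 - 1 / R) * real r = real (2 * r) - 1" using R unfolding R_def by (simp add: field_simps)
        also have "n powr (real (2 * r) - 1) = n ^ (2 * r) / n"
          unfolding powr_diff using n by (simp only: powr_realpow powr_one less_imp_le)
        finally show ?thesis .
      qed
      ultimately show ?thesis unfolding N1_def R_def[symmetric] by (simp add: power_mult_distrib)
    qed
    have "(N / (2 * n ^ 2)) ^ r \<le> q ^ r" using q_ge Np n by (intro power_mono) auto
    then have "n * (N / (2 * n ^ 2)) ^ r \<le> n * q ^ r" using n by (intro mult_left_mono) auto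
    moreover have "n * (N / (2 * n ^ 2)) ^ r = (start_const / 2) ^ r * (u ^ r / p)"
    proof -
      have "n * (N / (2 * n ^ 2)) ^ r = n * (u ^ r * N1 ^ r / (2 ^ r * n ^ (2 * r)))"
        unfolding uN by (simp add: power_divide power_mult_distrib power_mult)
      also have "\<dots> = (start_const / 2) ^ r * (u ^ r / p)"
        unfolding N1r using n p0 by (simp add: power_divide mult_ac)
      finally show ?thesis .
    qed
    ultimately show ?thesis by linarith
  qed
  have K0r: "(start_const / 2) ^ r \<ge> start_const / 2"
    using power_increasing[of 1 r "start_const / 2"] r1 start_const by simp
  have ur1: "u ^ r \<ge> 1" using u1 by (rule one_le_power)
  have nqr2: "n * q ^ r \<ge> u ^ r / p"
  proof -
    have "1 * (u ^ r / p) \<le> (start_const / 2) ^ r * (u ^ r / p)"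
      using K0r start_const ur1 p0 by (intro mult_right_mono) auto
    then show ?thesis using nqr by linarith
  qed
  have nqr3: "n * q ^ r \<ge> 1 / p" using nqr2 ur1 p0 by (smt (verit) divide_right_mono)
  have p1: "1 / p \<ge> 1" using p0 p(2) by simp
  have nqr4: "n * q ^ r \<ge> start_const / 2"
  proof -
    have "1 \<le> u ^ r / p" using ur1 p0 p(2) by (simp add: pos_le_divide_eq)
    then have "(start_const / 2) * 1 \<le> (start_const / 2) ^ r * (u ^ r / p)" using K0r start_const by (intro mult_mono) auto
    then show ?thesis using nqr by linarith
  qed
  have dense: "\<epsilon> * n * q ^ r \<ge> 2 * (card S + card T + 1)"
  proof -
    have "\<epsilon> * (start_const / 2) \<le> \<epsilon> * (n * q ^ r)" using nqr4 \<epsilon>_pos by (intro mult_left_mono) auto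
    moreover have "\<epsilon> * (start_const / 2) = 2 * (card S + card T + 1)" unfolding start_const_def using \<epsilon>_pos by (simp add: field_simps)
    ultimately show ?thesis by (simp add: mult_ac)
  qed
  interpret H: dense_host S T vs Nb r V C D q
  proof (unfold_locales)
    show "finite V" "V \<noteq> {}" "D * card V \<le> card C" "0 < D" "q = real D / real (card V)" "q \<le> 1"
      using V V0 Dn D1 q_def q_le by auto
    show "real (2 * (card S + card T + 1)) \<le> \<epsilon> * real (card V) * q ^ r" using dense unfolding n_def by simp
    show "e \<subseteq> V \<and> card e = 2" if "e \<in> C" for e using C[OF that] .
  qed
  define w where "w = p powr (1 - 1 / R) / ln n ^ 3"
  define k where "k = q * n powr (1 / R)"
  (* As k^r = n q^r, the first term is k^{-r}. *)
  define \<tau> where "\<tau> = max (1 / (n * q ^ r)) (w / k)"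
  define A where "A = ln n"
  define B where "B = ln q"
  define P where "P = ln p"
  define \<Lambda> where "\<Lambda> = ln (ln n)"
  have k0: "k > 0" unfolding k_def using q0 n by simp
  have w0: "w > 0" unfolding w_def using p0 ln1 by simp
  have lnk: "ln k = B + A / R" unfolding k_def A_def B_def using q0 n by (simp add: ln_mult ln_powr)
  have lnw: "ln w = (1 - 1 / R) * P - 3 * \<Lambda>"
    unfolding w_def P_def \<Lambda>_def using p0 ln1 by (simp add: ln_div ln_powr ln_realpow)
  have lnnq: "ln (n * q ^ r) = A + R * B" unfolding A_def B_def R_def using n q0 by (simp add: ln_mult ln_realpow)
  have AB: "A + R * B \<ge> - P"
  proof -
    have "ln (1 / p) \<le> ln (n * q ^ r)" using nqr3 p0 n q0 by (subst ln_le_cancel_iff) auto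
    then show ?thesis unfolding lnnq P_def using p0 by (simp add: ln_div)
  qed
  have P0: "P \<le> 0" unfolding P_def using p0 p(2) by (simp add: ln_le_zero_iff)
  have AB0: "A + R * B \<ge> 0" using AB P0 by linarith
  have lnkR: "R * ln k = A + R * B" unfolding lnk using R by (simp add: field_simps)
  have "R * ln k \<ge> 0" using lnkR AB0 by simp
  then have lnk0: "ln k \<ge> 0" using R by (simp add: zero_le_mult_iff)
  then have k1: "k \<ge> 1" using k0 by simp
  have w1: "w \<le> 1"
  proof -
    have "p powr (1 - 1 / R) \<le> 1" using p0 p(2) R by (intro powr_le1) auto
    moreover have "1 \<le> ln n ^ 3" using ln1 by (rule one_le_power)
    ultimately show ?thesis unfolding w_def by (subst pos_divide_le_eq) linarith+
  qed
  have nqr1: "n * q ^ r \<ge> 1" using nqr3 p1 by linarith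
  have \<tau>: "\<tau> > 0" "\<tau> \<le> 1"
  proof -
    have "w / k > 0" using w0 k0 by simp
    then show "\<tau> > 0" unfolding \<tau>_def by simp
    have "w / k \<le> 1" using w1 k1 k0 by (subst pos_divide_le_eq) auto
    moreover have "1 / (n * q ^ r) \<le> 1" using nqr1 by (subst pos_divide_le_eq) auto
    ultimately show "\<tau> \<le> 1" unfolding \<tau>_def by simp
  qed
  have lt: "ln \<tau> \<ge> - (A + R * B)" "ln \<tau> \<ge> (1 - 1 / R) * P - 3 * \<Lambda> - B - A / R"
  proof -
    have "ln (1 / (n * q ^ r)) \<le> ln \<tau>" using \<tau> nqr1 by (subst ln_le_cancel_iff) (auto simp: \<tau>_def)
    moreover have "ln (1 / (n * q ^ r)) = - (A + R * B)"
    proof -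
      have "ln (1 / y) = - ln y" if "y > 0" for y :: real using that by (simp add: ln_div)
      from this[of "n * q ^ r"] show ?thesis using nqr1 unfolding lnnq by linarith
    qed
    ultimately show "ln \<tau> \<ge> - (A + R * B)" by simp
    have "ln (w / k) \<le> ln \<tau>" using \<tau> w0 k0 by (subst ln_le_cancel_iff) (auto simp: \<tau>_def)
    moreover have "ln (w / k) = ln w - ln k" using w0 k0 by (simp add: ln_div)
    ultimately show "ln \<tau> \<ge> (1 - 1 / R) * P - 3 * \<Lambda> - B - A / R" unfolding lnw lnk by simp
  qed
  have Pge: "P \<ge> - a * A + log_exponent * \<Lambda>"
  proof -
    have "ln (n powr (- a) * ln n powr log_exponent) \<le> ln p"
      using p(1) p0 lower by (subst ln_le_cancel_iff) auto
    moreover have "ln (n powr (- a) * ln n powr log_exponent) = - a * A + log_exponent * \<Lambda>"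
      unfolding A_def \<Lambda>_def using n ln1 by (simp add: ln_mult ln_powr)
    ultimately show ?thesis unfolding P_def by simp
  qed
  have A0: "A \<ge> 0" "\<Lambda> \<ge> 0" unfolding A_def \<Lambda>_def using ln1 n by auto
  have exts: "1 \<le> \<tau> ^ (e_nat (\<Union>\<sigma>) - 1) * n ^ (card (\<Union>\<sigma>) - 2) * q ^ (f_nat (\<Union>\<sigma>) - 1)"
    if \<sigma>: "\<sigma> \<subseteq> pattern_edges" "\<sigma> \<noteq> {}" for \<sigma>
  proof -
    define \<nu> where "\<nu> = \<Union>\<sigma>"
    note F = f_nat_bounds[OF \<sigma>, folded \<nu>_def]
    have e': "real (e_nat \<nu> - 1) = real (e_nat \<nu>) - 1" "real (f_nat \<nu> - 1) = real (f_nat \<nu>) - 1"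
      "real (card \<nu> - 2) = real (card \<nu>) - 2" using F by (simp_all add: of_nat_diff)
    have "real (e_nat \<nu> - 1) * ln \<tau> + real (card \<nu> - 2) * A + real (f_nat \<nu> - 1) * B \<ge> 0"
    proof (rule log_tau_bound[where \<rho> = R and P = P and \<Lambda> = \<Lambda> and a = a and c = log_exponent])
      show "real (e_nat \<nu> - 1) \<le> real (f_nat \<nu> - 1)" using F(1) by simp
      have "real (f_nat \<nu> + 2 * r) \<le> real (r * card \<nu> + 1)" using F(2) by (rule of_nat_mono)
      then show "real (f_nat \<nu> - 1) \<le> R * real (card \<nu> - 2)" unfolding e' R_def by (simp add: algebra_simps)
      assume less: "real (f_nat \<nu> - 1) < R * real (e_nat \<nu> - 1)"
      have "f_nat \<nu> - 1 < r * (e_nat \<nu> - 1)"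
        using less unfolding R_def by (metis of_nat_less_iff of_nat_mult)
      then have "real (f_nat \<nu> - 1 + 1) \<le> real (r * (e_nat \<nu> - 1))" by (intro of_nat_mono) simp
      then have "real (f_nat \<nu> - 1) + 1 \<le> R * real (e_nat \<nu> - 1)"
        unfolding R_def by (simp only: of_nat_add of_nat_mult of_nat_1)
      then have "1 \<le> R * real (e_nat \<nu> - 1) - real (f_nat \<nu> - 1)" by linarith
      moreover have "a * (R * real (e_nat \<nu> - 1) - real (f_nat \<nu> - 1)) \<le> R * real (card \<nu> - 2) - real (f_nat \<nu> - 1)"
      proof -
        have "real (f_nat \<nu>) - 1 < R * (real (e_nat \<nu>) - 1)" using less unfolding e' .
        then have "a * (R * (real (e_nat \<nu>) - 1) + 1 - real (f_nat \<nu>)) \<le> R * (real (card \<nu>) - 2) + 1 - real (f_nat \<nu>)"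
          using adm \<sigma> unfolding admissible_def \<nu>_def R_def by blast
        then show ?thesis unfolding e' by (simp add: algebra_simps)
      qed
      moreover have "3 * R * real (e_nat \<nu> - 1) \<le> log_exponent"
      proof -
        have "e_nat \<nu> \<le> card pattern_edges"
          unfolding e_nat_def using finite_pattern_edges by (intro card_mono) auto
        then have "real (e_nat \<nu> - 1) \<le> real (card pattern_edges)" by simp
        then have "3 * R * real (e_nat \<nu> - 1) \<le> 3 * R * card pattern_edges" using R by (intro mult_left_mono) auto
        then show ?thesis unfolding log_exponent_def R_def by simp
      qed
      ultimately show "1 \<le> R * real (e_nat \<nu> - 1) - real (f_nat \<nu> - 1) \<and>
        a * (R * real (e_nat \<nu> - 1) - real (f_nat \<nu> - 1)) \<le> R * real (card \<nu> - 2) - real (f_nat \<nu> - 1) \<and>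
        3 * R * real (e_nat \<nu> - 1) \<le> log_exponent" by blast
    qed (use R A0 AB AB0 lt Pge in auto)
    also have "real (e_nat \<nu> - 1) * ln \<tau> + real (card \<nu> - 2) * A + real (f_nat \<nu> - 1) * B =
        ln (\<tau> ^ (e_nat \<nu> - 1) * n ^ (card \<nu> - 2) * q ^ (f_nat \<nu> - 1))"
      unfolding A_def B_def using \<tau> n q0 by (simp add: ln_mult ln_realpow)
    finally have "0 \<le> ln (\<tau> ^ (e_nat \<nu> - 1) * n ^ (card \<nu> - 2) * q ^ (f_nat \<nu> - 1))" .
    moreover have "\<tau> ^ (e_nat \<nu> - 1) * n ^ (card \<nu> - 2) * q ^ (f_nat \<nu> - 1) > 0" using \<tau> n q0 by simp
    ultimately show ?thesis unfolding \<nu>_def by simp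
  qed
  define b where "b = nat \<lceil>\<tau> * N\<rceil>"
  have b: "\<tau> * N \<le> b" "b \<le> \<tau> * N + 1"
    unfolding b_def using \<tau> Np by (auto simp: of_nat_nat le_of_int_ceiling intro: less_imp_le)
  define z where "z = u ^ r"
  have z1: "z \<ge> 1" unfolding z_def by (rule ur1)
  let ?ee = "card pattern_edges"
  have main: "indep_sum embedding_free (2 * p) {} C \<le> z ^ (?ee * b) * (1 + 2 * p / z) ^ card C * M"
    by (rule H.container_step[OF C2 \<tau>]) (use b exts p0 z1 M in \<open>auto simp: N_def n_def\<close>)
  have u_r: "u / u ^ r \<le> 1 / u"
  proof -
    have "u ^ 2 \<le> u ^ r" using u1 r2 by (intro power_increasing) auto
    then have "u * u \<le> 1 * u ^ r" by (simp add: power2_eq_square)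
    then show ?thesis using u1 ur1 by (simp add: field_simps)
  qed
  have m0: "m \<ge> 0" unfolding m_def by simp
  have su: "sqrt u \<ge> 1" "sqrt u * sqrt u = u" using u1 by auto
  have u_half: "1 / u \<le> 1 / sqrt u"
  proof -
    have "sqrt u * 1 \<le> sqrt u * sqrt u" using su by (intro mult_left_mono) auto
    then have "sqrt u \<le> u" using su(2) by simp
    then show ?thesis using su(1) by (intro divide_left_mono) auto
  qed
  have lnu: "ln u \<ge> 0" using u1 by simp
  have lnu2: "ln u / u \<le> 2 / sqrt u"
  proof -
    have "ln u = 2 * ln (sqrt u)" using u1 by (simp add: ln_sqrt)
    also have "\<dots> \<le> 2 * sqrt u"
    proof -
      have "sqrt u > 0" using su(1) by linarith
      from ln_less_self[OF this] show ?thesis by linarith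
    qed
    finally have "ln u / u \<le> 2 * sqrt u / u" using u1 by (intro divide_right_mono) auto
    also have "\<dots> = 2 / sqrt u" using su u1 by (simp add: field_simps)
    finally show ?thesis .
  qed
  have lnu3: "ln u \<le> 2 * ln n"
  proof -
    have "u \<le> N / 1" unfolding u_def using N1n n Np by (intro divide_left_mono) auto
    then have "u \<le> n ^ 2" using N2 by simp
    then have "ln u \<le> ln (n ^ 2)" using u1 n by (subst ln_le_cancel_iff) auto
    then show ?thesis using n by (simp add: ln_realpow)
  qed
  have xz: "N * (2 * p / z) \<le> m * (2 * start_const / sqrt u)"
  proof -
    have "N * (2 * p / z) = 2 * (p * N1) * (u / u ^ r)" unfolding uN z_def by simp
    also have "\<dots> = 2 * start_const * m * (u / u ^ r)" unfolding pN1 by simp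
    also have "\<dots> \<le> 2 * start_const * m * (1 / sqrt u)" using u_r u_half start_const m0 by (intro mult_left_mono) auto
    finally show ?thesis by (simp add: mult_ac)
  qed
  have \<tau>N: "\<tau> * N \<le> start_const * m * (u / u ^ r) + 2 * m / ln n ^ 3"
  proof -
    have "1 / (n * q ^ r) * N \<le> p / u ^ r * N"
    proof (rule mult_right_mono)
      have "1 / (n * q ^ r) \<le> 1 / (u ^ r / p)" using nqr2 ur1 p0 nqr1 by (intro divide_left_mono) auto
      then show "1 / (n * q ^ r) \<le> p / u ^ r" by simp
    qed (use Np in simp)
    also have "\<dots> = (p * N1) * (u / u ^ r)" unfolding uN by simp
    also have "\<dots> = start_const * m * (u / u ^ r)" unfolding pN1 ..
    finally have 1: "1 / (n * q ^ r) * N \<le> start_const * m * (u / u ^ r)" .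
    have "w / k * N \<le> w / k * (2 * n ^ 2 * q)"
      using q_ge n w0 k0 by (intro mult_left_mono) (auto simp: field_simps)
    also have "\<dots> = 2 * w * (n ^ 2 / n powr (1 / R))" unfolding k_def using q0 by simp
    also have "n ^ 2 / n powr (1 / R) = n powr (2 - 1 / R)"
      unfolding powr_diff using n by simp
    also have "2 * w * n powr (2 - 1 / R) = 2 * m / ln n ^ 3" unfolding w_def m_def R_def by simp
    finally have 2: "w / k * N \<le> 2 * m / ln n ^ 3" .
    have nn: "start_const * m * (u / u ^ r) \<ge> 0" "2 * m / ln n ^ 3 \<ge> 0" using start_const m0 u1 ln1 by auto
    show ?thesis
    proof (cases "1 / (n * q ^ r) \<le> w / k")
      case True then have \<tau>_eq: "\<tau> = w / k" unfolding \<tau>_def by simp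
      show ?thesis unfolding \<tau>_eq using 2 nn by linarith
    next
      case False then have \<tau>_eq: "\<tau> = 1 / (n * q ^ r)" unfolding \<tau>_def by simp
      show ?thesis unfolding \<tau>_eq using 1 nn by linarith
    qed
  qed
  have bb: "b \<le> start_const * m * (u / u ^ r) + 3 * m / ln n ^ 3"
  proof -
    have "1 \<le> m / ln n ^ 3" using m ln1 by (subst pos_le_divide_eq) auto
    then show ?thesis using b(2) \<tau>N by simp
  qed
  have zb: "?ee * b * (r * ln u) \<le> m * (2 * ?ee * r * start_const / sqrt u + \<gamma> / ln n ^ 2)"
  proof -
    have "b * ln u \<le> (start_const * m * (u / u ^ r) + 3 * m / ln n ^ 3) * ln u"
      using bb lnu by (intro mult_right_mono) auto
    also have "\<dots> = start_const * m * ((u / u ^ r) * ln u) + 3 * m / ln n ^ 3 * ln u" by (simp add: algebra_simps)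
    also have "\<dots> \<le> start_const * m * (2 / sqrt u) + 3 * m / ln n ^ 3 * (2 * ln n)"
    proof (intro add_mono mult_left_mono)
      have "(u / u ^ r) * ln u \<le> 1 / u * ln u" using u_r lnu by (intro mult_right_mono) auto
      then show "(u / u ^ r) * ln u \<le> 2 / sqrt u" using lnu2 by simp
    qed (use lnu3 start_const m0 ln1 in auto)
    also have "3 * m / ln n ^ 3 * (2 * ln n) = m * (6 / ln n ^ 2)"
      using ln1 by (simp add: power2_eq_square power3_eq_cube field_simps)
    finally have "b * ln u \<le> m * (2 * start_const / sqrt u + 6 / ln n ^ 2)" by (simp add: algebra_simps)
    then have "?ee * r * (b * ln u) \<le> ?ee * r * (m * (2 * start_const / sqrt u + 6 / ln n ^ 2))"
      by (intro mult_left_mono) auto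
    then show ?thesis unfolding \<gamma>_def by (simp add: algebra_simps)
  qed
  have "z ^ (?ee * b) = exp (?ee * b * (r * ln u))"
  proof -
    have "exp (real (r * (?ee * b)) * ln u) = u ^ (r * (?ee * b))"
      unfolding exp_of_nat_mult using u1 by simp
    then show ?thesis unfolding z_def by (simp add: power_mult[symmetric] mult_ac)
  qed
  moreover have "(1 + 2 * p / z) ^ card C \<le> exp (N * (2 * p / z))"
  proof -
    have "(1 + 2 * p / z) ^ card C \<le> exp (2 * p / z) ^ card C"
      using p0 z1 by (intro power_mono exp_ge_add_one_self) auto
    then show ?thesis unfolding N_def exp_of_nat_mult .
  qed
  ultimately have "z ^ (?ee * b) * (1 + 2 * p / z) ^ card C \<le>
      exp (?ee * b * (r * ln u)) * exp (N * (2 * p / z))" by simp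
  also have "\<dots> = exp (?ee * b * (r * ln u) + N * (2 * p / z))" by (simp add: exp_add)
  also have "\<dots> \<le> exp (m * (\<beta> * sqrt (N1 / card C) + \<gamma> / ln n ^ 2))"
  proof -
    have "sqrt (N1 / card C) = 1 / sqrt u" unfolding u_def N_def[symmetric] by (simp add: real_sqrt_divide)
    then have "m * (\<beta> * sqrt (N1 / card C) + \<gamma> / ln n ^ 2) =
       m * (2 * ?ee * r * start_const / sqrt u + \<gamma> / ln n ^ 2) + m * (2 * start_const / sqrt u)"
      unfolding \<beta>_def by (simp add: algebra_simps add_divide_distrib)
    then show ?thesis using zb xz by simp
  qed
  finally have "z ^ (?ee * b) * (1 + 2 * p / z) ^ card C * M \<le>
     exp (m * (\<beta> * sqrt (N1 / card C) + \<gamma> / ln n ^ 2)) * M" using M(1) by (rule mult_right_mono)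
  then show ?thesis using main by linarith
qed

text \<open>A container step shrinks the edge set by the factor \<open>\<theta>^2\<close>, so
  \<open>sqrt (N1 / |C|)\<close> runs through a geometric progression with ratio
  \<open>\<theta>\<close>.\<close>

definition \<theta> :: real where "\<theta> = sqrt (1 - 1 / (4 * shrink_const))"

lemma \<theta>: "\<theta> > 0" "\<theta> < 1" "\<theta> ^ 2 = 1 - 1 / (4 * shrink_const)"
proof -
  have "0 < 1 / (4 * shrink_const)" "1 / (4 * shrink_const) < 1" using shrink_const by auto
  then show "\<theta> > 0" "\<theta> < 1" "\<theta> ^ 2 = 1 - 1 / (4 * shrink_const)" unfolding \<theta>_def by auto
qed

definition sum_const :: real where "sum_const = 2 * start_const + \<beta> / (1 - \<theta>) + (1 / (- ln \<theta>) + 1) * \<gamma>"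

lemma indep_sum_all_pairs_le:
  fixes V :: "'v set" and C :: "'v set set" and p a n m :: real
  defines "n \<equiv> real (card V)"
  defines "m \<equiv> p powr (1 - 1 / r) * n powr (2 - 1 / r)"
  assumes r2: "r \<ge> 2" and V: "finite V" "n \<ge> 3" and C: "\<And>e. e \<in> C \<Longrightarrow> e \<subseteq> V \<and> card e = 2"
    and p: "n powr (- a) * ln n powr log_exponent \<le> p" "p \<le> 1"
    and adm: "admissible a" and m: "m \<ge> ln n ^ 3"
  shows "indep_sum embedding_free (2 * p) {} C \<le> exp (sum_const * m)"
proof -
  define N1 where "N1 = start_const * p powr (- 1 / r) * n powr (2 - 1 / r)"
  have n: "n > 0" using V by auto
  have ln1: "ln n \<ge> 1" by (rule ln_ge_1[OF V(2)])
  have "n \<noteq> 0" "ln n \<noteq> 0" using n ln1 by auto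
  then have lower: "n powr (- a) * ln n powr log_exponent > 0"
    by (intro mult_pos_pos) (simp_all only: powr_gt_zero simp_thms)
  then have p0: "p > 0" using p by linarith
  have m0: "m \<ge> 0" unfolding m_def by simp
  have \<beta>0: "\<beta> \<ge> 0" "\<gamma> \<ge> 0" unfolding \<beta>_def \<gamma>_def using start_const by auto
  have pN1: "p * N1 = start_const * m"
    unfolding N1_def m_def using mult_powr_minus[OF p0, of "1 / r"] by (simp add: mult_ac)
  define g where "g = \<gamma> / ln n ^ 2"
  have g0: "g \<ge> 0" unfolding g_def using \<beta>0 by simp
  have fin: "finite C'" if "C' \<subseteq> C" for C'
    by (rule finite_subset[of _ "Pow V"]) (use that C V in auto)
  have ind: "indep_sum embedding_free (2 * p) {} C' \<le> exp (m * (2 * start_const + (\<Sum>i<j. \<beta> * \<theta> ^ i + g)))"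
    if "C' \<subseteq> C" "card C' * \<theta> ^ (2 * j) \<le> N1" for C' j
    using that
  proof (induction j arbitrary: C')
    case 0
    have "indep_sum embedding_free (2 * p) {} C' \<le> (1 + 2 * p) ^ card C'"
      using fin[OF 0(1)] p0 by (intro indep_sum_le_all) auto
    also have "\<dots> \<le> exp (2 * p) ^ card C'" using p0 by (intro power_mono exp_ge_add_one_self) auto
    also have "\<dots> = exp (card C' * (2 * p))" by (simp add: exp_of_nat_mult)
    also have "\<dots> \<le> exp (N1 * (2 * p))" using 0(2) p0 by simp
    also have "N1 * (2 * p) = m * (2 * start_const)" using pN1 by (simp add: mult_ac)
    finally show ?case by simp
  next
    case (Suc j)
    let ?s = "\<lambda>j. 2 * start_const + (\<Sum>i<j. \<beta> * \<theta> ^ i + g)"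
    have term0: "\<beta> * \<theta> ^ j + g \<ge> 0" using \<beta>0 g0 \<theta> by simp
    show ?case
    proof (cases "card C' * \<theta> ^ (2 * j) \<le> N1")
      case True
      have "indep_sum embedding_free (2 * p) {} C' \<le> exp (m * ?s j)" by (rule Suc.IH[OF Suc.prems(1) True])
      also have "\<dots> \<le> exp (m * ?s (Suc j))" using m0 term0 by (simp add: mult_left_mono)
      finally show ?thesis .
    next
      case False
      then have big: "N1 < card C' * \<theta> ^ (2 * j)" by simp
      have N10: "N1 \<ge> 0" unfolding N1_def using start_const by simp
      have c0: "real (card C') > 0"
      proof (rule ccontr)
        assume "\<not> real (card C') > 0"
        then show False using big N10 by simp
      qed
      have \<theta>1: "\<theta> ^ (2 * j) \<le> 1" using \<theta> by (intro power_le_one) auto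
      have N1C: "N1 \<le> card C'"
      proof -
        have "card C' * \<theta> ^ (2 * j) \<le> real (card C') * 1" using \<theta>1 by (intro mult_left_mono) auto
        then show ?thesis using big by simp
      qed
      have "indep_sum embedding_free (2 * p) {} C' \<le>
         exp (m * (\<beta> * sqrt (N1 / card C') + \<gamma> / ln n ^ 2)) * exp (m * ?s j)"
        unfolding m_def n_def N1_def
      proof (rule container_step_numeric[OF r2 V(1) V(2)[unfolded n_def] _ p[unfolded n_def] adm
            m[unfolded m_def n_def] N1C[unfolded N1_def n_def]])
        show "e \<subseteq> V \<and> card e = 2" if "e \<in> C'" for e using C that Suc.prems(1) by auto
        fix C'' assume C'': "C'' \<subseteq> C'" "real (card C'') \<le> card C' - card C' / (4 * shrink_const)"
        have "card C' - card C' / (4 * shrink_const) = card C' * \<theta> ^ 2" unfolding \<theta>(3) by (simp add: algebra_simps)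
        then have "card C'' * \<theta> ^ (2 * j) \<le> card C' * \<theta> ^ 2 * \<theta> ^ (2 * j)"
          using C''(2) \<theta> by (intro mult_right_mono) auto
        also have "\<dots> = card C' * \<theta> ^ (2 * Suc j)" by (simp add: power2_eq_square)
        also have "\<dots> \<le> N1" by (rule Suc.prems(2))
        finally have "indep_sum embedding_free (2 * p) {} C'' \<le> exp (m * ?s j)"
          using C''(1) Suc.prems(1) by (intro Suc.IH) auto
        then show "indep_sum embedding_free (2 * p) {} C'' \<le>
          exp (p powr (1 - 1 / r) * real (card V) powr (2 - 1 / r) * ?s j)" unfolding m_def n_def .
      qed simp
      also have "\<dots> = exp (m * (\<beta> * sqrt (N1 / card C') + g + ?s j))"
        unfolding g_def by (simp add: exp_add[symmetric] algebra_simps)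
      also have "\<dots> \<le> exp (m * ?s (Suc j))"
      proof -
        have "N1 / card C' \<le> \<theta> ^ (2 * j)" using big c0 by (simp add: field_simps)
        then have "sqrt (N1 / card C') \<le> sqrt (\<theta> ^ (2 * j))" by simp
        also have "sqrt (\<theta> ^ (2 * j)) = \<theta> ^ j" using \<theta>(1) by (simp add: real_sqrt_unique power_mult[symmetric] mult.commute)
        finally have "\<beta> * sqrt (N1 / card C') \<le> \<beta> * \<theta> ^ j" using \<beta>0 by (intro mult_left_mono) auto
        then have "\<beta> * sqrt (N1 / card C') + g + ?s j \<le> ?s (Suc j)" by simp
        then show ?thesis using m0 by (simp add: mult_left_mono)
      qed
      finally show ?thesis .
    qed
  qed
  (* Enough steps to shrink n^2 pairs to a single one. *)
  define j where "j = nat \<lceil>ln n / (- ln \<theta>)\<rceil>"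
  have ln\<theta>: "- ln \<theta> > 0" using \<theta> by simp
  have j: "ln n / (- ln \<theta>) \<le> j" "j \<le> ln n / (- ln \<theta>) + 1"
  proof -
    have "ln n / (- ln \<theta>) \<ge> 0" using ln1 ln\<theta> by (intro divide_nonneg_pos) auto
    then show "ln n / (- ln \<theta>) \<le> j" "j \<le> ln n / (- ln \<theta>) + 1" unfolding j_def by linarith+
  qed
  have "card C * \<theta> ^ (2 * j) \<le> N1"
  proof -
    have "ln n \<le> j * (- ln \<theta>)" using j(1) ln\<theta> by (simp only: pos_divide_le_eq)
    then have "ln (\<theta> ^ j) \<le> - ln n" using \<theta> by (simp add: ln_realpow)
    also have "- ln n = ln (1 / n)" using n by (simp add: ln_div)
    finally have "\<theta> ^ j \<le> 1 / n" using \<theta> n by simp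
    then have "(\<theta> ^ j) ^ 2 \<le> (1 / n) ^ 2" using \<theta> by (intro power_mono) auto
    then have t: "\<theta> ^ (2 * j) \<le> 1 / n ^ 2" by (simp add: power_mult[symmetric] mult.commute power_divide)
    have "real (card C) \<le> n ^ 2" unfolding n_def by (rule card_pairs_le[OF V(1) C])
    then have "card C * \<theta> ^ (2 * j) \<le> n ^ 2 * (1 / n ^ 2)" using t \<theta> by (intro mult_mono) auto
    also have "\<dots> = 1" using n by simp
    also have "1 \<le> N1"
    proof -
      have "p powr 0 \<le> p powr (- 1 / r)" using p0 p(2) by (intro powr_mono') auto
      moreover have "n powr 0 \<le> n powr (2 - 1 / r)" using V(2) r1 by (intro powr_mono) (auto simp: field_simps)
      ultimately have "1 * 1 * 1 \<le> N1" unfolding N1_def using start_const p0 n by (intro mult_mono) auto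
      then show ?thesis by simp
    qed
    finally show ?thesis .
  qed
  then have "indep_sum embedding_free (2 * p) {} C \<le> exp (m * (2 * start_const + (\<Sum>i<j. \<beta> * \<theta> ^ i + g)))"
    by (intro ind) auto
  also have "\<dots> \<le> exp (m * sum_const)"
  proof -
    have "(\<Sum>i<j. \<beta> * \<theta> ^ i + g) = \<beta> * (\<Sum>i<j. \<theta> ^ i) + j * g" by (simp add: sum.distrib sum_distrib_left)
    also have "\<dots> \<le> \<beta> * (1 / (1 - \<theta>)) + (1 / (- ln \<theta>) + 1) * \<gamma>"
    proof (intro add_mono mult_left_mono)
      have "(\<Sum>i<j. \<theta> ^ i) = (1 - \<theta> ^ j) / (1 - \<theta>)" using \<theta> by (simp add: sum_gp_strict)
      also have "\<dots> \<le> 1 / (1 - \<theta>)" using \<theta> by (intro divide_right_mono) auto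
      finally show "(\<Sum>i<j. \<theta> ^ i) \<le> 1 / (1 - \<theta>)" .
      have "j \<le> (1 / (- ln \<theta>) + 1) * ln n ^ 2"
      proof -
        have l2: "ln n \<le> ln n ^ 2" "1 \<le> ln n ^ 2" using ln1 by (auto simp: power2_eq_square intro: order_trans)
        have "ln n / (- ln \<theta>) \<le> ln n ^ 2 / (- ln \<theta>)" using l2 ln\<theta> by (intro divide_right_mono) auto
        then have "j \<le> ln n ^ 2 / (- ln \<theta>) + ln n ^ 2" using j(2) l2 by linarith
        then show ?thesis by (simp add: algebra_simps)
      qed
      then have "j * g \<le> (1 / (- ln \<theta>) + 1) * ln n ^ 2 * g" using g0 by (intro mult_right_mono) auto
      then show "j * g \<le> (1 / (- ln \<theta>) + 1) * \<gamma>" unfolding g_def using ln1 by simp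
    qed (rule \<beta>0)
    finally have "2 * start_const + (\<Sum>i<j. \<beta> * \<theta> ^ i + g) \<le> sum_const" unfolding sum_const_def by simp
    then show ?thesis using m0 by (simp add: mult_left_mono)
  qed
  finally show ?thesis by (simp add: mult.commute)
qed

end

section \<open>Random graphs\<close>

definition pairs :: "nat \<Rightarrow> nat set set" where
  "pairs N = {e. e \<subseteq> {..<N} \<and> card e = 2}"

lemma finite_pairs: "finite (pairs N)"
  unfolding pairs_def by (rule finite_subset[of _ "Pow {..<N}"]) auto

lemma set_pmf_random_graph:
  "G \<in> set_pmf (random_graph N p) \<Longrightarrow> verts G = {..<N} \<and> edges G \<subseteq> pairs N"
  unfolding random_graph_def Let_def pairs_def by auto

lemma prob_random_graph_contains:
  assumes "I \<subseteq> pairs N" "0 \<le> p" "p \<le> 1"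
  shows "measure_pmf.prob (random_graph N p) {G. I \<subseteq> edges G} = p ^ card I"
proof -
  let ?Q = "Pi_pmf (pairs N) False (\<lambda>_. bernoulli_pmf p)"
  have "measure_pmf.prob (random_graph N p) {G. I \<subseteq> edges G} =
      measure_pmf.prob ?Q (Pi (pairs N) (\<lambda>e. if e \<in> I then {True} else UNIV))"
    unfolding random_graph_def Let_def pairs_def[symmetric] measure_map_pmf
    by (rule arg_cong[where f = "measure_pmf.prob ?Q"]) (use assms(1) in \<open>auto simp: Pi_def\<close>)
  also have "\<dots> = (\<Prod>e\<in>pairs N. measure_pmf.prob (bernoulli_pmf p) (if e \<in> I then {True} else UNIV))"
    by (rule measure_Pi_pmf_Pi[OF finite_pairs])
  also have "\<dots> = (\<Prod>e\<in>pairs N. if e \<in> I then p else 1)"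
    using assms by (intro prod.cong) (auto simp: measure_pmf_single)
  also have "\<dots> = (\<Prod>e\<in>I. p)"
    using assms(1) finite_pairs by (intro prod.mono_neutral_cong_right) auto
  finally show ?thesis by simp
qed

context semi_bounded_pattern
begin

text \<open>For the whole pattern \<open>\<nu> = S \<union> T\<close> the inequality
  \<open>a(\<nu>) \<le> 1\<close> says that \<open>|\<nu>| \<le> e(\<nu>) + 1\<close>, which holds as
  every vertex of \<open>T\<close> other than \<open>vs\<close> contributes an edge besides the edges
  at \<open>vs\<close>.\<close>

lemma admissible_le_1:
  assumes "r \<ge> 2" "card pattern_edges \<ge> 2" "admissible a"
  shows "a \<le> 1"
proof -
  let ?e = "card pattern_edges"
  have U: "\<Union>pattern_edges = S \<union> T"
  proof
    show "\<Union>pattern_edges \<subseteq> S \<union> T" using pattern_edge_subset by auto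
    have "b \<in> \<Union>pattern_edges" if "b \<in> T" for b
      using Nb[OF that] that unfolding pattern_edges_def by blast
    moreover have "s \<in> \<Union>pattern_edges" if "s \<in> S" for s
      using that vsT Nbvs unfolding pattern_edges_def by blast
    ultimately show "S \<union> T \<subseteq> \<Union>pattern_edges" by auto
  qed
  have ne: "pattern_edges \<noteq> {}" using assms(2) by auto
  have "ext_exp (S \<union> T) vs + f_nat (S \<union> T) = ?e"
    using vsT card_Nb_le by (intro ext_exp_f_nat) auto
  moreover have "ext_exp (S \<union> T) vs = 0"
  proof -
    have d: "S - (S \<union> T) = {}" "T - (S \<union> T) - {vs} = {}" by auto
    show ?thesis unfolding ext_exp_def d using vsT by simp
  qed
  ultimately have f: "f_nat (S \<union> T) = ?e" by simp
  have e: "e_nat (S \<union> T) = ?e"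
  proof -
    have "{e \<in> pattern_edges. e \<subseteq> S \<union> T} = pattern_edges" using pattern_edge_subset by auto
    then show ?thesis unfolding e_nat_def by simp
  qed
  have less: "real ?e - 1 < real r * (real ?e - 1)"
  proof -
    have "real ?e - 1 < 2 * (real ?e - 1)" using assms(2) by simp
    also have "\<dots> \<le> real r * (real ?e - 1)" using assms by (intro mult_right_mono) auto
    finally show ?thesis .
  qed
  have "pattern_edges \<subseteq> pattern_edges \<and> pattern_edges \<noteq> {} \<and>
      real (f_nat (\<Union>pattern_edges)) - 1 < real r * (real (e_nat (\<Union>pattern_edges)) - 1)"
    using ne less unfolding U f e by simp
  from assms(3)[unfolded admissible_def, rule_format, OF this]
  have ineq: "a * (real r * (real ?e - 1) + 1 - real ?e) \<le> real r * (real (card (S \<union> T)) - 2) + 1 - real ?e"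
    unfolding U f e .
  have "card (S \<union> T) \<le> ?e + 1"
  proof -
    have "(\<Sum>b\<in>T - {vs}. 1) \<le> (\<Sum>b\<in>T - {vs}. card (Nb b))"
    proof (intro sum_mono)
      fix b assume "b \<in> T - {vs}"
      then have "Nb b \<noteq> {}" "finite (Nb b)" using Nb finNb by auto
      then show "1 \<le> card (Nb b)" by (simp add: Suc_le_eq card_gt_0_iff)
    qed
    then have "card T - 1 \<le> (\<Sum>b\<in>T - {vs}. card (Nb b))" using vsT finT by simp
    moreover have "?e = card S + (\<Sum>b\<in>T - {vs}. card (Nb b))"
      unfolding card_pattern_edges using sum.remove[OF finT vsT, of "\<lambda>b. card (Nb b)"] Nbvs by simp
    ultimately show ?thesis using card_Un_disjoint[OF finS finT disj] cardT by linarith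
  qed
  then have "real (card (S \<union> T)) - 2 \<le> real ?e - 1" by linarith
  then have "real r * (real (card (S \<union> T)) - 2) \<le> real r * (real ?e - 1)" by (intro mult_left_mono) auto
  then have "real r * (real (card (S \<union> T)) - 2) + 1 - real ?e \<le> 1 * (real r * (real ?e - 1) + 1 - real ?e)"
    by simp
  with ineq have "a * (real r * (real ?e - 1) + 1 - real ?e) \<le> 1 * (real r * (real ?e - 1) + 1 - real ?e)"
    by (rule order_trans)
  then show ?thesis by (rule mult_right_le_imp_le) (use less in simp)
qed

definition turan_const :: real where "turan_const = (sum_const + 1) / ln 2"

lemma sum_const_nonneg: "sum_const \<ge> 0"
proof -
  have pos: "\<beta> \<ge> 0" "\<gamma> \<ge> 0" unfolding \<beta>_def \<gamma>_def using start_const by auto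
  have "- ln \<theta> > 0" using \<theta> by simp
  then have "1 / (- ln \<theta>) > 0" by (rule divide_pos_pos[OF zero_less_one])
  then have "(1 / (- ln \<theta>) + 1) * \<gamma> \<ge> 0" using pos by (intro mult_nonneg_nonneg) linarith+
  moreover have "\<beta> / (1 - \<theta>) \<ge> 0" using \<theta> pos by simp
  ultimately show ?thesis unfolding sum_const_def using start_const by linarith
qed

lemma turan_const_ge: "turan_const \<ge> 1"
proof -
  have "ln 2 \<le> (1::real)" using ln_le_minus_one[of "2::real"] by simp
  then have "ln 2 \<le> sum_const + 1" using sum_const_nonneg by linarith
  then show ?thesis unfolding turan_const_def by (simp add: pos_le_divide_eq)
qed

lemma prob_dense_embedding_free_subset:
  fixes p a n m :: real and N :: nat
  defines "n \<equiv> real N"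
  defines "m \<equiv> p powr (1 - 1 / r) * n powr (2 - 1 / r)"
  assumes r2: "r \<ge> 2" and n: "n \<ge> 3"
    and p: "n powr (- a) * ln n powr log_exponent \<le> p" "p \<le> 1"
    and adm: "admissible a" and m: "m \<ge> ln n ^ 3"
  shows "measure_pmf.prob (random_graph N p)
    {G. \<exists>I\<subseteq>edges G. embedding_free I \<and> real (card I) > turan_const * m} \<le> exp (- m)"
proof -
  let ?Q = "random_graph N p"
  define Bad where "Bad = {I. I \<subseteq> pairs N \<and> embedding_free I \<and> real (card I) > turan_const * m}"
  have finB: "finite Bad" by (rule finite_subset[of _ "Pow (pairs N)"]) (auto simp: Bad_def finite_pairs)
  have p0: "p \<ge> 0"
  proof -
    have "0 \<le> n powr (- a) * ln n powr log_exponent" by simp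
    then show ?thesis using p(1) by linarith
  qed
  have small: "p ^ card I \<le> exp (- (sum_const + 1) * m) * (2 * p) ^ card I" if "I \<in> Bad" for I
  proof -
    have "exp ((sum_const + 1) * m) = exp (turan_const * m * ln 2)" unfolding turan_const_def by simp
    also have "\<dots> \<le> exp (card I * ln 2)" using that unfolding Bad_def by simp
    also have "\<dots> = 2 ^ card I" by (simp add: exp_of_nat_mult)
    finally have "exp ((sum_const + 1) * m) * p ^ card I \<le> 2 ^ card I * p ^ card I" using p0 by (intro mult_right_mono) auto
    then have "exp (- (sum_const + 1) * m) * (exp ((sum_const + 1) * m) * p ^ card I) \<le> exp (- (sum_const + 1) * m) * (2 * p) ^ card I"
      unfolding power_mult_distrib by (intro mult_left_mono) auto
    moreover have "exp (- (sum_const + 1) * m) * (exp ((sum_const + 1) * m) * p ^ card I) = p ^ card I"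
    proof -
      have "exp (- (sum_const + 1) * m) * exp ((sum_const + 1) * m) = 1"
        unfolding exp_add[symmetric] by (simp add: algebra_simps)
      then show ?thesis by (simp only: mult.assoc[symmetric] mult_1)
    qed
    ultimately show ?thesis by (simp only:)
  qed
  have "measure_pmf.prob ?Q {G. \<exists>I\<subseteq>edges G. embedding_free I \<and> real (card I) > turan_const * m} =
     measure_pmf.prob ?Q ({G. \<exists>I\<subseteq>edges G. embedding_free I \<and> real (card I) > turan_const * m} \<inter> set_pmf ?Q)"
    by (rule measure_Int_set_pmf[symmetric])
  also have "\<dots> \<le> measure_pmf.prob ?Q (\<Union>I\<in>Bad. {G. I \<subseteq> edges G})"
  proof (intro measure_pmf.finite_measure_mono subsetI)
    fix G assume G: "G \<in> {G. \<exists>I\<subseteq>edges G. embedding_free I \<and> real (card I) > turan_const * m} \<inter> set_pmf ?Q"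
    then obtain I where I: "I \<subseteq> edges G" "embedding_free I" "real (card I) > turan_const * m" by auto
    have "edges G \<subseteq> pairs N" using set_pmf_random_graph G by blast
    then have "I \<in> Bad" using I unfolding Bad_def by auto
    then show "G \<in> (\<Union>I\<in>Bad. {G. I \<subseteq> edges G})" using I(1) by blast
  qed simp
  also have "\<dots> \<le> (\<Sum>I\<in>Bad. measure_pmf.prob ?Q {G. I \<subseteq> edges G})"
    by (rule measure_pmf.finite_measure_subadditive_finite[OF finB]) auto
  also have "\<dots> = (\<Sum>I\<in>Bad. p ^ card I)"
    by (intro sum.cong refl prob_random_graph_contains p0 p(2)) (auto simp: Bad_def)
  also have "\<dots> \<le> (\<Sum>I\<in>Bad. exp (- (sum_const + 1) * m) * (2 * p) ^ card I)" by (intro sum_mono small)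
  also have "\<dots> = exp (- (sum_const + 1) * m) * (\<Sum>I\<in>Bad. (2 * p) ^ card I)" by (simp add: sum_distrib_left)
  also have "\<dots> \<le> exp (- (sum_const + 1) * m) * indep_sum embedding_free (2 * p) {} (pairs N)"
    unfolding indep_sum_def using finite_pairs p0 by (intro mult_left_mono sum_mono2) (auto simp: Bad_def)
  also have "\<dots> \<le> exp (- (sum_const + 1) * m) * exp (sum_const * m)"
  proof (intro mult_left_mono)
    have "indep_sum embedding_free (2 * p) {} (pairs N) \<le>
       exp (sum_const * (p powr (1 - 1 / r) * real (card {..<N}) powr (2 - 1 / r)))"
      by (rule indep_sum_all_pairs_le[of "{..<N}" _ a])
         (use r2 n p adm m in \<open>auto simp: n_def m_def pairs_def\<close>)
    then show "indep_sum embedding_free (2 * p) {} (pairs N) \<le> exp (sum_const * m)" unfolding m_def n_def by simp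
  qed simp
  also have "\<dots> = exp (- m)" by (simp add: exp_add[symmetric] algebra_simps)
  finally show ?thesis .
qed

end

text \<open>Isolated vertices of \<open>F\<close> go to any unused vertices of \<open>H\<close>.\<close>

lemma copy_from_embedding:
  assumes F: "simple_graph F" and H: "simple_graph H" "card (verts F) \<le> card (verts H)"
    and \<phi>: "inj_on \<phi> (\<Union>(edges F))" "\<And>e. e \<in> edges F \<Longrightarrow> \<phi> ` e \<in> edges H"
  shows "contains_copy F H"
proof -
  let ?U = "\<Union>(edges F)"
  have fin: "finite (verts F)" "finite (verts H)" using F H unfolding simple_graph_def by auto
  have U: "?U \<subseteq> verts F" using F unfolding simple_graph_def by auto
  have img: "\<phi> ` ?U \<subseteq> verts H" using \<phi>(2) H(1) unfolding simple_graph_def by blast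
  have finU: "finite ?U" using U fin(1) finite_subset by auto
  have le: "card (verts F - ?U) \<le> card (verts H - \<phi> ` ?U)"
    using H(2) card_Diff_subset[OF finU U] card_Diff_subset[OF finite_imageI[OF finU] img] card_image[OF \<phi>(1)]
    by simp
  obtain g where g: "g ` (verts F - ?U) \<subseteq> verts H - \<phi> ` ?U" "inj_on g (verts F - ?U)"
    using card_le_inj[OF finite_Diff[OF fin(1)] finite_Diff[OF fin(2)] le] by (elim exE conjE)
  define \<psi> where "\<psi> x = (if x \<in> ?U then \<phi> x else g x)" for x
  have \<psi>U: "\<psi> ` A = \<phi> ` A" if "A \<subseteq> ?U" for A using that by (intro image_cong) (auto simp: \<psi>_def)
  have \<psi>D: "\<psi> ` (verts F - ?U) = g ` (verts F - ?U)" by (intro image_cong) (auto simp: \<psi>_def)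
  have split: "verts F = ?U \<union> (verts F - ?U)" using U by auto
  have "inj_on \<psi> (?U \<union> (verts F - ?U))"
  proof (subst inj_on_Un, intro conjI)
    show "inj_on \<psi> ?U" using \<phi>(1) by (auto simp: inj_on_def \<psi>_def)
    show "inj_on \<psi> (verts F - ?U)" using g(2) by (auto simp: inj_on_def \<psi>_def)
    have "?U - (verts F - ?U) = ?U" "verts F - ?U - ?U = verts F - ?U" by auto
    then show "\<psi> ` (?U - (verts F - ?U)) \<inter> \<psi> ` (verts F - ?U - ?U) = {}"
      using g(1) \<psi>U[of ?U] \<psi>D by auto
  qed
  then have "inj_on \<psi> (verts F)" using split by simp
  moreover have "\<psi> ` verts F \<subseteq> verts H"
  proof -
    have "\<psi> ` verts F = \<psi> ` ?U \<union> \<psi> ` (verts F - ?U)" using split by (metis image_Un)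
    then show ?thesis using g(1) \<psi>U[of ?U] \<psi>D img by auto
  qed
  moreover have "\<forall>e\<in>edges F. \<psi> ` e \<in> edges H" using \<phi>(2) \<psi>U by (metis Union_upper)
  ultimately show ?thesis unfolding contains_copy_def by blast
qed

text \<open>A subgraph with fewer vertices than \<open>F\<close> may fail to contain \<open>F\<close> for lack
  of vertices even if its edges contain the edges of a copy; such subgraphs have boundedly many edges,
  which is the reason for the last assumption.\<close>

lemma extremal_number_le:
  assumes F: "simple_graph F" "edges F \<noteq> {}" and G: "simple_graph G"
    and free: "\<And>I. I \<subseteq> edges G \<Longrightarrow>
       \<not> (\<exists>\<phi>. inj_on \<phi> (\<Union>(edges F)) \<and> (\<forall>e\<in>edges F. \<phi> ` e \<in> I)) \<Longrightarrow> real (card I) \<le> B"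
    and B: "real (card (verts F)) ^ 2 \<le> B"
  shows "real (extremal_number G F) \<le> B"
proof -
  let ?A = "{card (edges H) | H. subgraph H G \<and> \<not> contains_copy F H}"
  have finG: "finite (edges G)"
    by (rule finite_subset[of _ "Pow (verts G)"]) (use G in \<open>auto simp: simple_graph_def\<close>)
  have "?A \<subseteq> {..card (edges G)}" using finG by (auto simp: subgraph_def intro: card_mono)
  then have fin: "finite ?A" using finite_subset by blast
  have "subgraph ({}, {}) G" by (auto simp: subgraph_def simple_graph_def)
  moreover have "\<not> contains_copy F ({}, {})" using F(2) by (auto simp: contains_copy_def)
  ultimately have ne: "?A \<noteq> {}" by blast
  have "extremal_number G F \<in> ?A" unfolding extremal_number_def by (rule Max_in[OF fin ne])
  then obtain H where H: "extremal_number G F = card (edges H)" "subgraph H G" "\<not> contains_copy F H" by blast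
  have sH: "simple_graph H" "edges H \<subseteq> edges G" using H(2) unfolding subgraph_def by auto
  show ?thesis
  proof (cases "card (verts F) \<le> card (verts H)")
    case True
    then have "\<not> (\<exists>\<phi>. inj_on \<phi> (\<Union>(edges F)) \<and> (\<forall>e\<in>edges F. \<phi> ` e \<in> edges H))"
      using copy_from_embedding[OF F(1) sH(1)] H(3) by blast
    then show ?thesis unfolding H(1) using free sH(2) by blast
  next
    case False
    have "real (card (edges H)) \<le> real (card (verts H)) ^ 2"
      by (rule card_pairs_le) (use sH(1) in \<open>auto simp: simple_graph_def\<close>)
    also have "\<dots> \<le> real (card (verts F)) ^ 2" using False by (intro power_mono) auto
    finally show ?thesis unfolding H(1) using B by linarith
  qed
qed

locale semi_bounded_graph =
  fixes F :: "'a ugraph" and S T :: "'a set" and vstar :: 'a and r :: nat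
  assumes r1: "r \<ge> 1" and simple: "simple_graph F" and semi: "semi_bounded r F S T vstar"
    and cyc: "contains_cycle F"
begin

definition Nbh :: "'a \<Rightarrow> 'a set" where "Nbh b = {a \<in> S. {a, b} \<in> edges F}"

text \<open>Isolated vertices of \<open>F\<close> in \<open>T\<close> are discarded; they are in no
  \<open>\<nu> \<in> A_F\<close>.\<close>

definition T' :: "'a set" where "T' = {b \<in> T. Nbh b \<noteq> {}}"

lemma bip: "S \<union> T = verts F" "S \<inter> T = {}" "\<And>e. e \<in> edges F \<Longrightarrow> \<exists>s\<in>S. \<exists>t\<in>T. e = {s, t}"
  "vstar \<in> T" "\<And>s. s \<in> S \<Longrightarrow> {s, vstar} \<in> edges F" "\<And>v. v \<in> T - {vstar} \<Longrightarrow> degree F v \<le> r"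
  using semi unfolding semi_bounded_def bipartition_def by auto

lemma fin: "finite S" "finite T"
  using simple bip(1) unfolding simple_graph_def by (metis finite_Un)+

lemma edges_at: "b \<in> T \<Longrightarrow> {e \<in> edges F. b \<in> e} = (\<lambda>a. {a, b}) ` Nbh b"
proof (intro equalityI subsetI)
  fix e assume b: "b \<in> T" "e \<in> {e \<in> edges F. b \<in> e}"
  then obtain s t where st: "s \<in> S" "t \<in> T" "e = {s, t}" using bip(3) by blast
  then have "b = t" using b bip(2) by auto
  then show "e \<in> (\<lambda>a. {a, b}) ` Nbh b" using st b unfolding Nbh_def by auto
qed (auto simp: Nbh_def)

lemma degree_eq: "b \<in> T \<Longrightarrow> degree F b = card (Nbh b)"
  unfolding degree_def
  by (subst edges_at, assumption, rule card_image) (auto simp: inj_on_def doubleton_eq_iff)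

lemma exists_edge: "edges F \<noteq> {}"
proof -
  obtain vs where vs: "length vs \<ge> 3" "\<forall>i<length vs. {vs ! i, vs ! (Suc i mod length vs)} \<in> edges F"
    using cyc unfolding contains_cycle_def by auto
  then have "{vs ! 0, vs ! (Suc 0 mod length vs)} \<in> edges F" by (cases vs) auto
  then show ?thesis by auto
qed

text \<open>A cycle alternates between \<open>S\<close> and \<open>T\<close>, so it has two distinct vertices in
  \<open>T\<close>, and each of them has two neighbours on the cycle.\<close>

lemma degree_two_vertex: "\<exists>b\<in>T - {vstar}. card (Nbh b) \<ge> 2"
proof -
  obtain vs where vs: "length vs \<ge> 3" "distinct vs"
    "\<And>i. i < length vs \<Longrightarrow> {vs ! i, vs ! (Suc i mod length vs)} \<in> edges F"
    using cyc unfolding contains_cycle_def by auto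
  define l where "l = length vs"
  have l: "l \<ge> 3" using vs(1) l_def by simp
  define c where "c i = vs ! (i mod l)" for i
  have edge: "{c i, c (Suc i)} \<in> edges F" for i
  proof -
    have "i mod length vs < length vs" using vs(1) by (intro mod_less_divisor) linarith
    from vs(3)[OF this] show ?thesis unfolding c_def l_def by (simp add: mod_Suc_eq)
  qed
  have neq: "c i \<noteq> c (i + 2)" for i
  proof
    assume "c i = c (i + 2)"
    then have "i mod l = (i + 2) mod l"
    proof -
      have "k mod length vs < length vs" for k using vs(1) by (intro mod_less_divisor) linarith
      with \<open>c i = c (i + 2)\<close> show ?thesis
        unfolding c_def l_def by (simp add: nth_eq_iff_index_eq[OF vs(2)])
    qed
    then have "l dvd (i + 2) - i" by (metis le_add1 mod_eq_dvd_iff_nat)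
    then show False using l by (auto dest: dvd_imp_le)
  qed
  have one: "c i \<in> T \<longleftrightarrow> c (Suc i) \<in> S" "c i \<in> S \<longleftrightarrow> c (Suc i) \<in> T" for i
  proof -
    obtain s t where "s \<in> S" "t \<in> T" "{c i, c (Suc i)} = {s, t}" using bip(3)[OF edge] by blast
    then show "c i \<in> T \<longleftrightarrow> c (Suc i) \<in> S" "c i \<in> S \<longleftrightarrow> c (Suc i) \<in> T"
      using bip(2) by (auto simp: doubleton_eq_iff)
  qed
  have two: "card (Nbh (c (Suc i))) \<ge> 2" if "c (Suc i) \<in> T" for i
  proof -
    have "c i \<in> S" "c (i + 2) \<in> S" using that one[of i] one[of "Suc i"] by auto
    moreover have "{c i, c (Suc i)} \<in> edges F" "{c (i + 2), c (Suc i)} \<in> edges F"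
      using edge[of i] edge[of "Suc i"] by (auto simp: insert_commute)
    ultimately have "{c i, c (i + 2)} \<subseteq> Nbh (c (Suc i))" unfolding Nbh_def by auto
    moreover have "finite (Nbh (c (Suc i)))" unfolding Nbh_def using fin by auto
    ultimately have "card {c i, c (i + 2)} \<le> card (Nbh (c (Suc i)))" by (intro card_mono)
    then show ?thesis using neq[of i] by simp
  qed
  obtain i where i: "c (Suc i) \<in> T"
  proof -
    obtain s t where "s \<in> S" "t \<in> T" "{c 1, c 2} = {s, t}" using bip(3)[OF edge[of 1]] by (auto simp: numeral_2_eq_2)
    then have "c (Suc 0) \<in> T \<or> c (Suc 1) \<in> T" by (auto simp: doubleton_eq_iff numeral_2_eq_2)
    then show ?thesis using that by blast
  qed
  (* Two steps along the cycle lead back to T, at a different vertex. *)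
  then have i2: "c (Suc (i + 2)) \<in> T" using one[of "Suc i"] one[of "Suc (Suc i)"] by simp
  have "c (Suc i) \<noteq> c (Suc (i + 2))" using neq[of "Suc i"] by simp
  then show ?thesis using two[OF i] two[OF i2] i i2 by blast
qed

lemma r2: "r \<ge> 2"
proof -
  obtain b where b: "b \<in> T - {vstar}" "card (Nbh b) \<ge> 2" using degree_two_vertex by blast
  then show ?thesis using bip(6)[OF b(1)] degree_eq[of b] by simp
qed

sublocale pat: semi_bounded_pattern S T' vstar Nbh r
proof
  have "S \<noteq> {}" using exists_edge bip(3) by blast
  moreover have Nv: "Nbh vstar = S" unfolding Nbh_def using bip(5) by auto
  ultimately show "vstar \<in> T'" unfolding T'_def using bip(4) by auto
  show "Nbh vstar = S" by (rule Nv)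
  show "finite S" "finite T'" using fin unfolding T'_def by auto
  show "S \<inter> T' = {}" using bip(2) unfolding T'_def by auto
  show "1 \<le> r" by (rule r1)
  show "Nbh b \<subseteq> S \<and> Nbh b \<noteq> {}" if "b \<in> T'" for b using that unfolding T'_def Nbh_def by auto
  show "card (Nbh b) \<le> r" if "b \<in> T' - {vstar}" for b
    using that bip(6)[of b] degree_eq[of b] unfolding T'_def by auto
qed

lemma pattern_edges_eq: "pat.pattern_edges = edges F"
proof
  show "pat.pattern_edges \<subseteq> edges F" unfolding pat.pattern_edges_def Nbh_def by auto
  show "edges F \<subseteq> pat.pattern_edges"
  proof
    fix e assume e: "e \<in> edges F"
    then obtain s t where st: "s \<in> S" "t \<in> T" "e = {s, t}" using bip(3) by blast
    then have "s \<in> Nbh t" unfolding Nbh_def using e by auto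
    moreover from this have "t \<in> T'" unfolding T'_def using st by auto
    ultimately show "e \<in> pat.pattern_edges" unfolding pat.pattern_edges_def using st by blast
  qed
qed

lemma Union_edges: "\<Union>(edges F) = S \<union> T'"
proof
  show "\<Union>(edges F) \<subseteq> S \<union> T'" using pat.pattern_edge_subset unfolding pattern_edges_eq by blast
  have "b \<in> \<Union>(edges F)" if b: "b \<in> T'" for b
  proof -
    obtain a where "a \<in> Nbh b" using b unfolding T'_def by auto
    then have "{a, b} \<in> edges F" unfolding Nbh_def by auto
    then show ?thesis by blast
  qed
  moreover have "s \<in> \<Union>(edges F)" if "s \<in> S" for s using bip(5)[OF that] by blast
  ultimately show "S \<union> T' \<subseteq> \<Union>(edges F)" by auto
qed

lemma card_edges_ge_2: "card pat.pattern_edges \<ge> 2"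
proof -
  obtain b where b: "b \<in> T - {vstar}" "card (Nbh b) \<ge> 2" using degree_two_vertex by auto
  then have "b \<in> T'" unfolding T'_def by auto
  then have "card (Nbh b) \<le> card pat.pattern_edges"
    unfolding pat.card_pattern_edges using pat.finT by (intro member_le_sum) auto
  then show ?thesis using b by linarith
qed

lemma
  assumes \<sigma>: "\<sigma> \<subseteq> edges F" "\<sigma> \<noteq> {}"
  shows min_degree_edge_union: "min_degree (induced F (\<Union>\<sigma>)) \<ge> 1"
    and f_val_edge_union: "f_val F S T (\<Union>\<sigma>) = real (pat.f_nat (\<Union>\<sigma>))"
    and e_num_edge_union: "e_num F (\<Union>\<sigma>) = pat.e_nat (\<Union>\<sigma>)"
proof -
  define \<nu> where "\<nu> = \<Union>\<sigma>"
  note U = pat.edge_union[unfolded pattern_edges_eq, OF \<sigma>, folded \<nu>_def]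
  have fin\<nu>: "finite \<nu>" using U(1) fin pat.finT finite_subset by auto
  have \<nu>0: "\<nu> \<noteq> {}" using U(2) by auto
  have finE: "finite (edges F)" using pat.finite_pattern_edges unfolding pattern_edges_eq .
  have deg: "degree (induced F \<nu>) v \<ge> 1" if v: "v \<in> \<nu>" for v
  proof -
    obtain e where "e \<in> \<sigma>" "v \<in> e" using v \<nu>_def by auto
    then have "e \<in> {e \<in> edges (induced F \<nu>). v \<in> e}" using \<sigma> unfolding induced_def \<nu>_def by auto
    moreover have "finite {e \<in> edges (induced F \<nu>). v \<in> e}" using finE unfolding induced_def by auto
    ultimately have "card {e \<in> edges (induced F \<nu>). v \<in> e} > 0" by (auto simp: card_gt_0_iff)
    then show ?thesis unfolding degree_def by simp
  qed
  have TT: "T \<inter> \<nu> = T' \<inter> \<nu>" using U(1) bip(2) unfolding T'_def by auto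
  have "min_degree (induced F \<nu>) \<ge> 1"
    unfolding min_degree_def using deg fin\<nu> \<nu>0 by (subst Min_ge_iff) (auto simp: induced_def)
  then show "min_degree (induced F (\<Union>\<sigma>)) \<ge> 1" unfolding \<nu>_def .
  show "e_num F (\<Union>\<sigma>) = pat.e_nat (\<Union>\<sigma>)"
    unfolding e_num_def pat.e_nat_def pattern_edges_eq induced_def by simp
  have "{v \<in> T \<inter> \<nu>. degree (induced F \<nu>) v \<ge> 1} = T' \<inter> \<nu>" using deg TT by auto
  moreover have dg: "degree F b = card (Nbh b)" if "b \<in> T' \<inter> \<nu>" for b
    using that degree_eq unfolding T'_def by auto
  moreover have im: "degree F ` (T' \<inter> \<nu>) = (\<lambda>b. card (Nbh b)) ` (T' \<inter> \<nu>)" using dg by (intro image_cong) auto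
  moreover have "(\<Sum>v\<in>T' \<inter> \<nu>. real (degree F v)) = real (\<Sum>b\<in>T' \<inter> \<nu>. card (Nbh b))" using dg by simp
  moreover have "Max ((\<lambda>b. card (Nbh b)) ` (T' \<inter> \<nu>)) \<le> (\<Sum>b\<in>T' \<inter> \<nu>. card (Nbh b))"
  proof (rule Max.boundedI)
    fix x assume "x \<in> (\<lambda>b. card (Nbh b)) ` (T' \<inter> \<nu>)"
    then show "x \<le> (\<Sum>b\<in>T' \<inter> \<nu>. card (Nbh b))" using fin\<nu> by (auto intro: member_le_sum)
  qed (use fin\<nu> U(2) in auto)
  ultimately have "f_val F S T \<nu> = real (pat.f_nat \<nu>)"
    unfolding f_val_def pat.f_nat_def TT by (simp add: of_nat_diff)
  then show "f_val F S T (\<Union>\<sigma>) = real (pat.f_nat (\<Union>\<sigma>))" unfolding \<nu>_def .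
qed

lemma admissible_a_exponent: "pat.admissible (a_exponent r F S T)"
  unfolding pat.admissible_def
proof (intro allI impI)
  fix \<sigma> assume "\<sigma> \<subseteq> pat.pattern_edges \<and> \<sigma> \<noteq> {} \<and>
     real (pat.f_nat (\<Union>\<sigma>)) - 1 < real r * (real (pat.e_nat (\<Union>\<sigma>)) - 1)"
  then have \<sigma>: "\<sigma> \<subseteq> edges F" "\<sigma> \<noteq> {}" and less: "real (pat.f_nat (\<Union>\<sigma>)) - 1 < real r * (real (pat.e_nat (\<Union>\<sigma>)) - 1)"
    unfolding pattern_edges_eq by auto
  define \<nu> where "\<nu> = \<Union>\<sigma>"
  note F = f_val_edge_union[OF \<sigma>, folded \<nu>_def] e_num_edge_union[OF \<sigma>, folded \<nu>_def]
    min_degree_edge_union[OF \<sigma>, folded \<nu>_def]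
  have "\<nu> \<subseteq> verts F" using simple \<sigma> unfolding simple_graph_def \<nu>_def by auto
  moreover have "\<nu> \<noteq> {}"
    using pat.edge_union(2)[unfolded pattern_edges_eq, OF \<sigma>] unfolding \<nu>_def by auto
  ultimately have "\<nu> \<in> A_set r F S T" unfolding A_set_def using F less unfolding \<nu>_def[symmetric] by simp
  moreover have "finite (A_set r F S T)"
    by (rule finite_subset[of _ "Pow (verts F)"]) (use simple in \<open>auto simp: A_set_def simple_graph_def\<close>)
  ultimately have "a_exponent r F S T \<le> a_val r F S T \<nu>" unfolding a_exponent_def by (intro Min_le) auto
  also have "a_val r F S T \<nu> = (real r * (real (card \<nu>) - 2) + 1 - real (pat.f_nat \<nu>)) /
      (real r * (real (pat.e_nat \<nu>) - 1) + 1 - real (pat.f_nat \<nu>))" unfolding a_val_def F ..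
  finally show "a_exponent r F S T * (real r * (real (pat.e_nat (\<Union>\<sigma>)) - 1) + 1 - real (pat.f_nat (\<Union>\<sigma>)))
       \<le> real r * (real (card (\<Union>\<sigma>)) - 2) + 1 - real (pat.f_nat (\<Union>\<sigma>))"
    unfolding \<nu>_def[symmetric] using less[folded \<nu>_def] by (simp add: pos_le_divide_eq)
qed

text \<open>As \<open>p \<ge> n^{-1} log^c n\<close>, the bound \<open>m\<close> on the extremal number is at
  least linear in \<open>n\<close>, so it absorbs constants and logarithms.\<close>

lemma size_lower_bound:
  fixes p a n :: real
  assumes n: "n \<ge> 3" and p: "n powr (- a) * ln n powr pat.log_exponent \<le> p" and a: "a \<le> 1"
  shows "n * ln n ^ 3 \<le> p powr (1 - 1 / r) * n powr (2 - 1 / r)"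
proof -
  have ln1: "ln n \<ge> 1" by (rule ln_ge_1[OF n])
  have r: "real r \<ge> 2" using r2 by simp
  have "n powr (- 1) * ln n powr pat.log_exponent \<le> n powr (- a) * ln n powr pat.log_exponent"
    using a n by (intro mult_right_mono powr_mono) auto
  then have "n powr (- 1) * ln n powr pat.log_exponent \<le> p" using p by linarith
  then have "(n powr (- 1) * ln n powr pat.log_exponent) powr (1 - 1 / r) \<le> p powr (1 - 1 / r)"
    using r by (intro powr_mono2) (auto simp: field_simps)
  also have "(n powr (- 1) * ln n powr pat.log_exponent) powr (1 - 1 / r) =
      n powr (- (1 - 1 / r)) * ln n powr (pat.log_exponent * (1 - 1 / r))"
    unfolding powr_mult powr_powr by simp
  finally have 1: "n powr (- (1 - 1 / r)) * ln n powr (pat.log_exponent * (1 - 1 / r)) \<le> p powr (1 - 1 / r)" .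
  have "ln n powr 3 \<le> ln n powr (pat.log_exponent * (1 - 1 / r))"
  proof (rule powr_mono[OF _ ln1])
    have "pat.log_exponent * (1 - 1 / r) = 3 * (real r - 1) * card pat.pattern_edges"
      unfolding pat.log_exponent_def using r by (simp add: field_simps)
    moreover have "3 * 1 * 1 \<le> 3 * (real r - 1) * card pat.pattern_edges"
      using r card_edges_ge_2 by (intro mult_mono) auto
    ultimately show "3 \<le> pat.log_exponent * (1 - 1 / r)" by simp
  qed
  then have "n powr (- (1 - 1 / r)) * ln n powr 3 \<le> p powr (1 - 1 / r)"
    using 1 by (meson mult_left_mono order_trans powr_ge_zero)
  then have "n powr (- (1 - 1 / r)) * ln n powr 3 * n powr (2 - 1 / r) \<le> p powr (1 - 1 / r) * n powr (2 - 1 / r)"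
    by (intro mult_right_mono) auto
  moreover have "n powr (- (1 - 1 / r)) * n powr (2 - 1 / r) = n"
    using n by (simp add: powr_add[symmetric])
  moreover have "ln n powr 3 = ln n ^ 3" using ln1 by simp
  ultimately show ?thesis by (simp add: mult_ac)
qed

lemma prob_extremal_number_le:
  fixes p :: real and N :: nat
  defines "m \<equiv> p powr (1 - 1 / r) * real N powr (2 - 1 / r)"
  assumes N: "N \<ge> 3" "card (verts F) ^ 2 \<le> N"
    and p: "real N powr (- a_exponent r F S T) * ln (real N) powr pat.log_exponent \<le> p" "p \<le> 1"
  shows "measure_pmf.prob (random_graph N p) {G. real (extremal_number G F) \<le> pat.turan_const * m} \<ge> 1 - exp (- real N)"
proof -
  let ?Q = "random_graph N p"
  let ?a = "a_exponent r F S T"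
  let ?E = "{G. \<exists>I\<subseteq>edges G. pat.embedding_free I \<and> real (card I) > pat.turan_const * m}"
  have a1: "?a \<le> 1" by (rule pat.admissible_le_1[OF r2 card_edges_ge_2 admissible_a_exponent])
  have "real N * ln (real N) ^ 3 \<le> m" unfolding m_def using N by (intro size_lower_bound[OF _ p(1) a1]) auto
  moreover have "ln (real N) \<ge> 1" using N by (intro ln_ge_1) simp
  moreover from this have ln3: "ln (real N) ^ 3 \<ge> 1" by (rule one_le_power)
  moreover have "1 * ln (real N) ^ 3 \<le> real N * ln (real N) ^ 3" "real N * 1 \<le> real N * ln (real N) ^ 3"
    using ln3 N by (intro mult_right_mono mult_left_mono; simp)+
  ultimately have m: "ln (real N) ^ 3 \<le> m" "real N \<le> m" by linarith+
  have "measure_pmf.prob ?Q ?E \<le> exp (- m)"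
    unfolding m_def
    by (rule pat.prob_dense_embedding_free_subset[OF r2 _ p admissible_a_exponent])
       (use N m in \<open>auto simp: m_def\<close>)
  also have "\<dots> \<le> exp (- real N)" using m by simp
  finally have E: "measure_pmf.prob ?Q ?E \<le> exp (- real N)" .
  have good: "real (extremal_number G F) \<le> pat.turan_const * m" if G: "G \<in> set_pmf ?Q" "G \<notin> ?E" for G
  proof (rule extremal_number_le[OF simple exists_edge])
    show "simple_graph G" using set_pmf_random_graph[OF G(1)] unfolding simple_graph_def pairs_def by auto
    show "real (card I) \<le> pat.turan_const * m" if "I \<subseteq> edges G"
      "\<not> (\<exists>\<phi>. inj_on \<phi> (\<Union>(edges F)) \<and> (\<forall>e\<in>edges F. \<phi> ` e \<in> I))" for I
    proof -
      have "pat.embedding_free I" using that(2) unfolding pat.embedding_free_def pattern_edges_eq Union_edges .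
      then show ?thesis using G(2) that(1) by (auto simp: not_less)
    qed
    have "real (card (verts F)) ^ 2 \<le> real N" using of_nat_mono[OF N(2), where 'a = real] by simp
    also have "\<dots> \<le> 1 * m" using m by simp
    also have "\<dots> \<le> pat.turan_const * m" using pat.turan_const_ge m N by (intro mult_right_mono) auto
    finally show "real (card (verts F)) ^ 2 \<le> pat.turan_const * m" .
  qed
  have "1 - exp (- real N) \<le> 1 - measure_pmf.prob ?Q ?E" using E by simp
  also have "\<dots> = measure_pmf.prob ?Q (UNIV - ?E)" using measure_pmf.prob_compl[of ?E ?Q] by simp
  also have "\<dots> = measure_pmf.prob ?Q ((UNIV - ?E) \<inter> set_pmf ?Q)" by (rule measure_Int_set_pmf[symmetric])
  also have "\<dots> \<le> measure_pmf.prob ?Q {G. real (extremal_number G F) \<le> pat.turan_const * m}"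
    using good by (intro measure_pmf.finite_measure_mono) auto
  finally show ?thesis .
qed

end

theorem theorem2p5:
  fixes F :: "'a ugraph" and S T :: "'a set" and vstar :: 'a and r :: nat
  assumes "r \<ge> 1"
    and "simple_graph F"
    and "semi_bounded r F S T vstar"
    and "contains_cycle F"
  shows "\<exists>C::real. C > 0 \<and> (\<exists>K::real. K > 0 \<and>
    (\<forall>p :: nat \<Rightarrow> real.
      (\<forall>\<^sub>F n in sequentially.
         real n powr (- a_exponent r F S T) * ln (real n) powr C \<le> p n \<and> p n \<le> 1) \<longrightarrow>
      (\<lambda>n. measure_pmf.prob (random_graph n (p n))
         {G. real (extremal_number G F)
               \<le> K * (p n powr (1 - 1 / real r) * real n powr (2 - 1 / real r))})
        \<longlonglongrightarrow> 1))"
proof -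
  interpret semi_bounded_graph F S T vstar r
    using assms by unfold_locales
  have C: "pat.log_exponent > 0" unfolding pat.log_exponent_def using r1 pat.card_pattern_edges_pos by simp
  have K: "pat.turan_const > 0" using pat.turan_const_ge by linarith
  show ?thesis
  proof (rule exI[of _ pat.log_exponent], rule conjI[OF C], rule exI[of _ pat.turan_const], rule conjI[OF K], intro allI impI)
    fix p :: "nat \<Rightarrow> real"
    assume p: "\<forall>\<^sub>F n in sequentially.
         real n powr (- a_exponent r F S T) * ln (real n) powr pat.log_exponent \<le> p n \<and> p n \<le> 1"
    let ?P = "\<lambda>n. measure_pmf.prob (random_graph n (p n))
         {G. real (extremal_number G F) \<le> pat.turan_const * (p n powr (1 - 1 / real r) * real n powr (2 - 1 / real r))}"
    show "?P \<longlonglongrightarrow> 1"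
    proof (rule tendsto_sandwich)
      show "\<forall>\<^sub>F n in sequentially. 1 - exp (- real n) \<le> ?P n"
        using p eventually_ge_at_top[of 3] eventually_ge_at_top[of "card (verts F) ^ 2"]
        by eventually_elim (rule prob_extremal_number_le, auto)
      show "\<forall>\<^sub>F n in sequentially. ?P n \<le> 1" by simp
      have "(\<lambda>n. exp (- real n)) \<longlonglongrightarrow> 0"
        by (intro filterlim_compose[OF exp_at_bot] filterlim_compose[OF filterlim_uminus_at_bot_at_top] filterlim_real_sequentially)
      then have "(\<lambda>n. 1 - exp (- real n)) \<longlonglongrightarrow> 1 - 0" by (intro tendsto_diff tendsto_const)
      then show "(\<lambda>n. 1 - exp (- real n)) \<longlonglongrightarrow> 1" by simp
    qed simp
  qed
qed

end
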